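(* Let $1<p<\infty$, $\max\{1,p-1\}\le q<\infty$ and $\lambda>0$. Assume that $|F|\in L^{p-1}_{\mathrm{loc}}(\Omega_T)$ and that $u\in L^q_{\mathrm{loc}}(0,T;W^{1,q}_{\mathrm{loc}}(\Omega;\mathbb{R}^N))$ satisfies $$\iint_{\Omega_T}\bigl(-u\cdot\varphi_t+\mathcal{A}(z,\nabla u)\cdot\nabla\varphi\bigr)\,dz=\iint_{\Omega_T}|F|^{p-2}F\cdot\nabla\varphi\,dz$$ for every $\varphi\in C_0^\infty(\Omega_T;\mathbb{R}^N)$. Then there exists a constant $c=c(n,q,L)$ such that $$\frac1{|Q|}\iint_{Q}\frac{|u-u_{Q}|^{q}}{\rho^{q}}\,dz\le c\,\frac1{|Q|}\iint_{Q}|\nabla u|^{q}\,dz+c\left(\lambda^{2-p}\,\frac1{|Q|}\iint_{Q}(|\nabla u|+|F|)^{p-1}\,dz\right)^q$$ for every parabolic cylinder $Q=Q^\lambda_\rho\Subset\Omega_T$.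
   Context: $\Omega\subset\mathbb{R}^n$, $n\ge1$, is a bounded open domain, $T>0$, $\Omega_T=\Omega\times(0,T)$, $N\ge1$, $0<\nu<L<\infty$. $\mathcal{A}:\Omega_T\times\mathbb{R}^{Nn}\to\mathbb{R}^{Nn}$ is a Carathéodory vector field ($\mathcal{A}(\cdot,\xi)$ measurable for every $\xi$, $\mathcal{A}(z,\cdot)$ continuous for a.e. $z$) with $\nu|\xi|^p\le\mathcal{A}(z,\xi)\cdot\xi$ and $|\mathcal{A}(z,\xi)|\le L|\xi|^{p-1}$ for a.e. $z\in\Omega_T$ and every $\xi\in\mathbb{R}^{Nn}$. $F:\Omega_T\to\mathbb{R}^{Nn}$ is measurable. We write $z=(x,t)$, $dz=dx\,dt$, and $\nabla$ is the gradient in $x$. $u\in L^q_{\mathrm{loc}}(0,T;W^{1,q}_{\mathrm{loc}}(\Omega;\mathbb{R}^N))$ means that for all $\Omega'\Subset\Omega$ and $0<t_1<t_2<T$ one has $u(\cdot,t)\in W^{1,q}(\Omega';\mathbb{R}^N)$ for a.e. $t\in(t_1,t_2)$ and $\int_{t_1}^{t_2}\int_{\Omega'}(|u|^q+|\nabla u|^q)\,dx\,dt<\infty$. The (intrinsic) parabolic cylinder of radius $\rho>0$ with scaling factor $\lambda>0$ centered at $(x_0,t_0)$ is $Q^\lambda_\rho=B_\rho(x_0)\times(t_0-\lambda^{2-p}\rho^2,t_0+\lambda^{2-p}\rho^2)$. $u_Q=\frac1{|Q|}\iint_Q u\,dz$ (componentwise). $Q\Subset\Omega_T$ means that the closure of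 $Q$ is a compact subset of $\Omega_T$. *)

theory Defs
  imports "HOL-Analysis.Analysis"
begin

section \<open>The spaces \<open>\<real>\<^sup>N\<close> and \<open>\<real>\<^sup>N\<^sup>n\<close>\<close>

text \<open>
  The dimension \<open>N\<close> is a term, not a type, so that a constant can be chosen before \<open>N\<close> (constants
  here depend on the space dimension \<open>n = CARD('n)\<close> but not on \<open>N\<close>). A vector with \<open>N\<close> entries is
  a function on the natural numbers vanishing from \<open>N\<close> on. With real entries this is \<open>\<real>\<^sup>N\<close>; with
  entries in \<open>\<real>\<^sup>n\<close> it is \<open>\<real>\<^sup>N\<^sup>n\<close>, the \<open>i\<close>-th entry of a gradient being the gradient of the \<open>i\<close>-th
  component function. The product topology of the function type induces the Euclidean topology on
  \<^term>\<open>vecs N\<close>.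
\<close>

definition vecs :: "nat \<Rightarrow> (nat \<Rightarrow> 'b::euclidean_space) set" where
  "vecs N = {v. \<forall>i\<ge>N. v i = 0}"

definition vinner :: "nat \<Rightarrow> (nat \<Rightarrow> 'b::euclidean_space) \<Rightarrow> (nat \<Rightarrow> 'b) \<Rightarrow> real" where
  "vinner N v w = (\<Sum>i<N. v i \<bullet> w i)"

definition vnorm :: "nat \<Rightarrow> (nat \<Rightarrow> 'b::euclidean_space) \<Rightarrow> real" where
  "vnorm N v = L2_set (\<lambda>i. norm (v i)) {..<N}"

definition compactly_inside :: "'a::topological_space set \<Rightarrow> 'a set \<Rightarrow> bool" where
  "compactly_inside S U \<longleftrightarrow> compact (closure S) \<and> closure S \<subseteq> U"

definition avg :: "'a::euclidean_space set \<Rightarrow> ('a \<Rightarrow> real) \<Rightarrow> real" where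
  "avg S f = integral\<^sup>L (lebesgue_on S) f / measure lebesgue S"

definition vavg :: "'a::euclidean_space set \<Rightarrow> ('a \<Rightarrow> nat \<Rightarrow> real) \<Rightarrow> nat \<Rightarrow> real" where
  "vavg S f = (\<lambda>i. avg S (\<lambda>z. f z i))"

section \<open>Test functions\<close>

primrec Ck :: "nat \<Rightarrow> ('a::euclidean_space \<Rightarrow> real) \<Rightarrow> bool" where
  "Ck 0 f \<longleftrightarrow> continuous_on UNIV f"
| "Ck (Suc k) f \<longleftrightarrow>
     f differentiable_on UNIV \<and> (\<forall>b\<in>Basis. Ck k (\<lambda>x. frechet_derivative f (at x) b))"

text \<open>Elements of \<open>C\<^sub>0\<^sup>\<infinity>(S)\<close> are taken as functions on the whole space, extended by zero.\<close>

definition test_functions :: "'a::euclidean_space set \<Rightarrow> ('a \<Rightarrow> real) set" where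
  "test_functions S = {\<psi>. (\<forall>k. Ck k \<psi>) \<and> compactly_inside {x. \<psi> x \<noteq> 0} S}"

definition test_fields :: "'a::euclidean_space set \<Rightarrow> nat \<Rightarrow> ('a \<Rightarrow> nat \<Rightarrow> real) set" where
  "test_fields S N = {\<phi>. (\<forall>z. \<phi> z \<in> vecs N) \<and> (\<forall>i<N. (\<lambda>z. \<phi> z i) \<in> test_functions S)}"

definition gradient :: "(real^'n \<Rightarrow> real) \<Rightarrow> real^'n \<Rightarrow> real^'n" where
  "gradient f x = (\<chi> j. frechet_derivative f (at x) (axis j 1))"

definition spatial_gradient ::
  "((real^'n) \<times> real \<Rightarrow> nat \<Rightarrow> real) \<Rightarrow> (real^'n) \<times> real \<Rightarrow> nat \<Rightarrow> real^'n" where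
  "spatial_gradient \<phi> z = (\<lambda>i. gradient (\<lambda>x. \<phi> (x, snd z) i) (fst z))"

definition time_derivative ::
  "((real^'n) \<times> real \<Rightarrow> nat \<Rightarrow> real) \<Rightarrow> (real^'n) \<times> real \<Rightarrow> nat \<Rightarrow> real" where
  "time_derivative \<phi> z = (\<lambda>i. deriv (\<lambda>t. \<phi> (fst z, t) i) (snd z))"

section \<open>Lebesgue and Sobolev spaces\<close>

definition vmeasurable ::
  "'a::euclidean_space set \<Rightarrow> nat \<Rightarrow> ('a \<Rightarrow> nat \<Rightarrow> 'b::euclidean_space) \<Rightarrow> bool" where
  "vmeasurable S N f \<longleftrightarrow> (\<forall>i<N. (\<lambda>x. f x i) \<in> borel_measurable (lebesgue_on S))"

definition Lspace ::
  "'a::euclidean_space set \<Rightarrow> real \<Rightarrow> nat \<Rightarrow> ('a \<Rightarrow> nat \<Rightarrow> 'b::euclidean_space) \<Rightarrow> bool" where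
  "Lspace S r N f \<longleftrightarrow>
     vmeasurable S N f \<and> integrable (lebesgue_on S) (\<lambda>x. vnorm N (f x) powr r)"

definition Lspace_loc ::
  "'a::euclidean_space set \<Rightarrow> real \<Rightarrow> nat \<Rightarrow> ('a \<Rightarrow> nat \<Rightarrow> 'b::euclidean_space) \<Rightarrow> bool" where
  "Lspace_loc S r N f \<longleftrightarrow> (\<forall>K. compact K \<and> K \<subseteq> S \<longrightarrow> Lspace K r N f)"

definition weak_gradient ::
  "(real^'n) set \<Rightarrow> (real^'n \<Rightarrow> real) \<Rightarrow> (real^'n \<Rightarrow> real^'n) \<Rightarrow> bool" where
  "weak_gradient S f g \<longleftrightarrow>
     (\<forall>K. compact K \<and> K \<subseteq> S \<longrightarrow> integrable (lebesgue_on K) f \<and> integrable (lebesgue_on K) g) \<and>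
     (\<forall>\<psi>\<in>test_functions S. \<forall>j.
        integral\<^sup>L (lebesgue_on S) (\<lambda>x. f x * gradient \<psi> x $ j) =
        - integral\<^sup>L (lebesgue_on S) (\<lambda>x. g x $ j * \<psi> x))"

text \<open>\<open>v \<in> W\<^sup>1\<^sup>,\<^sup>q(S;\<real>\<^sup>N)\<close> with weak gradient (represented by) \<open>D\<close>.\<close>

definition sobolev ::
  "(real^'n) set \<Rightarrow> real \<Rightarrow> nat \<Rightarrow> (real^'n \<Rightarrow> nat \<Rightarrow> real) \<Rightarrow> (real^'n \<Rightarrow> nat \<Rightarrow> real^'n) \<Rightarrow> bool" where
  "sobolev S q N v D \<longleftrightarrow>
     Lspace S q N v \<and> Lspace S q N D \<and> (\<forall>i<N. weak_gradient S (\<lambda>x. v x i) (\<lambda>x. D x i))"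

text \<open>\<open>u \<in> L\<^sup>q\<^sub>l\<^sub>o\<^sub>c(0,T;W\<^sup>1\<^sup>,\<^sup>q\<^sub>l\<^sub>o\<^sub>c(\<Omega>;\<real>\<^sup>N))\<close> with \<open>\<nabla>u\<close> represented by the jointly measurable function \<open>Du\<close>.\<close>

definition parabolic_sobolev ::
  "(real^'n) set \<Rightarrow> real \<Rightarrow> real \<Rightarrow> nat \<Rightarrow> ((real^'n) \<times> real \<Rightarrow> nat \<Rightarrow> real) \<Rightarrow>
   ((real^'n) \<times> real \<Rightarrow> nat \<Rightarrow> real^'n) \<Rightarrow> bool" where
  "parabolic_sobolev \<Omega> T q N u Du \<longleftrightarrow>
     u \<in> (\<Omega> \<times> {0<..<T}) \<rightarrow> vecs N \<and> Du \<in> (\<Omega> \<times> {0<..<T}) \<rightarrow> vecs N \<and>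
     vmeasurable (\<Omega> \<times> {0<..<T}) N u \<and> vmeasurable (\<Omega> \<times> {0<..<T}) N Du \<and>
     (\<forall>\<Omega>' t1 t2. open \<Omega>' \<and> compactly_inside \<Omega>' \<Omega> \<and> 0 < t1 \<and> t1 < t2 \<and> t2 < T \<longrightarrow>
        (AE t in lebesgue_on {t1<..<t2}. sobolev \<Omega>' q N (\<lambda>x. u (x, t)) (\<lambda>x. Du (x, t))) \<and>
        integrable (lebesgue_on (\<Omega>' \<times> {t1<..<t2}))
          (\<lambda>z. vnorm N (u z) powr q + vnorm N (Du z) powr q))"

section \<open>The parabolic system\<close>

definition caratheodory ::
  "'a::euclidean_space set \<Rightarrow> nat \<Rightarrow> ('a \<Rightarrow> (nat \<Rightarrow> 'b::euclidean_space) \<Rightarrow> nat \<Rightarrow> 'b) \<Rightarrow> bool" where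
  "caratheodory S N A \<longleftrightarrow>
     (\<forall>z\<in>S. A z \<in> vecs N \<rightarrow> vecs N) \<and>
     (\<forall>\<xi>\<in>vecs N. vmeasurable S N (\<lambda>z. A z \<xi>)) \<and>
     (AE z in lebesgue_on S. continuous_on (vecs N) (A z))"

text \<open>At points with \<open>F z = 0\<close> the factor \<open>|F|\<^sup>p\<^sup>-\<^sup>2\<close> is \<open>0\<close>, so \<open>|F|\<^sup>p\<^sup>-\<^sup>2F = 0\<close> there, also for \<open>p < 2\<close>.\<close>

definition weak_solution ::
  "((real^'n) \<times> real) set \<Rightarrow> real \<Rightarrow> nat \<Rightarrow>
   ((real^'n) \<times> real \<Rightarrow> (nat \<Rightarrow> real^'n) \<Rightarrow> nat \<Rightarrow> real^'n) \<Rightarrow>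
   ((real^'n) \<times> real \<Rightarrow> nat \<Rightarrow> real^'n) \<Rightarrow>
   ((real^'n) \<times> real \<Rightarrow> nat \<Rightarrow> real) \<Rightarrow> ((real^'n) \<times> real \<Rightarrow> nat \<Rightarrow> real^'n) \<Rightarrow> bool" where
  "weak_solution S p N A F u Du \<longleftrightarrow>
     (\<forall>\<phi>\<in>test_fields S N.
        integral\<^sup>L (lebesgue_on S)
          (\<lambda>z. - vinner N (u z) (time_derivative \<phi> z)
                + vinner N (A z (Du z)) (spatial_gradient \<phi> z)) =
        integral\<^sup>L (lebesgue_on S)
          (\<lambda>z. vinner N (\<lambda>i. vnorm N (F z) powr (p - 2) *\<^sub>R F z i) (spatial_gradient \<phi> z)))"

definition cylinder :: "real \<Rightarrow> real \<Rightarrow> real^'n \<Rightarrow> real \<Rightarrow> real \<Rightarrow> ((real^'n) \<times> real) set" where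
  "cylinder p lam x0 t0 \<rho> =
     ball x0 \<rho> \<times> {t0 - lam powr (2 - p) * \<rho>\<^sup>2 <..< t0 + lam powr (2 - p) * \<rho>\<^sup>2}"

end

theory Submission
  imports Defs
begin

text \<open>
  The estimate follows from the distributional identity \<open>u\<^sub>t = div G\<close> on the cylinder, where
  \<open>G = A(z, \<nabla>u) - |F|\<^sup>p\<^sup>-\<^sup>2 F\<close> is integrable and satisfies
  \<open>|G| \<le> (L + 1) (|\<nabla>u| + |F|)\<^sup>p\<^sup>-\<^sup>1\<close>. The oscillation of \<open>u\<close> over \<open>Q = B \<times> I\<close> is split by means of a
  smooth bump \<open>\<eta>\<close> in the ball \<open>B\<close> with \<open>\<integral>\<eta> = 1\<close> and the weighted means \<open>m(t) = \<integral> u(x,t) \<eta>(x) dx\<close>.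

  On a time slice, \<open>u - m\<close> is controlled by \<open>\<nabla>u\<close>: by Jensen's inequality
  \<open>|u(x,t) - m(t)|\<^sup>q\<close> is at most \<open>\<integral> |u(x,t) - u(y,t)|\<^sup>q \<eta>(y) dy\<close>, and
  \<open>|u(x,t) - u(y,t)|\<^sup>q \<le> |x - y|\<^sup>q \<integral>\<^sub>0\<^sup>1 |\<nabla>u(y + \<tau>(x - y), t)|\<^sup>q d\<tau>\<close>. When this is integrated over \<open>B \<times> B\<close>, the
  substitution \<open>x \<mapsto> y + \<tau>(x - y)\<close> for \<open>\<tau> \<ge> 1/2\<close>, or the one in \<open>y\<close> for \<open>\<tau> < 1/2\<close>, costs a
  factor of at most \<open>2\<^sup>n\<close>. In time, the equation tested with \<open>\<eta>(x) Z(t)\<close>, where \<open>Z\<close> approximates the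
  indicator of the interval between \<open>s\<close> and \<open>t\<close>, gives
  \<open>|m(t) - m(s)| \<le> sup |\<nabla>\<eta>| \<integral>\<^sub>Q |G|\<close>, and \<open>sup |\<nabla>\<eta>|\<close> is a multiple of \<open>\<rho>\<^sup>-\<^sup>n\<^sup>-\<^sup>1\<close>. Since \<open>|Q|\<close> is a
  multiple of \<open>\<rho>\<^sup>n\<^sup>+\<^sup>2 \<lambda>\<^sup>2\<^sup>-\<^sup>p\<close>, these two estimates are the two terms on the right-hand side.

  To make pointwise sense of \<open>u\<close>, both estimates are proved for the space-time mollification of \<open>u\<close> on a
  slightly smaller cylinder (\<open>mollified_poincare\<close>, \<open>mollified_mean_increment\<close>,
  \<open>mollified_oscillation_bound\<close>), with bounds that do not depend on the mollification parameter. The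
  mollifications converge to \<open>u\<close> in \<open>L\<^sup>1\<close>, hence almost everywhere along a subsequence, and Fatou's
  lemma gives \<open>oscillation_bound\<close> on the whole cylinder. The left-hand side is written as a double
  integral of \<open>|u(z) - u(z')|\<^sup>q\<close> so that no constant has to be followed through the limit; the mean
  \<open>u\<^sub>Q\<close> enters only at the end, by Jensen's inequality.

  All norms of integrals over \<open>\<real>\<^sup>N\<close> are estimated with \<open>vnorm_integral_le\<close>, which keeps the constant
  independent of \<open>N\<close>.
\<close>

section \<open>Norms and means of vector-valued functions\<close>

lemma vnorm_nonneg [simp]: "0 \<le> vnorm N v"
  by (simp add: vnorm_def)

lemma norm_le_vnorm: "i < N \<Longrightarrow> norm (v i) \<le> vnorm N v"
  unfolding vnorm_def by (rule member_le_L2_set) auto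

lemma vnorm_le_sum: "vnorm N v \<le> (\<Sum>i<N. norm (v i))"
  unfolding vnorm_def by (rule L2_set_le_sum) auto

lemma vnorm_triangle: "vnorm N (\<lambda>i. v i + w i) \<le> vnorm N v + vnorm N w"
proof -
  have "vnorm N (\<lambda>i. v i + w i) \<le> L2_set (\<lambda>i. norm (v i) + norm (w i)) {..<N}"
    unfolding vnorm_def by (rule L2_set_mono) (auto intro: norm_triangle_ineq)
  also have "\<dots> \<le> vnorm N v + vnorm N w"
    unfolding vnorm_def by (rule L2_set_triangle_ineq)
  finally show ?thesis .
qed

lemma vnorm_scaleR: "vnorm N (\<lambda>i. c *\<^sub>R v i) = \<bar>c\<bar> * vnorm N v"
  unfolding vnorm_def by (simp add: L2_set_right_distrib)

lemma vnorm_minus_commute: "vnorm N (\<lambda>i. v i - w i) = vnorm N (\<lambda>i. w i - v i)"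
  by (simp add: vnorm_def norm_minus_commute)

lemma vnorm_triangle_diff:
  "vnorm N (\<lambda>i. u i - w i) \<le> vnorm N (\<lambda>i. u i - v i) + vnorm N (\<lambda>i. v i - w i)"
  using vnorm_triangle[of N "\<lambda>i. u i - v i" "\<lambda>i. v i - w i"] by simp

lemma vnorm_inner_le:
  fixes v :: "nat \<Rightarrow> 'a::euclidean_space"
  shows "vnorm N (\<lambda>i. v i \<bullet> h) \<le> vnorm N v * norm h"
proof -
  have "vnorm N (\<lambda>i. v i \<bullet> h) \<le> L2_set (\<lambda>i. norm (v i) * norm h) {..<N}"
    unfolding vnorm_def by (rule L2_set_mono) (auto intro: Cauchy_Schwarz_ineq2)
  thus ?thesis by (simp add: vnorm_def L2_set_left_distrib)
qed

lemma vnorm_square: "(vnorm N v)\<^sup>2 = (\<Sum>i<N. (norm (v i))\<^sup>2)"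
  by (simp add: vnorm_def L2_set_def sum_nonneg)

lemma vinner_le: "vinner N v w \<le> vnorm N v * vnorm N w"
proof -
  have "vinner N v w \<le> (\<Sum>i<N. \<bar>norm (v i)\<bar> * \<bar>norm (w i)\<bar>)"
    unfolding vinner_def by (intro sum_mono) (simp add: norm_cauchy_schwarz)
  also have "\<dots> \<le> vnorm N v * vnorm N w"
    unfolding vnorm_def by (rule L2_set_mult_ineq)
  finally show ?thesis .
qed

lemma vnorm_measurable [measurable (raw)]:
  assumes [measurable]: "\<And>i. i < N \<Longrightarrow> (\<lambda>x. f x i) \<in> borel_measurable M"
  shows "(\<lambda>x. vnorm N (f x)) \<in> borel_measurable M"
  unfolding vnorm_def L2_set_def by measurable

lemma integrable_vnorm:
  assumes "\<And>i. i < N \<Longrightarrow> integrable M (\<lambda>x. f x i)"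
  shows "integrable M (\<lambda>x. vnorm N (f x))"
proof (rule Bochner_Integration.integrable_bound)
  show "integrable M (\<lambda>x. \<Sum>i<N. norm (f x i))"
    using assms by auto
  show "(\<lambda>x. vnorm N (f x)) \<in> borel_measurable M"
    using assms by (intro vnorm_measurable) auto
  show "AE x in M. norm (vnorm N (f x)) \<le> norm (\<Sum>i<N. norm (f x i))"
    using vnorm_le_sum by (intro AE_I2) (simp add: sum_nonneg)
qed

text \<open>
  Pair the integral with itself and apply the Cauchy--Schwarz inequality under the integral sign.
  Summing componentwise bounds instead would produce a constant depending on \<open>N\<close>.
\<close>

lemma vnorm_integral_le:
  fixes f :: "'a \<Rightarrow> nat \<Rightarrow> real"
  assumes f: "\<And>i. i < N \<Longrightarrow> integrable M (\<lambda>x. f x i)"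
  shows "vnorm N (\<lambda>i. \<integral>x. f x i \<partial>M) \<le> (\<integral>x. vnorm N (f x) \<partial>M)"
proof -
  define v where "v i = (\<integral>x. f x i \<partial>M)" for i
  have "(vnorm N v)\<^sup>2 = (\<Sum>i<N. v i * v i)"
    unfolding vnorm_square by (simp add: power2_eq_square)
  also have "\<dots> = (\<Sum>i<N. (\<integral>x. v i * f x i \<partial>M))"
    by (simp add: v_def)
  also have "\<dots> = (\<integral>x. vinner N v (f x) \<partial>M)"
    unfolding vinner_def inner_real_def
    by (rule Bochner_Integration.integral_sum[symmetric]) (use f in auto)
  also have "\<dots> \<le> (\<integral>x. vnorm N v * vnorm N (f x) \<partial>M)"
    using f by (intro integral_mono vinner_le integrable_mult_right integrable_vnorm)
      (auto simp: vinner_def intro!: Bochner_Integration.integrable_sum)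
  finally have "vnorm N v * vnorm N v \<le> vnorm N v * (\<integral>x. vnorm N (f x) \<partial>M)"
    by (simp add: power2_eq_square)
  moreover have "0 \<le> (\<integral>x. vnorm N (f x) \<partial>M)"
    by simp
  ultimately have "vnorm N v \<le> (\<integral>x. vnorm N (f x) \<partial>M)"
    using vnorm_nonneg[of N v] by (cases "vnorm N v = 0") auto
  thus ?thesis unfolding v_def .
qed

lemma powr_above_tangent:
  fixes q m x :: real
  assumes "1 \<le> q" "0 < m" "0 \<le> x"
  shows "m powr q + q * m powr (q - 1) * (x - m) \<le> x powr q"
proof (cases "x = 0")
  case True
  have "m powr (q - 1) * m = m powr q"
    using assms by (simp add: powr_mult_base mult.commute)
  thus ?thesis
    using True assms by (simp add: algebra_simps)
next
  case False
  have "(\<lambda>x. x powr q) x - (\<lambda>x. x powr q) m \<ge> q * m powr (q - 1) * (x - m)"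
    by (rule convex_on_imp_above_tangent[of "{0<..}"])
      (use assms False in \<open>auto intro!: powr_convex derivative_eq_intros simp: interior_open\<close>)
  thus ?thesis by simp
qed

text \<open>
  Jensen's inequality for the power \<open>q\<close> and the probability density \<open>k\<close>.
  The integrals are in the extended half-line and only a lower bound of the mean of
  \<open>f\<close> is assumed, so that it can be applied without integrability of
  \<open>f\<^sup>q\<close>. The proof integrates the tangent inequality at \<open>r\<close>.
\<close>

lemma weighted_powr_mean_le:
  fixes f k :: "'a \<Rightarrow> real"
  assumes [measurable]: "f \<in> borel_measurable M" "k \<in> borel_measurable M"
    and f: "\<And>x. 0 \<le> f x" and k: "\<And>x. 0 \<le> k x" "(\<integral>\<^sup>+x. k x \<partial>M) = 1"
    and q: "1 \<le> q" and r: "0 \<le> r" "ennreal r \<le> (\<integral>\<^sup>+x. f x * k x \<partial>M)"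
  shows "ennreal (r powr q) \<le> (\<integral>\<^sup>+x. f x powr q * k x \<partial>M)"
proof (cases "r = 0 \<or> (\<integral>\<^sup>+x. f x powr q * k x \<partial>M) = \<infinity>")
  case False
  hence r0: "0 < r" using r by simp
  let ?t = "\<lambda>x. r powr q + q * r powr (q - 1) * (f x - r)"
  have intk: "integrable M k"
    using k by (intro integrableI_nonneg) auto
  have intq: "integrable M (\<lambda>x. f x powr q * k x)"
    using False f k by (intro integrableI_nonneg) (auto simp: less_top)
  have le: "f x \<le> 1 + f x powr q" for x
  proof (cases "f x \<le> 1")
    case False
    hence "f x powr 1 \<le> f x powr q" using q by (intro powr_mono) auto
    thus ?thesis using False by simp
  qed (use add_increasing2 powr_ge_zero in blast)
  have intf: "integrable M (\<lambda>x. f x * k x)"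
  proof (rule Bochner_Integration.integrable_bound)
    show "integrable M (\<lambda>x. k x + f x powr q * k x)"
      using intk intq by simp
    show "AE x in M. norm (f x * k x) \<le> norm (k x + f x powr q * k x)"
      using f k(1) mult_right_mono[OF le k(1)] by (intro AE_I2) (simp add: algebra_simps)
  qed simp
  have k1: "(\<integral>x. k x \<partial>M) = 1"
    using k intk by (simp add: integral_eq_nn_integral)
  have "ennreal r \<le> ennreal (\<integral>x. f x * k x \<partial>M)"
    using r(2) intf f k by (subst nn_integral_eq_integral[symmetric]) auto
  hence rle: "r \<le> (\<integral>x. f x * k x \<partial>M)"
    using f k by (subst (asm) ennreal_le_iff) (auto intro!: integral_nonneg)
  have "r powr q \<le> r powr q + q * r powr (q - 1) * ((\<integral>x. f x * k x \<partial>M) - r)"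
    using rle q by simp
  also have "\<dots> = (\<integral>x. r powr q * k x + q * r powr (q - 1) * (f x * k x - r * k x) \<partial>M)"
    using intf intk k1 by simp
  also have "\<dots> \<le> (\<integral>x. f x powr q * k x \<partial>M)"
  proof (rule integral_mono)
    show "r powr q * k x + q * r powr (q - 1) * (f x * k x - r * k x) \<le> f x powr q * k x" for x
      using mult_right_mono[OF powr_above_tangent[OF q r0 f[of x]] k(1)[of x]]
      by (simp add: algebra_simps)
  qed (use intf intk intq in auto)
  finally have "ennreal (r powr q) \<le> ennreal (\<integral>x. f x powr q * k x \<partial>M)"
    by (rule ennreal_leI)
  also have "\<dots> = (\<integral>\<^sup>+x. f x powr q * k x \<partial>M)"
    using intq f k by (subst nn_integral_eq_integral) auto
  finally show ?thesis .
qed (use q in auto)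

section \<open>Smooth functions with compact support\<close>

lemma Ck_Suc_imp: "Ck (Suc k) f \<Longrightarrow> Ck k f"
proof (induction k arbitrary: f)
  case 0
  then show ?case by (simp add: differentiable_imp_continuous_on)
next
  case (Suc k)
  then show ?case by auto
qed

lemma Ck_SucI:
  assumes "\<And>x. (f has_derivative f' x) (at x)" "\<And>b. b \<in> Basis \<Longrightarrow> Ck k (\<lambda>x. f' x b)"
  shows "Ck (Suc k) f"
proof -
  have "frechet_derivative f (at x) = f' x" for x
    using frechet_derivative_at[OF assms(1)] by simp
  moreover have "f differentiable_on UNIV"
    using assms(1) by (auto simp: differentiable_on_def differentiable_def)
  ultimately show ?thesis using assms(2) by simp
qed

lemma Ck_has_derivative:
  "Ck (Suc k) f \<Longrightarrow> (f has_derivative frechet_derivative f (at x)) (at x)"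
  by (auto simp: differentiable_on_def frechet_derivative_works)

lemma Ck_const: "Ck k (\<lambda>x. c)"
proof (induction k arbitrary: c)
  case (Suc k)
  show ?case
    by (rule Ck_SucI[where f'="\<lambda>_ _. 0"]) (auto intro: Suc)
qed simp

lemma Ck_add: "Ck k f \<Longrightarrow> Ck k g \<Longrightarrow> Ck k (\<lambda>x. f x + g x)"
proof (induction k arbitrary: f g)
  case 0
  then show ?case by (auto intro: continuous_intros)
next
  case (Suc k)
  show ?case
    using Suc.prems
    by (intro Ck_SucI[OF has_derivative_add[OF Ck_has_derivative[OF Suc.prems(1)]
            Ck_has_derivative[OF Suc.prems(2)]]] Suc.IH) auto
qed

lemma Ck_mult: "Ck k f \<Longrightarrow> Ck k g \<Longrightarrow> Ck k (\<lambda>x. f x * g x)"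
proof (induction k arbitrary: f g)
  case 0
  then show ?case by (auto intro: continuous_intros)
next
  case (Suc k)
  show ?case
    using Suc.prems Ck_Suc_imp[OF Suc.prems(1)] Ck_Suc_imp[OF Suc.prems(2)]
    by (intro Ck_SucI[OF has_derivative_mult[OF Ck_has_derivative[OF Suc.prems(1)]
            Ck_has_derivative[OF Suc.prems(2)]]] Ck_add Suc.IH) auto
qed

lemma Ck_sum: "(\<And>i. i \<in> I \<Longrightarrow> Ck k (f i)) \<Longrightarrow> Ck k (\<lambda>x. \<Sum>i\<in>I. f i x)"
  by (induction I rule: infinite_finite_induct) (auto intro: Ck_add Ck_const)

text \<open>
  The chain rule for affine maps yields translations, reflections, rescalings and the two
  coordinate projections of a product at once.
\<close>

lemma Ck_affine:
  fixes M :: "'a::euclidean_space \<Rightarrow> 'b::euclidean_space"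
  assumes M: "bounded_linear M"
  shows "Ck k f \<Longrightarrow> Ck k (\<lambda>x. f (M x + c))"
proof (induction k arbitrary: f)
  case 0
  have "continuous_on UNIV M"
    using M by (simp add: linear_continuous_on)
  with 0 show ?case
    by (auto intro!: continuous_on_compose2[of UNIV f] continuous_intros)
next
  case (Suc k)
  have "(f has_derivative frechet_derivative f (at (M x + c))) (at (M x + c))" for x
    using Suc.prems Ck_has_derivative by blast
  hence d: "((\<lambda>x. f (M x + c)) has_derivative (\<lambda>h. frechet_derivative f (at (M x + c)) (M h))) (at x)" for x
    using M by (auto intro!: has_derivative_compose[of "\<lambda>x. M x + c" M _ _ f] derivative_eq_intros
        bounded_linear_imp_has_derivative)
  have "frechet_derivative f (at y) h = (\<Sum>b\<in>Basis. (h \<bullet> b) * frechet_derivative f (at y) b)" for y h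
  proof -
    interpret bounded_linear "frechet_derivative f (at y)"
      using Suc.prems Ck_has_derivative has_derivative_bounded_linear by blast
    show ?thesis
      by (subst (1) euclidean_representation[of h, symmetric]) (simp add: sum scaleR)
  qed
  hence "(\<lambda>x. frechet_derivative f (at (M x + c)) (M e)) =
      (\<lambda>x. \<Sum>b\<in>Basis. (M e \<bullet> b) * frechet_derivative f (at (M x + c)) b)" for e
    by blast
  moreover have "Ck k (\<lambda>x. \<Sum>b\<in>Basis. (M e \<bullet> b) * frechet_derivative f (at (M x + c)) b)" for e
    using Suc.prems by (intro Ck_sum Ck_mult Ck_const Suc.IH) auto
  ultimately show ?case
    by (intro Ck_SucI[OF d]) auto
qed

text \<open>
  The functions \<open>P(1/s) exp(-1/s)\<close>, extended by zero to \<open>s \<le> 0\<close>: a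
  family that contains \<open>exp(-1/s)\<close> and is closed under differentiation.
\<close>

definition exp_inv :: "real poly \<Rightarrow> real \<Rightarrow> real" where
  "exp_inv P s = (if s > 0 then poly P (1/s) * exp (- (1/s)) else 0)"

lemma poly_times_exp_minus_tendsto_0:
  "((\<lambda>y. poly P y * exp (- y)) \<longlongrightarrow> 0) at_top" for P :: "real poly"
proof (induction P)
  case (pCons a P)
  have *: "((\<lambda>y::real. y ^ k * exp (- y)) \<longlongrightarrow> 0) at_top" for k
    using tendsto_power_div_exp_0[of k] by (simp add: exp_minus divide_inverse)
  have "((\<lambda>y. y ^ k * (poly Q y * exp (- y))) \<longlongrightarrow> 0) at_top" for k and Q :: "real poly"
  proof (induction Q arbitrary: k)
    case (pCons b Q)
    have "((\<lambda>y. b * (y ^ k * exp (- y)) + y ^ (Suc k) * (poly Q y * exp (- y))) \<longlongrightarrow> b * 0 + 0) at_top"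
      by (intro tendsto_intros * pCons)
    thus ?case by (simp add: algebra_simps)
  qed simp
  from this[of 0 "pCons a P"] show ?case by simp
qed simp

text \<open>
  With \<open>y = 1/s\<close> the derivative of \<open>P(y) exp(-y)\<close> is \<open>y\<^sup>2
  (P(y) - P'(y)) exp(-y)\<close>. At \<open>0\<close> the difference quotient is \<open>y P(y)
  exp(-y)\<close>, which tends to \<open>0\<close> as \<open>y \<rightarrow> \<infinity>\<close>.
\<close>

lemma exp_inv_has_derivative:
  "(exp_inv P has_real_derivative exp_inv ([:0,0,1:] * (P - pderiv P)) s) (at s)"
proof -
  consider "s > 0" | "s < 0" | "s = 0" by linarith
  thus ?thesis
  proof cases
    case 1
    have "((\<lambda>s. poly P (1/s) * exp (- (1/s))) has_real_derivative
        exp_inv ([:0,0,1:] * (P - pderiv P)) s) (at s)"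
      using 1 by (auto intro!: derivative_eq_intros DERIV_chain2[OF poly_DERIV]
          simp: exp_inv_def field_simps power2_eq_square)
    moreover have "eventually (\<lambda>x. x \<in> {0<..}) (nhds s)"
      using 1 by (intro eventually_nhds_in_open) auto
    ultimately show ?thesis
      by (subst DERIV_cong_ev[OF refl _ refl]) (auto elim!: eventually_mono simp: exp_inv_def)
  next
    case 2
    have "eventually (\<lambda>x. x \<in> {..<0}) (nhds s)"
      using 2 by (intro eventually_nhds_in_open) auto
    hence "(exp_inv P has_real_derivative 0) (at s)"
      by (subst DERIV_cong_ev[OF refl _ refl, where g="\<lambda>_. 0"])
        (auto elim!: eventually_mono simp: exp_inv_def)
    thus ?thesis using 2 by (simp add: exp_inv_def)
  next
    case 3
    have "((\<lambda>h. poly (pCons 0 P) (inverse h) * exp (- inverse h)) \<longlongrightarrow> 0) (at_right 0)"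
      by (rule filterlim_compose[OF poly_times_exp_minus_tendsto_0 filterlim_inverse_at_top_right])
    hence "((\<lambda>h. exp_inv P h / h) \<longlongrightarrow> 0) (at_right 0)"
      by (rule Lim_transform_eventually)
        (auto simp: eventually_at_filter exp_inv_def field_simps)
    moreover have "((\<lambda>h. exp_inv P h / h) \<longlongrightarrow> 0) (at_left 0)"
      by (rule Lim_transform_eventually[OF tendsto_const])
        (auto simp: eventually_at_filter exp_inv_def)
    ultimately have "((\<lambda>h. exp_inv P h / h) \<longlongrightarrow> 0) (at 0)"
      by (intro filterlim_split_at)
    thus ?thesis using 3 by (simp add: DERIV_def exp_inv_def)
  qed
qed

text \<open>
  Differentiating replaces \<open>P\<close> by another polynomial and multiplies by a linear
  function, so the induction runs over all polynomials simultaneously.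
\<close>

lemma Ck_exp_inv_radial:
  "Ck k (\<lambda>x::'a::euclidean_space. exp_inv P (1 - x \<bullet> x))"
proof (induction k arbitrary: P)
  case 0
  have "isCont (exp_inv P) s" for s
    using exp_inv_has_derivative DERIV_isCont by blast
  hence "continuous_on UNIV (exp_inv P)"
    by (simp add: continuous_at_imp_continuous_on)
  thus ?case
    by (auto intro!: continuous_on_compose2[of UNIV "exp_inv P"] continuous_intros)
next
  case (Suc k)
  let ?P = "[:0,0,1:] * (P - pderiv P)"
  have "((\<lambda>x::'a. exp_inv P (1 - x \<bullet> x)) has_derivative
     (\<lambda>h. exp_inv ?P (1 - x \<bullet> x) * (-2 * (h \<bullet> x)))) (at x)" for x
  proof -
    have "((\<lambda>x::'a. 1 - x \<bullet> x) has_derivative (\<lambda>h. -2 * (h \<bullet> x))) (at x)"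
      by (auto intro!: derivative_eq_intros simp: inner_commute)
    from has_derivative_compose[OF this
        exp_inv_has_derivative[of P, unfolded has_field_derivative_def]]
    show ?thesis by simp
  qed
  moreover have "Ck k (\<lambda>x. exp_inv ?P (1 - x \<bullet> x) * (-2 * (b \<bullet> x)))" for b :: 'a
  proof -
    have id: "Ck k (\<lambda>y::real. y)"
    proof (cases k)
      case (Suc j)
      show ?thesis unfolding Suc
        by (rule Ck_SucI[where f'="\<lambda>_ h. h"]) (auto intro!: derivative_eq_intros Ck_const)
    qed auto
    have "Ck k (\<lambda>x. b \<bullet> x + 0)"
      using Ck_affine[OF bounded_linear_inner_right id] .
    thus ?thesis
      by (intro Ck_mult Suc.IH Ck_const) auto
  qed
  ultimately show ?case by (intro Ck_SucI) auto
qed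

lemma Ck_zero_outside_ball_bounded:
  fixes f :: "'a::euclidean_space \<Rightarrow> real"
  assumes "Ck k f" "\<And>x. r < norm x \<Longrightarrow> f x = 0"
  shows "\<exists>C. \<forall>x. \<bar>f x\<bar> \<le> C"
proof -
  have "Ck 0 f"
    using assms(1)
  proof (induction k)
    case (Suc k)
    thus ?case using Ck_Suc_imp[OF Suc.prems] by blast
  qed
  hence "continuous_on (cball 0 r) f"
    using continuous_on_subset[of UNIV f "cball 0 r"] by simp
  hence "compact (f ` cball 0 r)"
    by (intro compact_continuous_image) simp_all
  hence "bounded (f ` cball 0 r)"
    by (rule compact_imp_bounded)
  then obtain C where "\<forall>y\<in>f ` cball 0 r. norm y \<le> C"
    unfolding bounded_iff by blast
  hence C: "\<And>x. norm x \<le> r \<Longrightarrow> \<bar>f x\<bar> \<le> C"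
    by simp
  have "\<bar>f x\<bar> \<le> max C 0" for x
    using C[of x] assms(2)[of x] by (cases "norm x \<le> r") auto
  thus ?thesis by blast
qed

lemma Ck_derivative_bounded:
  fixes f :: "'a::euclidean_space \<Rightarrow> real"
  assumes f: "\<And>k. Ck k f" "\<And>x. r \<le> norm x \<Longrightarrow> f x = 0"
  shows "\<exists>C. \<forall>x h. \<bar>frechet_derivative f (at x) h\<bar> \<le> C * norm h"
proof -
  have z: "frechet_derivative f (at x) = (\<lambda>h. 0)" if "r < norm x" for x
  proof -
    have "open {x::'a. r < norm x}"
      by (intro open_Collect_less continuous_intros)
    hence "(f has_derivative (\<lambda>h. 0)) (at x)"
      by (rule has_derivative_transform_within_open[OF has_derivative_const[of 0]])
        (use that f(2) in auto)
    from frechet_derivative_at[OF this] show ?thesis by (rule sym)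
  qed
  have "\<exists>C. \<forall>x. \<bar>frechet_derivative f (at x) b\<bar> \<le> C" if "b \<in> Basis" for b
  proof (rule Ck_zero_outside_ball_bounded[where r=r])
    show "Ck 0 (\<lambda>x. frechet_derivative f (at x) b)"
      using f(1)[of "Suc 0"] that by simp
  qed (simp add: z)
  hence "\<forall>b\<in>Basis. \<exists>C. \<forall>x. \<bar>frechet_derivative f (at x) b\<bar> \<le> C"
    by blast
  from bchoice[OF this] obtain C
    where C: "\<forall>b\<in>Basis. \<forall>x. \<bar>frechet_derivative f (at x) b\<bar> \<le> C b" by blast
  have "\<bar>frechet_derivative f (at x) h\<bar> \<le> (\<Sum>b\<in>Basis. C b) * norm h" for x h
  proof -
    interpret bounded_linear "frechet_derivative f (at x)"
      by (rule has_derivative_bounded_linear[OF Ck_has_derivative[OF f(1)[of "Suc 0"]]])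
    have "frechet_derivative f (at x) h = (\<Sum>b\<in>Basis. (h \<bullet> b) * frechet_derivative f (at x) b)"
      by (subst (1) euclidean_representation[of h, symmetric]) (simp add: sum scaleR)
    also have "\<bar>\<dots>\<bar> \<le> (\<Sum>b\<in>Basis. \<bar>(h \<bullet> b) * frechet_derivative f (at x) b\<bar>)"
      by (rule sum_abs)
    also have "\<dots> \<le> (\<Sum>b\<in>Basis. norm h * C b)"
      by (intro sum_mono) (simp add: abs_mult mult_mono Basis_le_norm C)
    finally show ?thesis by (simp add: sum_distrib_left mult.commute)
  qed
  thus ?thesis by blast
qed

lemma exists_bump:
  obtains \<eta> :: "'a::euclidean_space \<Rightarrow> real"
  where "\<And>k. Ck k \<eta>" "\<And>x. 0 \<le> \<eta> x" "\<And>x. 1 \<le> norm x \<Longrightarrow> \<eta> x = 0"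
    "integrable lborel \<eta>" "integral\<^sup>L lborel \<eta> = 1"
proof -
  define \<eta> :: "'a \<Rightarrow> real" where "\<eta> x = exp_inv 1 (1 - x \<bullet> x)" for x
  have ck: "Ck k \<eta>" for k
    unfolding \<eta>_def by (rule Ck_exp_inv_radial)
  have nn: "0 \<le> \<eta> x" for x
    by (simp add: \<eta>_def exp_inv_def)
  have z: "\<eta> x = 0" if "1 \<le> norm x" for x
  proof -
    have "1 \<le> x \<bullet> x"
      using one_le_power[OF that, of 2] by (simp add: dot_square_norm)
    thus ?thesis by (simp add: \<eta>_def exp_inv_def)
  qed
  have cont: "continuous_on UNIV \<eta>"
    using ck[of 0] by simp
  have "integrable lborel (\<lambda>x. indicator (cball 0 1) x *\<^sub>R \<eta> x)"
    by (intro borel_integrable_compact continuous_on_subset[OF cont]) auto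
  moreover have "(\<lambda>x. indicator (cball 0 1) x *\<^sub>R \<eta> x) = \<eta>"
    using z by (intro ext) (auto simp: indicator_def)
  ultimately have int: "integrable lborel \<eta>" by simp
  (* Needed for normalising: the function is positive on the open unit ball. *)
  have pos: "integral\<^sup>L lborel \<eta> \<noteq> 0"
  proof
    assume "integral\<^sup>L lborel \<eta> = 0"
    hence "AE x in lborel. \<eta> x = 0"
      using integral_nonneg_eq_0_iff_AE[OF int] nn by auto
    moreover have "\<eta> x \<noteq> 0" if "x \<in> ball 0 1" for x
    proof -
      have "x \<bullet> x < 1"
        using that by (simp add: dot_square_norm abs_square_less_1)
      thus ?thesis by (simp add: \<eta>_def exp_inv_def)
    qed
    ultimately have "AE x in lborel. x \<notin> ball (0::'a) 1"
      by (auto elim!: eventually_mono)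
    hence "emeasure lborel (ball (0::'a) 1) = 0"
      using AE_iff_null_sets[of "ball 0 1" "lborel :: 'a measure"] by (auto dest: null_setsD1)
    moreover have "emeasure lborel (ball (0::'a) 1) = ennreal (unit_ball_vol DIM('a))"
      using emeasure_ball[of 1 "0::'a"] by simp
    ultimately show False
      using unit_ball_vol_pos[of "DIM('a)"] by simp
  qed
  show ?thesis
  proof
    show "Ck k (\<lambda>x. (1 / integral\<^sup>L lborel \<eta>) * \<eta> x)" for k
      by (intro Ck_mult Ck_const ck)
    have "0 \<le> integral\<^sup>L lborel \<eta>"
      by (rule Bochner_Integration.integral_nonneg) (rule nn)
    thus "0 \<le> (1 / integral\<^sup>L lborel \<eta>) * \<eta> x" for x
      using nn[of x] by simp
    show "(1 / integral\<^sup>L lborel \<eta>) * \<eta> x = 0" if "1 \<le> norm x" for x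
      using z[OF that] by simp
    show "integrable lborel (\<lambda>x. (1 / integral\<^sup>L lborel \<eta>) * \<eta> x)"
      using int by (rule integrable_mult_right)
    show "(\<integral>x. (1 / integral\<^sup>L lborel \<eta>) * \<eta> x \<partial>lborel) = 1"
      using pos by simp
  qed
qed

section \<open>Mollification in \<open>L\<^sup>1\<close>\<close>

lemma nn_integral_lborel_affine:
  fixes f :: "'a::euclidean_space \<Rightarrow> ennreal"
  assumes [measurable]: "f \<in> borel_measurable borel" and "c \<noteq> 0"
  shows "(\<integral>\<^sup>+x. f x \<partial>lborel) = ennreal (\<bar>c\<bar> ^ DIM('a)) * (\<integral>\<^sup>+x. f (t + c *\<^sub>R x) \<partial>lborel)"
  by (subst lborel_affine[OF assms(2), of t])
    (simp add: nn_integral_density nn_integral_distr nn_integral_cmult)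

lemma integral_lborel_affine:
  fixes f :: "'a::euclidean_space \<Rightarrow> 'b::{banach, second_countable_topology}"
  assumes f: "integrable lborel f" and c: "c \<noteq> 0"
  shows integrable_lborel_affine: "integrable lborel (\<lambda>x. f (t + c *\<^sub>R x))"
    and "(\<integral>x. f x \<partial>lborel) = (\<bar>c\<bar> ^ DIM('a)) *\<^sub>R (\<integral>x. f (t + c *\<^sub>R x) \<partial>lborel)"
proof -
  have [measurable]: "f \<in> borel_measurable borel"
    using f by auto
  have "integrable (density (distr lborel borel (\<lambda>x. t + c *\<^sub>R x)) (\<lambda>_. \<bar>c\<bar> ^ DIM('a))) f"
    using f lborel_affine[OF c, of t] by (metis (no_types))
  hence "integrable lborel (\<lambda>x. (\<bar>c\<bar> ^ DIM('a)) *\<^sub>R f (t + c *\<^sub>R x))"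
    by (simp add: integrable_density integrable_distr_eq)
  hence "integrable lborel (\<lambda>x. (1 / \<bar>c\<bar> ^ DIM('a)) *\<^sub>R ((\<bar>c\<bar> ^ DIM('a)) *\<^sub>R f (t + c *\<^sub>R x)))"
    by (rule integrable_scaleR_right)
  thus "integrable lborel (\<lambda>x. f (t + c *\<^sub>R x))"
    using c by simp
  show "(\<integral>x. f x \<partial>lborel) = (\<bar>c\<bar> ^ DIM('a)) *\<^sub>R (\<integral>x. f (t + c *\<^sub>R x) \<partial>lborel)"
    by (subst lborel_affine[OF c, of t]) (simp add: integral_density integral_distr)
qed

lemma nn_integral_lborel_shift:
  fixes f :: "'a::euclidean_space \<Rightarrow> ennreal"
  assumes "f \<in> borel_measurable borel"
  shows "(\<integral>\<^sup>+x. f (x - t) \<partial>lborel) = (\<integral>\<^sup>+x. f x \<partial>lborel)"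
  using nn_integral_lborel_affine[OF assms, of 1 "- t"] by simp

lemma nn_integral_lborel_reflect:
  fixes f :: "'a::euclidean_space \<Rightarrow> ennreal"
  assumes "f \<in> borel_measurable borel"
  shows "(\<integral>\<^sup>+x. f (t - x) \<partial>lborel) = (\<integral>\<^sup>+x. f x \<partial>lborel)"
  using nn_integral_lborel_affine[OF assms, of "-1" t] by simp

text \<open>
  Lebesgue measure restricted to \<open>A\<close> is a finite Borel measure, and those are inner
  regular.
\<close>

lemma inner_regular_lborel:
  fixes A :: "'a::euclidean_space set"
  assumes [measurable]: "A \<in> sets borel" and fin: "emeasure lborel A < \<infinity>" and e: "0 < (e::real)"
  obtains K where "compact K" "K \<subseteq> A" "emeasure lborel (A - K) < e"
proof -
  define M where "M = density lborel (indicator A :: 'a \<Rightarrow> ennreal)"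
  have M: "emeasure M B = emeasure lborel (A \<inter> B)" if "B \<in> sets borel" for B
    using that unfolding M_def
    by (subst emeasure_density) (auto simp: indicator_inter_arith[symmetric])
  have "emeasure M A = (SUP K \<in> {K. K \<subseteq> A \<and> compact K}. emeasure M K)"
    by (rule inner_regular) (use fin M[of UNIV] in \<open>auto simp: M_def\<close>)
  moreover have "emeasure M A = emeasure lborel A"
    by (simp add: M)
  ultimately have A: "emeasure lborel A = (SUP K \<in> {K. K \<subseteq> A \<and> compact K}. emeasure M K)"
    by simp
  show ?thesis
  proof (cases "emeasure lborel A = 0")
    case True
    thus ?thesis using that[of "{}"] e by auto
  next
    case False
    have "emeasure lborel A - ennreal e < emeasure lborel A"
      using False fin e by (intro ennreal_between) (auto simp: less_top zero_less_iff_neq_zero)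
    hence "emeasure lborel A - ennreal e < (SUP K \<in> {K. K \<subseteq> A \<and> compact K}. emeasure M K)"
      using A by simp
    then obtain K where K: "K \<subseteq> A" "compact K" "emeasure lborel A - ennreal e < emeasure M K"
      unfolding less_SUP_iff by auto
    have KA: "A \<inter> K = K" using K by auto
    have [measurable]: "K \<in> sets borel" using K by (simp add: borel_compact)
    have lt: "emeasure lborel A - ennreal e < emeasure lborel K"
      using K(3) M[of K] KA by simp
    have finK: "emeasure lborel K < \<infinity>"
      using K(1) fin emeasure_mono[of K A lborel] by (auto intro: le_less_trans)
    obtain a where a: "emeasure lborel A = ennreal a" "0 \<le> a"
      using fin by (cases "emeasure lborel A") auto
    obtain k where k: "emeasure lborel K = ennreal k" "0 \<le> k"
      using finK by (cases "emeasure lborel K") auto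
    have "ennreal (a - e) < ennreal k"
      using lt e unfolding a k by (simp add: ennreal_minus)
    hence "a - e < k"
      using k(2) by (cases "0 \<le> a - e") (auto simp: ennreal_less_iff)
    moreover have "emeasure lborel (A - K) = ennreal (a - k)"
      using K finK k a by (subst emeasure_Diff) (auto simp: ennreal_minus)
    ultimately have "emeasure lborel (A - K) < ennreal e"
      using e by (simp add: ennreal_lessI)
    thus ?thesis using K that by blast
  qed
qed

text \<open>
  Squeeze \<open>A\<close> between a compact \<open>K\<close> and an open \<open>U\<close> of
  nearly the same measure. A translation shorter than the distance from \<open>K\<close> to the
  complement of \<open>U\<close> changes the indicator of \<open>A\<close> only where the point or
  its translate lies in \<open>A - K\<close> or \<open>U - A\<close>.
\<close>

lemma L1_translation_continuous_indicator:
  fixes A :: "'a::euclidean_space set"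
  assumes A[measurable]: "A \<in> sets borel" and fin: "emeasure lborel A < \<infinity>" and e: "0 < (e::real)"
  shows "\<exists>d>0. \<forall>h. norm h < d \<longrightarrow>
    (\<integral>\<^sup>+z. ennreal \<bar>indicator A (z - h) - indicator A z\<bar> \<partial>lborel) \<le> ennreal e"
proof -
  obtain U where U: "open U" "A \<subseteq> U" "emeasure lborel (U - A) < ennreal (e/4)"
    using outer_regular_lborel[OF A, of "e/4"] e by auto
  obtain K where K: "compact K" "K \<subseteq> A" "emeasure lborel (A - K) < ennreal (e/4)"
    using inner_regular_lborel[OF A fin, of "e/4"] e by auto
  have [measurable]: "U \<in> sets borel" "K \<in> sets borel"
    using U K by (auto simp: borel_compact)
  obtain d where d: "d > 0" "(\<Union>x\<in>K. ball x d) \<subseteq> U"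
    using compact_subset_open_imp_ball_epsilon_subset[OF K(1) U(1)] U(2) K(2) by blast
  show ?thesis
  proof (intro exI conjI allI impI)
    fix h :: 'a assume h: "norm h < d"
    define g :: "'a \<Rightarrow> real" where "g z = indicator (A - K) z + indicator (U - A) z" for z
    have near: "x \<in> U" if "y \<in> K" "norm (x - y) < d" for x y
    proof -
      have "x \<in> ball y d" using that(2) by (simp add: dist_norm norm_minus_commute)
      thus ?thesis using that(1) d(2) by blast
    qed
    have "\<bar>indicator A (z - h) - indicator A z\<bar> \<le> g z + g (z - h)" for z
    proof -
      have "z - h \<in> K \<Longrightarrow> z \<in> U" "z \<in> K \<Longrightarrow> z - h \<in> U"
        using near[of "z - h" z] near[of z "z - h"] h by auto
      thus ?thesis by (auto simp: g_def indicator_def)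
    qed
    hence "(\<integral>\<^sup>+z. ennreal \<bar>indicator A (z - h) - indicator A z\<bar> \<partial>lborel) \<le>
        (\<integral>\<^sup>+z. ennreal (g z) + ennreal (g (z - h)) \<partial>lborel)"
      by (intro nn_integral_mono) (auto simp: g_def simp flip: ennreal_plus)
    also have "\<dots> = (\<integral>\<^sup>+z. ennreal (g z) \<partial>lborel) + (\<integral>\<^sup>+z. ennreal (g (z - h)) \<partial>lborel)"
      by (rule nn_integral_add) (auto simp: g_def)
    also have "(\<integral>\<^sup>+z. ennreal (g (z - h)) \<partial>lborel) = (\<integral>\<^sup>+z. ennreal (g z) \<partial>lborel)"
      by (rule nn_integral_lborel_shift) (simp add: g_def)
    also have "(\<integral>\<^sup>+z. ennreal (g z) \<partial>lborel) =
        (\<integral>\<^sup>+z. indicator (A - K) z + indicator (U - A) z \<partial>lborel)"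
      by (rule nn_integral_cong) (auto simp: g_def indicator_def)
    also have "\<dots> = emeasure lborel (A - K) + emeasure lborel (U - A)"
      by (subst nn_integral_add) auto
    finally have le: "(\<integral>\<^sup>+z. ennreal \<bar>indicator A (z - h) - indicator A z\<bar> \<partial>lborel) \<le>
      (emeasure lborel (A - K) + emeasure lborel (U - A)) +
      (emeasure lborel (A - K) + emeasure lborel (U - A))" .
    have "emeasure lborel (A - K) + emeasure lborel (U - A) \<le> ennreal (e/4) + ennreal (e/4)"
      using U(3) K(3) by (intro add_mono) auto
    also have "\<dots> = ennreal (e/2)"
      using e by (subst ennreal_plus[symmetric]) auto
    finally have "(emeasure lborel (A - K) + emeasure lborel (U - A)) +
      (emeasure lborel (A - K) + emeasure lborel (U - A)) \<le> ennreal (e/2) + ennreal (e/2)"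
      by (intro add_mono)
    also have "ennreal (e/2) + ennreal (e/2) = ennreal e"
      using e by (subst ennreal_plus[symmetric]) auto
    finally show "(\<integral>\<^sup>+z. ennreal \<bar>indicator A (z - h) - indicator A z\<bar> \<partial>lborel) \<le> ennreal e"
      using le by (rule order_trans[rotated])
  qed (use d in auto)
qed

text \<open>
  From indicators to all integrable functions by linearity and density, the translation being an
  \<open>L\<^sup>1\<close> isometry.
\<close>

lemma L1_translation_continuous:
  fixes f :: "'a::euclidean_space \<Rightarrow> real"
  assumes "integrable lborel f"
  shows "\<forall>e>0. \<exists>d>0. \<forall>h. norm h < d \<longrightarrow>
    (\<integral>\<^sup>+z. ennreal \<bar>f (z - h) - f z\<bar> \<partial>lborel) \<le> ennreal e"
  using assms
proof (induction rule: integrable_induct)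
  case (base A c)
  show ?case
  proof (intro allI impI)
    fix e :: real assume e: "e > 0"
    have A[measurable]: "A \<in> sets borel" using base by simp
    have "e / (\<bar>c\<bar> + 1) > 0" using e by simp
    then obtain d where d: "d > 0" "\<And>h. norm h < d \<Longrightarrow>
      (\<integral>\<^sup>+z. ennreal \<bar>indicator A (z - h) - indicator A z\<bar> \<partial>lborel) \<le> ennreal (e / (\<bar>c\<bar> + 1))"
      using L1_translation_continuous_indicator[of A "e / (\<bar>c\<bar> + 1)"] base by auto
    show "\<exists>d>0. \<forall>h. norm h < d \<longrightarrow>
      (\<integral>\<^sup>+z. ennreal \<bar>indicator A (z - h) *\<^sub>R c - indicator A z *\<^sub>R c\<bar> \<partial>lborel) \<le> ennreal e"
    proof (intro exI conjI allI impI)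
      fix h :: 'a assume h: "norm h < d"
      have "(\<integral>\<^sup>+z. ennreal \<bar>indicator A (z - h) *\<^sub>R c - indicator A z *\<^sub>R c\<bar> \<partial>lborel) =
        (\<integral>\<^sup>+z. ennreal \<bar>c\<bar> * ennreal \<bar>indicator A (z - h) - indicator A z\<bar> \<partial>lborel)"
        by (intro nn_integral_cong) (simp flip: ennreal_mult add: abs_mult[symmetric] algebra_simps)
      also have "\<dots> = ennreal \<bar>c\<bar> * (\<integral>\<^sup>+z. ennreal \<bar>indicator A (z - h) - indicator A z\<bar> \<partial>lborel)"
        by (rule nn_integral_cmult) measurable
      also have "\<dots> \<le> ennreal \<bar>c\<bar> * ennreal (e / (\<bar>c\<bar> + 1))"
        using d(2)[OF h] by (rule mult_left_mono) simp
      also have "\<dots> = ennreal (\<bar>c\<bar> * (e / (\<bar>c\<bar> + 1)))"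
        using e by (subst ennreal_mult) auto
      also have "\<dots> \<le> ennreal e"
        using e by (intro ennreal_leI) (simp add: field_simps)
      finally show "(\<integral>\<^sup>+z. ennreal \<bar>indicator A (z - h) *\<^sub>R c - indicator A z *\<^sub>R c\<bar> \<partial>lborel) \<le> ennreal e" .
    qed (use d in auto)
  qed
next
  case (add f g)
  have [measurable]: "f \<in> borel_measurable borel" "g \<in> borel_measurable borel"
    using add by auto
  show ?case
  proof (intro allI impI)
    fix e :: real assume e: "e > 0"
    hence e2: "e/2 > 0" by simp
    obtain d where d: "d > 0" "\<And>h. norm h < d \<Longrightarrow>
      (\<integral>\<^sup>+z. ennreal \<bar>f (z - h) - f z\<bar> \<partial>lborel) \<le> ennreal (e/2)"
      using add e2 by blast
    obtain d' where d': "d' > 0" "\<And>h. norm h < d' \<Longrightarrow>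
      (\<integral>\<^sup>+z. ennreal \<bar>g (z - h) - g z\<bar> \<partial>lborel) \<le> ennreal (e/2)"
      using add e2 by blast
    show "\<exists>d>0. \<forall>h. norm h < d \<longrightarrow>
      (\<integral>\<^sup>+z. ennreal \<bar>f (z - h) + g (z - h) - (f z + g z)\<bar> \<partial>lborel) \<le> ennreal e"
    proof (intro exI[of _ "min d d'"] conjI allI impI)
      fix h :: 'a assume h: "norm h < min d d'"
      have "(\<integral>\<^sup>+z. ennreal \<bar>f (z - h) + g (z - h) - (f z + g z)\<bar> \<partial>lborel) \<le>
        (\<integral>\<^sup>+z. ennreal \<bar>f (z - h) - f z\<bar> + ennreal \<bar>g (z - h) - g z\<bar> \<partial>lborel)"
        by (intro nn_integral_mono) (simp flip: ennreal_plus)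
      also have "\<dots> = (\<integral>\<^sup>+z. ennreal \<bar>f (z - h) - f z\<bar> \<partial>lborel) +
          (\<integral>\<^sup>+z. ennreal \<bar>g (z - h) - g z\<bar> \<partial>lborel)"
        by (rule nn_integral_add) measurable
      also have "\<dots> \<le> ennreal (e/2) + ennreal (e/2)"
        using h by (intro add_mono d d') auto
      also have "\<dots> = ennreal e"
        using e by (subst ennreal_plus[symmetric]) auto
      finally show "(\<integral>\<^sup>+z. ennreal \<bar>f (z - h) + g (z - h) - (f z + g z)\<bar> \<partial>lborel) \<le> ennreal e" .
    qed (use d d' in auto)
  qed
next
  case (lim f s)
  have [measurable]: "f \<in> borel_measurable borel" "\<And>i. s i \<in> borel_measurable borel"
    using borel_measurable_integrable[OF lim(4)] borel_measurable_integrable[OF lim(1)] by simp_all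
  have conv: "(\<lambda>i. \<integral>\<^sup>+z. ennreal (norm (s i z - f z)) \<partial>lborel) \<longlonglongrightarrow> 0"
  proof -
    have "(\<lambda>i. \<integral>\<^sup>+z. ennreal (norm (f z - s i z)) \<partial>lborel) \<longlonglongrightarrow> 0"
    proof (rule nn_integral_dominated_convergence_norm[where w="\<lambda>x. 2 * \<bar>f x\<bar>"])
      have "integrable lborel (\<lambda>x. 2 * \<bar>f x\<bar>)"
        using lim(4) by simp
      hence "(\<integral>\<^sup>+x. ennreal (norm (2 * \<bar>f x\<bar>)) \<partial>lborel) < \<infinity>"
        unfolding integrable_iff_bounded by blast
      thus "(\<integral>\<^sup>+x. ennreal (2 * \<bar>f x\<bar>) \<partial>lborel) < \<infinity>"
        by (simp only: real_norm_def abs_mult abs_numeral abs_idempotent)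
    qed (use lim(2,3) in auto)
    moreover have "(\<lambda>i. \<integral>\<^sup>+z. ennreal (norm (f z - s i z)) \<partial>lborel) =
        (\<lambda>i. \<integral>\<^sup>+z. ennreal (norm (s i z - f z)) \<partial>lborel)"
      by (intro ext nn_integral_cong) (simp add: abs_minus_commute)
    ultimately show ?thesis by simp
  qed
  show ?case
  proof (intro allI impI)
    fix e :: real assume e: "e > 0"
    hence e3: "e/3 > 0" by simp
    have "eventually (\<lambda>i. (\<integral>\<^sup>+z. ennreal (norm (s i z - f z)) \<partial>lborel) < ennreal (e/3)) sequentially"
      using order_tendstoD(2)[OF conv, of "ennreal (e/3)"] e by simp
    then obtain i where i: "(\<integral>\<^sup>+z. ennreal \<bar>s i z - f z\<bar> \<partial>lborel) < ennreal (e/3)"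
      using eventually_happens by fastforce
    obtain d where d: "d > 0" "\<And>h. norm h < d \<Longrightarrow>
      (\<integral>\<^sup>+z. ennreal \<bar>s i (z - h) - s i z\<bar> \<partial>lborel) \<le> ennreal (e/3)"
      using lim(5) e3 by blast
    show "\<exists>d>0. \<forall>h. norm h < d \<longrightarrow>
      (\<integral>\<^sup>+z. ennreal \<bar>f (z - h) - f z\<bar> \<partial>lborel) \<le> ennreal e"
    proof (intro exI[of _ d] conjI allI impI)
      fix h :: 'a assume h: "norm h < d"
      define g where "g z = ennreal \<bar>s i z - f z\<bar>" for z
      have [measurable]: "g \<in> borel_measurable borel" unfolding g_def by measurable
      have "(\<integral>\<^sup>+z. ennreal \<bar>f (z - h) - f z\<bar> \<partial>lborel) \<le>
        (\<integral>\<^sup>+z. g (z - h) + (ennreal \<bar>s i (z - h) - s i z\<bar> + g z) \<partial>lborel)"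
        unfolding g_def by (intro nn_integral_mono) (simp flip: ennreal_plus)
      also have "\<dots> = (\<integral>\<^sup>+z. g (z - h) \<partial>lborel) + (\<integral>\<^sup>+z. ennreal \<bar>s i (z - h) - s i z\<bar> + g z \<partial>lborel)"
        by (rule nn_integral_add) measurable
      also have "(\<integral>\<^sup>+z. ennreal \<bar>s i (z - h) - s i z\<bar> + g z \<partial>lborel) =
          (\<integral>\<^sup>+z. ennreal \<bar>s i (z - h) - s i z\<bar> \<partial>lborel) + (\<integral>\<^sup>+z. g z \<partial>lborel)"
        by (rule nn_integral_add) measurable
      also have "(\<integral>\<^sup>+z. g (z - h) \<partial>lborel) = (\<integral>\<^sup>+z. g z \<partial>lborel)"
        by (rule nn_integral_lborel_shift) measurable
      also have "(\<integral>\<^sup>+z. g z \<partial>lborel) +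
          ((\<integral>\<^sup>+z. ennreal \<bar>s i (z - h) - s i z\<bar> \<partial>lborel) + (\<integral>\<^sup>+z. g z \<partial>lborel)) \<le>
          ennreal (e/3) + (ennreal (e/3) + ennreal (e/3))"
        using h i by (intro add_mono d) (auto simp: g_def)
      also have "\<dots> = ennreal e"
        using e by (subst ennreal_plus[symmetric], simp, simp)+ simp
      finally show "(\<integral>\<^sup>+z. ennreal \<bar>f (z - h) - f z\<bar> \<partial>lborel) \<le> ennreal e" .
    qed (use d in auto)
  qed
qed

lemma integrable_mult_kernel:
  fixes f k :: "'a::euclidean_space \<Rightarrow> real"
  assumes f: "integrable lborel f" and [measurable]: "k \<in> borel_measurable borel"
    and k: "\<And>x. \<bar>k x\<bar> \<le> C"
  shows "integrable lborel (\<lambda>x. f x * k x)"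
proof (rule Bochner_Integration.integrable_bound)
  show "integrable lborel (\<lambda>x. C * \<bar>f x\<bar>)"
    using f by auto
  show "AE x in lborel. norm (f x * k x) \<le> norm (C * \<bar>f x\<bar>)"
  proof (rule AE_I2)
    fix x
    have "\<bar>f x\<bar> * \<bar>k x\<bar> \<le> \<bar>f x\<bar> * \<bar>C\<bar>"
      using k[of x] by (intro mult_left_mono) auto
    thus "norm (f x * k x) \<le> norm (C * \<bar>f x\<bar>)"
      by (simp add: abs_mult mult.commute)
  qed
qed (use f in auto)

text \<open>
  The mollification is an average of translates by vectors from the support of \<open>k\<close>,
  so it is as close to \<open>f\<close> as these translates are.
\<close>

lemma mollifier_L1_bound:
  fixes f k :: "'a::euclidean_space \<Rightarrow> real"
  assumes f: "integrable lborel f" and k[measurable]: "k \<in> borel_measurable borel"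
    and k0: "\<And>x. 0 \<le> k x" and k1: "(\<integral>\<^sup>+x. k x \<partial>lborel) = 1" and C: "\<And>x. k x \<le> C"
    and supp: "\<And>x. d \<le> norm x \<Longrightarrow> k x = 0"
    and e: "\<And>h. norm h < d \<Longrightarrow> (\<integral>\<^sup>+z. ennreal \<bar>f (z - h) - f z\<bar> \<partial>lborel) \<le> ennreal e"
  shows "(\<integral>\<^sup>+z. ennreal \<bar>(\<integral>w. f w * k (z - w) \<partial>lborel) - f z\<bar> \<partial>lborel) \<le> ennreal e"
proof -
  have f[measurable]: "f \<in> borel_measurable borel" "integrable lborel f"
    using f by auto
  have intk: "integrable lborel k" "(\<integral>x. k x \<partial>lborel) = 1"
  proof -
    show "integrable lborel k"
      using k0 k1 by (intro integrableI_nonneg) auto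
    show "(\<integral>x. k x \<partial>lborel) = 1"
      using k0 k1 by (subst integral_eq_nn_integral) auto
  qed
  have pt: "ennreal \<bar>(\<integral>w. f w * k (z - w) \<partial>lborel) - f z\<bar> \<le>
      (\<integral>\<^sup>+h. ennreal \<bar>f (z - h) - f z\<bar> * ennreal (k h) \<partial>lborel)" for z
  proof -
    have i1: "integrable lborel (\<lambda>w. f w * k (z - w))"
      using f(2) k0 C by (intro integrable_mult_kernel[where C=C]) auto
    have eq: "(\<integral>w. f w * k (z - w) \<partial>lborel) = (\<integral>h. f (z - h) * k h \<partial>lborel)"
      using integral_lborel_affine(2)[OF i1, of "-1" z] by simp
    have i2: "integrable lborel (\<lambda>h. f (z - h) * k h)"
      using integral_lborel_affine(1)[OF i1, of "-1" z] by simp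
    have "(\<integral>w. f w * k (z - w) \<partial>lborel) - f z = (\<integral>h. (f (z - h) - f z) * k h \<partial>lborel)"
      using i2 intk unfolding eq by (simp add: left_diff_distrib)
    moreover have "ennreal (norm (\<integral>h. (f (z - h) - f z) * k h \<partial>lborel)) \<le>
      (\<integral>\<^sup>+h. ennreal (norm ((f (z - h) - f z) * k h)) \<partial>lborel)"
      using i2 intk by (intro integral_norm_bound_ennreal) (simp add: left_diff_distrib)
    ultimately show ?thesis
      using k0 by (simp add: abs_mult ennreal_mult)
  qed
  have "(\<integral>\<^sup>+z. ennreal \<bar>(\<integral>w. f w * k (z - w) \<partial>lborel) - f z\<bar> \<partial>lborel) \<le>
     (\<integral>\<^sup>+z. (\<integral>\<^sup>+h. ennreal \<bar>f (z - h) - f z\<bar> * ennreal (k h) \<partial>lborel) \<partial>lborel)"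
    by (intro nn_integral_mono pt)
  also have "\<dots> = (\<integral>\<^sup>+h. (\<integral>\<^sup>+z. ennreal \<bar>f (z - h) - f z\<bar> * ennreal (k h) \<partial>lborel) \<partial>lborel)"
    by (rule lborel_pair.Fubini') measurable
  also have "\<dots> = (\<integral>\<^sup>+h. (\<integral>\<^sup>+z. ennreal \<bar>f (z - h) - f z\<bar> \<partial>lborel) * ennreal (k h) \<partial>lborel)"
    by (intro nn_integral_cong nn_integral_multc) measurable
  also have "\<dots> \<le> (\<integral>\<^sup>+h. ennreal e * ennreal (k h) \<partial>lborel)"
  proof (rule nn_integral_mono)
    fix h :: 'a
    show "(\<integral>\<^sup>+z. ennreal \<bar>f (z - h) - f z\<bar> \<partial>lborel) * ennreal (k h) \<le> ennreal e * ennreal (k h)"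
      using e[of h] supp[of h] by (cases "norm h < d") (auto intro: mult_right_mono)
  qed
  also have "\<dots> = ennreal e"
    using k1 by (simp add: nn_integral_cmult)
  finally show ?thesis .
qed

section \<open>Rescaled bumps\<close>

lemma Ck_derivative_continuous:
  fixes f :: "'a::euclidean_space \<Rightarrow> real"
  assumes "\<And>k. Ck k f"
  shows "continuous_on UNIV (\<lambda>x. frechet_derivative f (at x) h)"
proof -
  have eq: "frechet_derivative f (at x) h = (\<Sum>b\<in>Basis. (h \<bullet> b) * frechet_derivative f (at x) b)" for x
  proof -
    interpret bounded_linear "frechet_derivative f (at x)"
      by (rule has_derivative_bounded_linear[OF Ck_has_derivative[OF assms[of "Suc 0"]]])
    show ?thesis
      by (subst (1) euclidean_representation[of h, symmetric]) (simp add: sum scaleR)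
  qed
  have "continuous_on UNIV (\<lambda>x. frechet_derivative f (at x) b)" if "b \<in> Basis" for b
    using assms[of "Suc 0"] that by simp
  thus ?thesis unfolding eq by (intro continuous_intros) auto
qed

text \<open>
  The constant \<open>C\<close> is independent of \<open>x0\<close> and \<open>R\<close>: the
  powers of \<open>R\<close> are those of the rescaling \<open>R\<^sup>-\<^sup>n \<beta>((x -
  x0)/R)\<close> of one fixed bump \<open>\<beta>\<close>.
\<close>

definition smooth_bump :: "'a::euclidean_space \<Rightarrow> real \<Rightarrow> real \<Rightarrow> ('a \<Rightarrow> real) \<Rightarrow> bool" where
  "smooth_bump x0 R C \<eta> \<longleftrightarrow> (\<forall>k. Ck k \<eta>) \<and>
     (\<forall>x. 0 \<le> \<eta> x \<and> \<eta> x \<le> C / R ^ DIM('a)) \<and>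
     (\<forall>x. R \<le> norm (x - x0) \<longrightarrow> \<eta> x = 0) \<and>
     (\<forall>x h. \<bar>frechet_derivative \<eta> (at x) h\<bar> \<le> C / R ^ Suc DIM('a) * norm h) \<and>
     (\<integral>\<^sup>+x. ennreal (\<eta> x) \<partial>lborel) = 1"

lemma smooth_bumpD:
  fixes x0 :: "'a::euclidean_space"
  assumes "smooth_bump x0 R C \<eta>"
  shows "Ck k \<eta>" "0 \<le> \<eta> x" "\<eta> x \<le> C / R ^ DIM('a)" "R \<le> norm (x - x0) \<Longrightarrow> \<eta> x = 0"
    "\<bar>frechet_derivative \<eta> (at x) h\<bar> \<le> C / R ^ Suc DIM('a) * norm h"
    "(\<integral>\<^sup>+x. ennreal (\<eta> x) \<partial>lborel) = 1"
  using assms unfolding smooth_bump_def by blast+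

lemma exists_smooth_bump:
  "\<exists>C>0. \<forall>(x0::'a::euclidean_space) R. 0 < R \<longrightarrow> (\<exists>\<eta>. smooth_bump x0 R C \<eta>)"
proof -
  obtain \<beta> :: "'a \<Rightarrow> real" where \<beta>: "\<And>k. Ck k \<beta>" "\<And>x. 0 \<le> \<beta> x" "\<And>x. 1 \<le> norm x \<Longrightarrow> \<beta> x = 0"
    "integrable lborel \<beta>" "integral\<^sup>L lborel \<beta> = 1"
    by (rule exists_bump) blast
  obtain C0 where C0: "\<And>x. \<bar>\<beta> x\<bar> \<le> C0"
    using Ck_zero_outside_ball_bounded[OF \<beta>(1), of 1] \<beta>(3) by (metis less_imp_le)
  obtain C1 where C1: "\<And>x h. \<bar>frechet_derivative \<beta> (at x) h\<bar> \<le> C1 * norm h"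
    using Ck_derivative_bounded[OF \<beta>(1) \<beta>(3)] by blast
  define C where "C = max C0 C1 + 1"
  have "0 \<le> C0" using C0[of 0] by linarith
  hence C: "C > 0" "C0 \<le> C" "C1 \<le> C" by (auto simp: C_def)
  have "\<exists>\<eta>. smooth_bump x0 R C \<eta>" if R: "R > 0" for R and x0 :: 'a
  proof -
    define M where "M x = (1/R) *\<^sub>R x" for x :: 'a
    define c where "c = - ((1/R) *\<^sub>R x0)"
    define \<eta> where "\<eta> x = (1 / R ^ DIM('a)) * \<beta> (M x + c)" for x
    have M: "bounded_linear M" unfolding M_def by (rule bounded_linear_scaleR_right)
    have Mc: "M x + c = (1/R) *\<^sub>R (x - x0)" for x
      by (simp add: M_def c_def algebra_simps)
    have ck: "Ck k \<eta>" for k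
      unfolding \<eta>_def by (intro Ck_mult Ck_const Ck_affine[OF M] \<beta>(1))
    have "(\<beta> has_derivative frechet_derivative \<beta> (at y)) (at y)" for y
      by (rule Ck_has_derivative[OF \<beta>(1)])
    note \<beta>' = this
    have "((\<lambda>x. M x + c) has_derivative M) (at x)" for x
      using M by (auto intro!: derivative_eq_intros bounded_linear_imp_has_derivative)
    from has_derivative_compose[OF this \<beta>']
    have "((\<lambda>x. \<beta> (M x + c)) has_derivative (\<lambda>h. frechet_derivative \<beta> (at (M x + c)) (M h))) (at x)" for x .
    hence "(\<eta> has_derivative (\<lambda>h. (1 / R ^ DIM('a)) * frechet_derivative \<beta> (at (M x + c)) (M h))) (at x)" for x
      unfolding \<eta>_def by (rule has_derivative_mult_right)
    from frechet_derivative_at[OF this]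
    have d: "frechet_derivative \<eta> (at x) = (\<lambda>h. (1 / R ^ DIM('a)) * frechet_derivative \<beta> (at (M x + c)) (M h))" for x
      by simp
    have db: "\<bar>frechet_derivative \<eta> (at x) h\<bar> \<le> C / R ^ Suc DIM('a) * norm h" for x h
    proof -
      have "\<bar>frechet_derivative \<eta> (at x) h\<bar> \<le> (1 / R ^ DIM('a)) * (C1 * norm (M h))"
        unfolding d abs_mult using R C1 by (intro mult_mono) auto
      also have "\<dots> \<le> (1 / R ^ DIM('a)) * (C * norm (M h))"
        using R C by (intro mult_left_mono mult_right_mono) auto
      also have "\<dots> = C / R ^ Suc DIM('a) * norm h"
        using R by (simp add: M_def)
      finally show ?thesis .
    qed
    have [measurable]: "\<beta> \<in> borel_measurable borel"
      using \<beta>(4) by auto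
    have "(\<integral>\<^sup>+x. ennreal (\<beta> x) \<partial>lborel) = 1"
      using nn_integral_eq_integral[OF \<beta>(4)] \<beta>(2,5) by simp
    moreover have "(\<integral>\<^sup>+x. ennreal (\<beta> x) \<partial>lborel) =
        ennreal (\<bar>1/R\<bar> ^ DIM('a)) * (\<integral>\<^sup>+x. ennreal (\<beta> (c + (1/R) *\<^sub>R x)) \<partial>lborel)"
      using R by (intro nn_integral_lborel_affine) auto
    moreover have "\<dots> = (\<integral>\<^sup>+x. ennreal (\<bar>1/R\<bar> ^ DIM('a)) * ennreal (\<beta> (c + (1/R) *\<^sub>R x)) \<partial>lborel)"
      by (rule nn_integral_cmult[symmetric]) simp
    moreover have "\<dots> = (\<integral>\<^sup>+x. ennreal (\<eta> x) \<partial>lborel)"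
      using R \<beta>(2) by (intro nn_integral_cong)
        (simp add: \<eta>_def M_def add.commute power_divide flip: ennreal_mult)
    ultimately have i: "(\<integral>\<^sup>+x. ennreal (\<eta> x) \<partial>lborel) = 1" by simp
    have z: "\<eta> x = 0" if "R \<le> norm (x - x0)" for x
      using that R unfolding \<eta>_def Mc by (subst \<beta>(3)) auto
    have b: "0 \<le> \<eta> x" "\<eta> x \<le> C / R ^ DIM('a)" for x
      using R \<beta>(2)[of "M x + c"] C0[of "M x + c"] C
      by (auto simp: \<eta>_def divide_right_mono)
    show ?thesis
      unfolding smooth_bump_def using ck db i z b by (intro exI[of _ \<eta>]) blast
  qed
  thus ?thesis using C(1) by blast
qed

text \<open>
  Riesz representation: testing \<open>f\<close> with its own representing vector bounds the norm
  of that vector.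
\<close>

lemma gradient_vector:
  fixes f :: "'a::euclidean_space \<Rightarrow> real"
  assumes "bounded_linear f" "\<And>h. \<bar>f h\<bar> \<le> C * norm h"
  obtains v where "\<And>h. f h = h \<bullet> v" "norm v \<le> C"
proof -
  interpret bounded_linear f by fact
  define v where "v = (\<Sum>b\<in>Basis. f b *\<^sub>R b)"
  have f: "f h = h \<bullet> v" for h
    by (subst (1) euclidean_representation[of h, symmetric])
      (simp add: sum scaleR v_def inner_sum_right mult.commute)
  have "norm v * norm v \<le> C * norm v"
    using assms(2)[of v] unfolding f by (simp add: dot_square_norm power2_eq_square)
  hence "norm v \<le> C"
  proof (cases "v = 0")
    case True
    have "0 \<le> C * norm (SOME b. b \<in> (Basis::'a set))"
      using assms(2) abs_ge_zero order_trans by blast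
    hence "0 \<le> C"
      by (simp add: SOME_Basis)
    thus ?thesis using True by simp
  qed auto
  with f show ?thesis using that by blast
qed

section \<open>A Poincare inequality for space-time mollifications\<close>

lemma Ck_measurable:
  fixes f :: "'a::euclidean_space \<Rightarrow> real"
  assumes "Ck 0 f" shows "f \<in> borel_measurable borel"
  using assms by (simp add: borel_measurable_continuous_onI)

lemma frechet_derivative_reflected_shift:
  fixes k :: "'a::euclidean_space \<Rightarrow> real"
  assumes "Ck (Suc 0) k"
  shows "frechet_derivative (\<lambda>w. k (c - w)) (at w) e = - frechet_derivative k (at (c - w)) e"
proof -
  have k: "(k has_derivative frechet_derivative k (at (c - w))) (at (c - w))"
    by (rule Ck_has_derivative[OF assms])
  have "((\<lambda>w. c - w) has_derivative (\<lambda>h. - h)) (at w)"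
    by (auto intro!: derivative_eq_intros)
  from has_derivative_compose[OF this k]
  have "((\<lambda>w. k (c - w)) has_derivative (\<lambda>h. frechet_derivative k (at (c - w)) (- h))) (at w)" .
  from frechet_derivative_at[OF this, symmetric]
  have "frechet_derivative (\<lambda>w. k (c - w)) (at w) e = frechet_derivative k (at (c - w)) (- e)"
    by simp
  thus ?thesis
    using linear_neg[OF has_derivative_linear[OF k]] by simp
qed

lemma Ck_reflected_shift:
  fixes k :: "'a::euclidean_space \<Rightarrow> real"
  assumes "Ck n k" shows "Ck n (\<lambda>w. k (c - w))"
  using Ck_affine[OF bounded_linear_minus[OF bounded_linear_ident] assms, of c]
  by (simp add: add.commute)

lemma integrable_lborel_product:
  fixes f :: "'a::euclidean_space \<Rightarrow> real" and g :: "'b::euclidean_space \<Rightarrow> real"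
  assumes f: "integrable lborel f" and g: "integrable lborel g"
  shows "integrable (lborel \<Otimes>\<^sub>M lborel) (\<lambda>(x, y). f x * g y)"
proof (rule lborel_pair.Fubini_integrable)
  have [measurable]: "f \<in> borel_measurable borel" "g \<in> borel_measurable borel"
    using borel_measurable_integrable[OF f] borel_measurable_integrable[OF g] by simp_all
  show "(\<lambda>(x, y). f x * g y) \<in> borel_measurable (lborel \<Otimes>\<^sub>M lborel)" by measurable
  show "integrable lborel (\<lambda>x. \<integral>y. norm (case (x, y) of (x, y) \<Rightarrow> f x * g y) \<partial>lborel)"
    using f by (simp add: abs_mult)
qed (use g in auto)

text \<open>
  Write \<open>k(c + h - w) - k(c - w)\<close> as the integral of the derivative of
  \<open>k\<close> along the segment, exchange the integrals, and move the derivative from the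
  test function \<open>w \<mapsto> k(c + \<tau>h - w)\<close> to \<open>u\<close>. Thus the
  increment of the mollified \<open>u\<close> is an average of \<open>D\<close> along the segment,
  and no differentiation under the integral sign is needed. The direction is called
  \<open>h\<close> in the domain and \<open>e\<close> in the space of values of \<open>D\<close>,
  because later \<open>h = (e, 0)\<close> is a spatial direction of space-time.
\<close>

lemma segment_difference_superposition:
  fixes k :: "'a::euclidean_space \<Rightarrow> real" and u :: "'a \<Rightarrow> real" and D :: "'a \<Rightarrow> 'b::euclidean_space"
  assumes u: "integrable lborel u" and D: "integrable lborel D"
    and k: "\<And>j. Ck j k" "\<And>x. \<bar>k x\<bar> \<le> C" "\<And>x. \<bar>frechet_derivative k (at x) h\<bar> \<le> C"
    and weak: "\<And>\<tau>. 0 \<le> \<tau> \<Longrightarrow> \<tau> \<le> 1 \<Longrightarrow>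
      (\<integral>w. u w * frechet_derivative (\<lambda>w. k (c + \<tau> *\<^sub>R h - w)) (at w) h \<partial>lborel) =
      - (\<integral>w. (D w \<bullet> e) * k (c + \<tau> *\<^sub>R h - w) \<partial>lborel)"
  shows "integrable (lborel \<Otimes>\<^sub>M lborel)
           (\<lambda>(\<tau>, w). (D w \<bullet> e) * (indicator {0..1} (\<tau>::real) * k (c + \<tau> *\<^sub>R h - w)))" (is ?int)
    and "(\<integral>w. u w * k (c + h - w) \<partial>lborel) - (\<integral>w. u w * k (c - w) \<partial>lborel) =
      (\<integral>(\<tau>, w). (D w \<bullet> e) * (indicator {0..1} \<tau> * k (c + \<tau> *\<^sub>R h - w)) \<partial>(lborel \<Otimes>\<^sub>M lborel))" (is ?eq)
proof -
  let ?M = "lborel \<Otimes>\<^sub>M lborel :: (real \<times> 'a) measure"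
  let ?I = "indicator {0..1} :: real \<Rightarrow> real"
  define k' where "k' x = frechet_derivative k (at x) h" for x
  have [measurable]: "u \<in> borel_measurable borel" "D \<in> borel_measurable borel"
    using borel_measurable_integrable[OF u] borel_measurable_integrable[OF D] by simp_all
  have [measurable]: "k \<in> borel_measurable borel" "k' \<in> borel_measurable borel"
    using Ck_measurable[OF k(1)] Ck_derivative_continuous[OF k(1), of h]
    by (auto simp: k'_def[abs_def] intro: borel_measurable_continuous_onI)
  have k3: "\<bar>k' x\<bar> \<le> C" for x
    using k(3) by (simp add: k'_def)
  have C0: "0 \<le> C" using k(2)[of 0] by linarith
  have prod_int: "integrable ?M (\<lambda>(\<tau>, w). f w * (?I \<tau> * g (c + \<tau> *\<^sub>R h - w)))"
    if f: "integrable lborel f" and g[measurable]: "g \<in> borel_measurable borel" and gC: "\<And>x. \<bar>g x\<bar> \<le> C"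
    for f g :: "'a \<Rightarrow> real"
  proof -
    have [measurable]: "f \<in> borel_measurable borel"
      using borel_measurable_integrable[OF f] by simp
    have "integrable lborel (?I :: real \<Rightarrow> real)" by simp
    hence base: "integrable ?M (\<lambda>(\<tau>, w). ?I \<tau> * (C * \<bar>f w\<bar>))"
      using f by (intro integrable_lborel_product) auto
    show ?thesis
    proof (rule Bochner_Integration.integrable_bound[OF base])
      show "AE p in ?M. norm (case p of (\<tau>, w) \<Rightarrow> f w * (?I \<tau> * g (c + \<tau> *\<^sub>R h - w))) \<le>
          norm (case p of (\<tau>, w) \<Rightarrow> ?I \<tau> * (C * \<bar>f w\<bar>))"
      proof (intro AE_I2, clarify)
        fix \<tau> w
        have "\<bar>f w\<bar> * \<bar>g (c + \<tau> *\<^sub>R h - w)\<bar> \<le> \<bar>f w\<bar> * C"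
          by (intro mult_left_mono gC) auto
        thus "norm (f w * (?I \<tau> * g (c + \<tau> *\<^sub>R h - w))) \<le> norm (?I \<tau> * (C * \<bar>f w\<bar>))"
          using C0 by (auto simp: indicator_def abs_mult mult.commute)
      qed
    qed measurable
  qed
  have De: "integrable lborel (\<lambda>w. D w \<bullet> e)"
    using D by simp
  show ?int
    by (rule prod_int[OF De _ k(2)]) simp
  (* The fundamental theorem of calculus for k along the segment. *)
  have ftc: "k (c + h - w) - k (c - w) = (\<integral>\<tau>. ?I \<tau> * k' (c + \<tau> *\<^sub>R h - w) \<partial>lborel)" for w
  proof -
    have d: "((\<lambda>\<tau>. k (c + \<tau> *\<^sub>R h - w)) has_real_derivative k' (c + \<tau> *\<^sub>R h - w)) (at \<tau>)" for \<tau>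
    proof -
      have "((\<lambda>\<tau>. c + \<tau> *\<^sub>R h - w) has_derivative (\<lambda>s. s *\<^sub>R h)) (at \<tau>)"
        by (auto intro!: derivative_eq_intros)
      from has_derivative_compose[OF this Ck_has_derivative[OF k(1)]]
      have "((\<lambda>\<tau>. k (c + \<tau> *\<^sub>R h - w)) has_derivative
          (\<lambda>s. frechet_derivative k (at (c + \<tau> *\<^sub>R h - w)) (s *\<^sub>R h))) (at \<tau>)" .
      moreover have "frechet_derivative k (at (c + \<tau> *\<^sub>R h - w)) (s *\<^sub>R h) =
          k' (c + \<tau> *\<^sub>R h - w) * s" for s
        using linear_scale[OF has_derivative_linear[OF Ck_has_derivative[OF k(1)]]]
        by (simp add: k'_def mult.commute)
      ultimately show ?thesis by (simp add: has_field_derivative_def mult_commute_abs)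
    qed
    have "continuous_on UNIV (\<lambda>\<tau>. k' (c + \<tau> *\<^sub>R h - w))"
      using Ck_derivative_continuous[OF k(1), of h] unfolding k'_def
      by (rule continuous_on_compose2) (auto intro!: continuous_intros)
    hence cont: "isCont (\<lambda>\<tau>. k' (c + \<tau> *\<^sub>R h - w)) \<tau>" for \<tau>
      by (simp add: continuous_on_eq_continuous_at)
    have "has_bochner_integral lborel (\<lambda>\<tau>. k' (c + \<tau> *\<^sub>R h - w) * ?I \<tau>)
       (k (c + 1 *\<^sub>R h - w) - k (c + 0 *\<^sub>R h - w))"
      by (rule has_bochner_integral_FTC_Icc_real) (use d cont in auto)
    from has_bochner_integral_integral_eq[OF this] show ?thesis
      by (simp add: mult.commute)
  qed
  have ik: "integrable lborel (\<lambda>w. u w * k (c' - w))" for c'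
    by (rule integrable_mult_kernel[OF u]) (use k(2) in auto)
  have "(\<integral>w. u w * k (c + h - w) \<partial>lborel) - (\<integral>w. u w * k (c - w) \<partial>lborel) =
      (\<integral>w. u w * (k (c + h - w) - k (c - w)) \<partial>lborel)"
    using ik by (simp add: right_diff_distrib)
  also have "\<dots> = (\<integral>w. (\<integral>\<tau>. u w * (?I \<tau> * k' (c + \<tau> *\<^sub>R h - w)) \<partial>lborel) \<partial>lborel)"
    unfolding ftc by simp
  also have "\<dots> = (\<integral>\<tau>. (\<integral>w. u w * (?I \<tau> * k' (c + \<tau> *\<^sub>R h - w)) \<partial>lborel) \<partial>lborel)"
    by (intro lborel_pair.Fubini_integral prod_int[OF u]) (auto intro: k3)
  also have "\<dots> = (\<integral>\<tau>. (\<integral>w. (D w \<bullet> e) * (?I \<tau> * k (c + \<tau> *\<^sub>R h - w)) \<partial>lborel) \<partial>lborel)"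
  proof (rule Bochner_Integration.integral_cong[OF refl])
    fix \<tau> :: real
    show "(\<integral>w. u w * (?I \<tau> * k' (c + \<tau> *\<^sub>R h - w)) \<partial>lborel) =
       (\<integral>w. (D w \<bullet> e) * (?I \<tau> * k (c + \<tau> *\<^sub>R h - w)) \<partial>lborel)"
    proof (cases "\<tau> \<in> {0..1}")
      case True
      have "(\<integral>w. u w * k' (c + \<tau> *\<^sub>R h - w) \<partial>lborel) = (\<integral>w. (D w \<bullet> e) * k (c + \<tau> *\<^sub>R h - w) \<partial>lborel)"
        using weak[of \<tau>] True
        by (simp add: frechet_derivative_reflected_shift[OF k(1)] k'_def)
      thus ?thesis using True by simp
    qed simp
  qed
  also have "\<dots> = (\<integral>(\<tau>, w). (D w \<bullet> e) * (?I \<tau> * k (c + \<tau> *\<^sub>R h - w)) \<partial>?M)"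
    using lborel_pair.integral_fst'[OF \<open>?int\<close>] by simp
  finally show ?eq .
qed

lemma vnorm_cong: "(\<And>i. i < N \<Longrightarrow> v i = w i) \<Longrightarrow> vnorm N v = vnorm N w"
  by (simp add: vnorm_def L2_set_def)

text \<open>
  The Jacobian \<open>\<tau>\<^sup>n\<close> of the dilation is at least
  \<open>2\<^sup>-\<^sup>n\<close>.
\<close>

lemma nn_integral_dilation_le:
  fixes g :: "'a::euclidean_space \<Rightarrow> ennreal"
  assumes [measurable]: "g \<in> borel_measurable borel" and \<tau>: "1/2 \<le> \<tau>"
  shows "(\<integral>\<^sup>+x. g (t + \<tau> *\<^sub>R x) \<partial>lborel) \<le> ennreal (2 ^ DIM('a)) * (\<integral>\<^sup>+x. g x \<partial>lborel)"
proof -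
  have "1 \<le> (2 * \<tau>) ^ DIM('a)"
    using \<tau> by (intro one_le_power) auto
  hence "(\<integral>\<^sup>+x. g (t + \<tau> *\<^sub>R x) \<partial>lborel) \<le>
      ennreal ((2 * \<tau>) ^ DIM('a)) * (\<integral>\<^sup>+x. g (t + \<tau> *\<^sub>R x) \<partial>lborel)"
    using mult_right_mono[of 1 "ennreal ((2 * \<tau>) ^ DIM('a))"] by simp
  also have "\<dots> = ennreal (2 ^ DIM('a)) * (ennreal (\<bar>\<tau>\<bar> ^ DIM('a)) * (\<integral>\<^sup>+x. g (t + \<tau> *\<^sub>R x) \<partial>lborel))"
    using \<tau> by (simp add: power_mult_distrib ennreal_mult mult.assoc)
  also have "ennreal (\<bar>\<tau>\<bar> ^ DIM('a)) * (\<integral>\<^sup>+x. g (t + \<tau> *\<^sub>R x) \<partial>lborel) = (\<integral>\<^sup>+x. g x \<partial>lborel)"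
    using \<tau> by (intro nn_integral_lborel_affine[symmetric]) auto
  finally show ?thesis .
qed

text \<open>
  One of the weights \<open>\<tau>\<close> and \<open>1 - \<tau>\<close> of \<open>x\<close> and
  \<open>y\<close> is at least \<open>1/2\<close>. Integrating first over the variable with that
  weight is a dilation by at least \<open>1/2\<close>; the other variable contributes the measure
  of \<open>B\<close>.
\<close>

lemma convex_combination_nn_integral_le:
  fixes g :: "'a::euclidean_space \<Rightarrow> ennreal"
  assumes [measurable]: "g \<in> borel_measurable borel" "B \<in> sets borel" and \<tau>: "0 \<le> \<tau>" "\<tau> \<le> 1"
  shows "(\<integral>\<^sup>+x. (\<integral>\<^sup>+y. indicator B x * indicator B y * g (v + (y + \<tau> *\<^sub>R (x - y))) \<partial>lborel) \<partial>lborel)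
    \<le> ennreal (2 ^ DIM('a)) * emeasure lborel B * (\<integral>\<^sup>+x. g x \<partial>lborel)" (is "?L \<le> ?R")
proof -
  let ?G = "ennreal (2 ^ DIM('a)) * (\<integral>\<^sup>+x. g x \<partial>lborel)"
  have B: "(\<integral>\<^sup>+x. indicator B x * ?G \<partial>lborel) = ?R"
    by (subst nn_integral_multc) (auto simp: mult_ac)
  show ?thesis
  proof (cases "1/2 \<le> \<tau>")
    case True
    have "?L = (\<integral>\<^sup>+y. (\<integral>\<^sup>+x. indicator B x * indicator B y * g (v + (y + \<tau> *\<^sub>R (x - y))) \<partial>lborel) \<partial>lborel)"
      by (rule lborel_pair.Fubini') measurable
    also have "\<dots> \<le> (\<integral>\<^sup>+y. indicator B y * ?G \<partial>lborel)"
    proof (rule nn_integral_mono)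
      fix y :: 'a
      have "(\<integral>\<^sup>+x. indicator B x * indicator B y * g (v + (y + \<tau> *\<^sub>R (x - y))) \<partial>lborel) \<le>
          (\<integral>\<^sup>+x. indicator B y * g ((v + y - \<tau> *\<^sub>R y) + \<tau> *\<^sub>R x) \<partial>lborel)"
        by (intro nn_integral_mono) (auto simp: indicator_def algebra_simps)
      also have "\<dots> = indicator B y * (\<integral>\<^sup>+x. g ((v + y - \<tau> *\<^sub>R y) + \<tau> *\<^sub>R x) \<partial>lborel)"
        by (rule nn_integral_cmult) simp
      also have "\<dots> \<le> indicator B y * ?G"
        by (intro mult_left_mono nn_integral_dilation_le) (use True in auto)
      finally show "(\<integral>\<^sup>+x. indicator B x * indicator B y * g (v + (y + \<tau> *\<^sub>R (x - y))) \<partial>lborel) \<le>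
        indicator B y * ?G" .
    qed
    finally show ?thesis unfolding B .
  next
    case False
    have "?L \<le> (\<integral>\<^sup>+x. indicator B x * ?G \<partial>lborel)"
    proof (rule nn_integral_mono)
      fix x :: 'a
      have "(\<integral>\<^sup>+y. indicator B x * indicator B y * g (v + (y + \<tau> *\<^sub>R (x - y))) \<partial>lborel) \<le>
          (\<integral>\<^sup>+y. indicator B x * g ((v + \<tau> *\<^sub>R x) + (1 - \<tau>) *\<^sub>R y) \<partial>lborel)"
        by (intro nn_integral_mono) (auto simp: indicator_def algebra_simps)
      also have "\<dots> = indicator B x * (\<integral>\<^sup>+y. g ((v + \<tau> *\<^sub>R x) + (1 - \<tau>) *\<^sub>R y) \<partial>lborel)"
        by (rule nn_integral_cmult) simp
      also have "\<dots> \<le> indicator B x * ?G"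
        by (intro mult_left_mono nn_integral_dilation_le) (use False in auto)
      finally show "(\<integral>\<^sup>+y. indicator B x * indicator B y * g (v + (y + \<tau> *\<^sub>R (x - y))) \<partial>lborel) \<le>
        indicator B x * ?G" .
    qed
    thus ?thesis unfolding B .
  qed
qed

text \<open>
  The weights \<open>indicator {0..1} \<tau> * k(c + \<tau>h - w)\<close> of the superposition
  form a probability density in \<open>(\<tau>, w)\<close>, so Jensen's inequality applies to it.
\<close>

lemma mollified_segment_power_bound:
  fixes u :: "nat \<Rightarrow> 'a::euclidean_space \<Rightarrow> real" and D :: "nat \<Rightarrow> 'a \<Rightarrow> 'b::euclidean_space"
  assumes u: "\<And>i. i < N \<Longrightarrow> integrable lborel (u i)" and D: "\<And>i. i < N \<Longrightarrow> integrable lborel (D i)"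
    and k: "\<And>j. Ck j k" "\<And>x. 0 \<le> k x" "\<And>x. k x \<le> C" "\<And>x. \<bar>frechet_derivative k (at x) h\<bar> \<le> C"
      "(\<integral>\<^sup>+x. k x \<partial>lborel) = 1"
    and weak: "\<And>i \<tau>. i < N \<Longrightarrow> 0 \<le> \<tau> \<Longrightarrow> \<tau> \<le> 1 \<Longrightarrow>
      (\<integral>w. u i w * frechet_derivative (\<lambda>w. k (c + \<tau> *\<^sub>R h - w)) (at w) h \<partial>lborel) =
      - (\<integral>w. (D i w \<bullet> e) * k (c + \<tau> *\<^sub>R h - w) \<partial>lborel)"
    and q: "1 \<le> q" and r: "norm e \<le> r"
  shows "ennreal (vnorm N (\<lambda>i. (\<integral>w. u i w * k (c + h - w) \<partial>lborel) - (\<integral>w. u i w * k (c - w) \<partial>lborel)) powr q)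
    \<le> (\<integral>\<^sup>+(\<tau>, w). ennreal ((r * vnorm N (\<lambda>i. D i w)) powr q * (indicator {0..1} (\<tau>::real) * k (c + \<tau> *\<^sub>R h - w)))
        \<partial>(lborel \<Otimes>\<^sub>M lborel))"
proof -
  let ?M = "lborel \<Otimes>\<^sub>M lborel :: (real \<times> 'a) measure"
  define K where "K p = indicator {0..1} (fst p) * k (c + fst p *\<^sub>R h - snd p)" for p :: "real \<times> 'a"
  have Dm: "i < N \<Longrightarrow> D i \<in> borel_measurable borel" for i
    using borel_measurable_integrable[OF D] by simp
  have [measurable]: "k \<in> borel_measurable borel"
    using k(1) by (rule Ck_measurable)
  have vm: "(\<lambda>w. vnorm N (\<lambda>i. D i w)) \<in> borel_measurable borel"
    using Dm by (intro vnorm_measurable) auto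
  note vm[measurable]
  have Km[measurable]: "K \<in> borel_measurable ?M"
    unfolding K_def[abs_def] by measurable
  have K0: "0 \<le> K p" for p using k(2) by (simp add: K_def)
  have r0: "0 \<le> r" using r norm_ge_zero order_trans by blast
  have seg: "integrable ?M (\<lambda>p. (D i (snd p) \<bullet> e) * K p)"
    "(\<integral>w. u i w * k (c + h - w) \<partial>lborel) - (\<integral>w. u i w * k (c - w) \<partial>lborel) =
      (\<integral>p. (D i (snd p) \<bullet> e) * K p \<partial>?M)" if "i < N" for i
    using segment_difference_superposition[OF u[OF that] D[OF that] k(1) _ k(4) weak[OF that]]
      k(2,3) by (auto simp: K_def split_beta')
  let ?d = "vnorm N (\<lambda>i. (\<integral>w. u i w * k (c + h - w) \<partial>lborel) - (\<integral>w. u i w * k (c - w) \<partial>lborel))"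
  have "?d = vnorm N (\<lambda>i. \<integral>p. (D i (snd p) \<bullet> e) * K p \<partial>?M)"
    by (rule vnorm_cong) (rule seg)
  also have "\<dots> \<le> (\<integral>p. vnorm N (\<lambda>i. (D i (snd p) \<bullet> e) * K p) \<partial>?M)"
    by (rule vnorm_integral_le) (rule seg)
  finally have "ennreal ?d \<le> ennreal (\<integral>p. vnorm N (\<lambda>i. (D i (snd p) \<bullet> e) * K p) \<partial>?M)"
    by (rule ennreal_leI)
  also have "\<dots> = (\<integral>\<^sup>+p. vnorm N (\<lambda>i. (D i (snd p) \<bullet> e) * K p) \<partial>?M)"
    by (intro nn_integral_eq_integral[symmetric] integrable_vnorm seg) auto
  also have "\<dots> \<le> (\<integral>\<^sup>+p. (r * vnorm N (\<lambda>i. D i (snd p))) * K p \<partial>?M)"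
  proof (intro nn_integral_mono ennreal_leI)
    fix p
    have "vnorm N (\<lambda>i. (D i (snd p) \<bullet> e) * K p) = vnorm N (\<lambda>i. D i (snd p) \<bullet> e) * K p"
      using vnorm_scaleR[of N "K p" "\<lambda>i. D i (snd p) \<bullet> e"] K0[of p] by (simp add: mult.commute)
    also have "\<dots> \<le> (vnorm N (\<lambda>i. D i (snd p)) * norm e) * K p"
      by (intro mult_right_mono vnorm_inner_le K0)
    also have "\<dots> \<le> (vnorm N (\<lambda>i. D i (snd p)) * r) * K p"
      using r by (intro mult_right_mono mult_left_mono K0) auto
    finally show "vnorm N (\<lambda>i. (D i (snd p) \<bullet> e) * K p) \<le> (r * vnorm N (\<lambda>i. D i (snd p))) * K p"
      by (simp add: mult_ac)
  qed
  finally have mean: "ennreal ?d \<le> (\<integral>\<^sup>+p. (r * vnorm N (\<lambda>i. D i (snd p))) * K p \<partial>?M)" .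
  have K1: "(\<integral>\<^sup>+p. K p \<partial>?M) = 1"
  proof -
    have "(\<integral>\<^sup>+p. K p \<partial>?M) = (\<integral>\<^sup>+\<tau>. (\<integral>\<^sup>+w. K (\<tau>, w) \<partial>lborel) \<partial>lborel)"
      by (rule lborel.nn_integral_fst[symmetric]) simp
    also have "\<dots> = (\<integral>\<^sup>+\<tau>. indicator {0..1} \<tau> * (\<integral>\<^sup>+w. k (c + \<tau> *\<^sub>R h - w) \<partial>lborel) \<partial>lborel)"
      using k(2) by (subst nn_integral_cmult[symmetric])
        (auto simp: K_def ennreal_mult ennreal_indicator intro!: nn_integral_cong)
    also have "\<dots> = (\<integral>\<^sup>+\<tau>. indicator {0..1::real} \<tau> \<partial>lborel)"
      using k(5) by (subst nn_integral_lborel_reflect) auto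
    finally show ?thesis by simp
  qed
  have "ennreal (?d powr q) \<le> (\<integral>\<^sup>+p. (r * vnorm N (\<lambda>i. D i (snd p))) powr q * K p \<partial>?M)"
    by (rule weighted_powr_mean_le[OF _ Km _ K0 K1 q _ mean]) (use r0 in auto)
  thus ?thesis by (simp add: K_def split_beta')
qed

text \<open>
  The projections as Borel maps: the Borel sets of a product type are not syntactically a product
  sigma-algebra.
\<close>

lemma borel_measurable_fst_snd [measurable (raw)]:
  fixes f :: "'c \<Rightarrow> 'a::second_countable_topology \<times> 'b::second_countable_topology"
  assumes "f \<in> borel_measurable M"
  shows "(\<lambda>x. fst (f x)) \<in> borel_measurable M" "(\<lambda>x. snd (f x)) \<in> borel_measurable M"
  using assms by (auto intro!: measurable_compose[OF assms] borel_measurable_continuous_onI continuous_intros)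

lemma nn_integral_lborel_pair:
  fixes f :: "'a::euclidean_space \<times> 'b::euclidean_space \<Rightarrow> ennreal"
  assumes "f \<in> borel_measurable borel"
  shows "(\<integral>\<^sup>+p. f p \<partial>lborel) = (\<integral>\<^sup>+x. (\<integral>\<^sup>+y. f (x, y) \<partial>lborel) \<partial>lborel)"
    and "(\<integral>\<^sup>+p. f p \<partial>lborel) = (\<integral>\<^sup>+y. (\<integral>\<^sup>+x. f (x, y) \<partial>lborel) \<partial>lborel)"
proof -
  have f: "f \<in> borel_measurable (lborel \<Otimes>\<^sub>M lborel)"
    using assms by (simp add: lborel_prod)
  show "(\<integral>\<^sup>+p. f p \<partial>lborel) = (\<integral>\<^sup>+x. (\<integral>\<^sup>+y. f (x, y) \<partial>lborel) \<partial>lborel)"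
    using lborel.nn_integral_fst[OF f] by (simp add: lborel_prod)
  show "(\<integral>\<^sup>+p. f p \<partial>lborel) = (\<integral>\<^sup>+y. (\<integral>\<^sup>+x. f (x, y) \<partial>lborel) \<partial>lborel)"
    using lborel_pair.nn_integral_snd[OF f] by (simp add: lborel_prod)
qed

text \<open>
  After the reflection \<open>w \<mapsto> c - w\<close> the kernel no longer depends on
  \<open>x\<close>, \<open>y\<close>, \<open>t\<close>, and for fixed \<open>(\<tau>, w)\<close>
  the inner integral is that of a translate of \<open>g\<close> at a convex combination of
  \<open>x\<close> and \<open>y\<close>.
\<close>

lemma averaged_segments_nn_integral_le:
  fixes g :: "'a::euclidean_space \<times> real \<Rightarrow> ennreal" and k :: "'a \<times> real \<Rightarrow> real"
  assumes g[measurable]: "g \<in> borel_measurable borel" and B[measurable]: "B \<in> sets borel"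
    and k[measurable]: "k \<in> borel_measurable borel" and k0: "\<And>x. 0 \<le> k x" and k1: "(\<integral>\<^sup>+x. k x \<partial>lborel) = 1"
  shows "(\<integral>\<^sup>+(t, x, y). indicator B x * indicator B y * (\<integral>\<^sup>+(\<tau>, w).
       g w * ennreal (indicator {0..1} (\<tau>::real) * k ((y, t) + \<tau> *\<^sub>R (x - y, 0) - w)) \<partial>(lborel \<Otimes>\<^sub>M lborel)) \<partial>lborel)
    \<le> ennreal (2 ^ DIM('a)) * emeasure lborel B * (\<integral>\<^sup>+w. g w \<partial>lborel)" (is "?L \<le> ?R")
proof -
  define F where "F P R = (indicator B (fst (snd P)) * indicator B (snd (snd P))) *
     (g ((snd (snd P) + fst R *\<^sub>R (fst (snd P) - snd (snd P)), fst P) - snd R) *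
      (indicator {0..1} (fst R) * ennreal (k (snd R))))"
    for P :: "real \<times> 'a \<times> 'a" and R :: "real \<times> 'a \<times> real"
  have Fm[measurable]: "case_prod F \<in> borel_measurable (lborel \<Otimes>\<^sub>M lborel)"
    unfolding F_def[abs_def] by measurable
  have "(\<integral>\<^sup>+(\<tau>, w). g w * ennreal (indicator {0..1} (\<tau>::real) * k ((y, t) + \<tau> *\<^sub>R (x - y, 0) - w))
      \<partial>(lborel \<Otimes>\<^sub>M lborel)) =
    (\<integral>\<^sup>+R. g ((y + fst R *\<^sub>R (x - y), t) - snd R) * (indicator {0..1} (fst R) * ennreal (k (snd R))) \<partial>lborel)"
    for t x y
  proof -
    let ?c = "\<lambda>\<tau>. (y + \<tau> *\<^sub>R (x - y), t)"
    have "(\<integral>\<^sup>+(\<tau>, w). g w * ennreal (indicator {0..1} (\<tau>::real) * k ((y, t) + \<tau> *\<^sub>R (x - y, 0) - w))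
      \<partial>(lborel \<Otimes>\<^sub>M lborel)) =
      (\<integral>\<^sup>+\<tau>. (\<integral>\<^sup>+w. g w * (indicator {0..1} \<tau> * ennreal (k (?c \<tau> - w))) \<partial>lborel) \<partial>lborel)"
      using k0 by (subst lborel.nn_integral_fst[symmetric])
        (auto simp: ennreal_mult ennreal_indicator)
    also have "\<dots> = (\<integral>\<^sup>+\<tau>. (\<integral>\<^sup>+w. g (?c \<tau> - w) * (indicator {0..1} \<tau> * ennreal (k w)) \<partial>lborel) \<partial>lborel)"
    proof (rule nn_integral_cong)
      fix \<tau> :: real
      have "(\<lambda>w. g w * (indicator {0..1} \<tau> * ennreal (k (?c \<tau> - w)))) \<in> borel_measurable borel"
        by measurable
      from nn_integral_lborel_reflect[OF this, of "?c \<tau>"]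
      show "(\<integral>\<^sup>+w. g w * (indicator {0..1} \<tau> * ennreal (k (?c \<tau> - w))) \<partial>lborel) =
        (\<integral>\<^sup>+w. g (?c \<tau> - w) * (indicator {0..1} \<tau> * ennreal (k w)) \<partial>lborel)"
        by simp
    qed
    also have "\<dots> = (\<integral>\<^sup>+R. g (?c (fst R) - snd R) * (indicator {0..1} (fst R) * ennreal (k (snd R))) \<partial>lborel)"
      by (subst nn_integral_lborel_pair(1)) auto
    finally show ?thesis .
  qed
  hence "?L = (\<integral>\<^sup>+P. indicator B (fst (snd P)) * indicator B (snd (snd P)) *
      (\<integral>\<^sup>+R. g ((snd (snd P) + fst R *\<^sub>R (fst (snd P) - snd (snd P)), fst P) - snd R) *
      (indicator {0..1} (fst R) * ennreal (k (snd R))) \<partial>lborel) \<partial>lborel)"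
    by (simp add: split_beta')
  also have "\<dots> = (\<integral>\<^sup>+P. (\<integral>\<^sup>+R. F P R \<partial>lborel) \<partial>lborel)"
    unfolding F_def by (intro nn_integral_cong nn_integral_cmult[symmetric]) measurable
  also have "\<dots> = (\<integral>\<^sup>+R. (\<integral>\<^sup>+P. F P R \<partial>lborel) \<partial>lborel)"
    by (rule lborel_pair.Fubini'[symmetric]) simp
  also have "\<dots> \<le> (\<integral>\<^sup>+R. (indicator {0..1::real} (fst R) * ennreal (k (snd R))) * ?R \<partial>lborel)"
  proof (rule nn_integral_mono)
    fix R :: "real \<times> 'a \<times> real"
    obtain \<tau> w1 w2 where R: "R = (\<tau>, w1, w2)" by (cases R) auto
    have cong: "(\<lambda>x. g (x, t)) \<in> borel_measurable borel" for t by measurable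
    show "(\<integral>\<^sup>+P. F P R \<partial>lborel) \<le> (indicator {0..1} (fst R) * ennreal (k (snd R))) * ?R"
    proof (cases "\<tau> \<in> {0..1}")
      case True
      have "(\<integral>\<^sup>+P. F P R \<partial>lborel) = (\<integral>\<^sup>+t. (\<integral>\<^sup>+x. (\<integral>\<^sup>+y. F (t, x, y) R \<partial>lborel) \<partial>lborel) \<partial>lborel)"
        by (subst nn_integral_lborel_pair(1), measurable, subst nn_integral_lborel_pair(1)) auto
      also have "\<dots> = (\<integral>\<^sup>+t. (\<integral>\<^sup>+x. (\<integral>\<^sup>+y. ennreal (k (w1, w2)) *
          (indicator B x * indicator B y * g (- w1 + (y + \<tau> *\<^sub>R (x - y)), t - w2)) \<partial>lborel) \<partial>lborel) \<partial>lborel)"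
        using True by (simp add: F_def R mult_ac)
      also have "\<dots> = (\<integral>\<^sup>+t. ennreal (k (w1, w2)) * (\<integral>\<^sup>+x. (\<integral>\<^sup>+y.
          (indicator B x * indicator B y * g (- w1 + (y + \<tau> *\<^sub>R (x - y)), t - w2)) \<partial>lborel) \<partial>lborel) \<partial>lborel)"
        by (simp add: nn_integral_cmult)
      also have "\<dots> \<le> (\<integral>\<^sup>+t. ennreal (k (w1, w2)) * (ennreal (2 ^ DIM('a)) * emeasure lborel B *
           (\<integral>\<^sup>+x. g (x, t - w2) \<partial>lborel)) \<partial>lborel)"
        using True by (intro nn_integral_mono mult_left_mono convex_combination_nn_integral_le) auto
      also have "\<dots> = ennreal (k (w1, w2)) * (ennreal (2 ^ DIM('a)) * emeasure lborel B *
           (\<integral>\<^sup>+t. (\<integral>\<^sup>+x. g (x, t - w2) \<partial>lborel) \<partial>lborel))"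
        by (simp add: nn_integral_cmult)
      also have "(\<integral>\<^sup>+t. (\<integral>\<^sup>+x. g (x, t - w2) \<partial>lborel) \<partial>lborel) = (\<integral>\<^sup>+t. (\<integral>\<^sup>+x. g (x, t) \<partial>lborel) \<partial>lborel)"
        by (rule nn_integral_lborel_shift) measurable
      also have "\<dots> = (\<integral>\<^sup>+w. g w \<partial>lborel)"
        by (rule nn_integral_lborel_pair(2)[symmetric]) simp
      finally show ?thesis using True by (simp add: R)
    qed (simp add: F_def R)
  qed
  also have "\<dots> = (\<integral>\<^sup>+R. indicator {0..1::real} (fst R) * ennreal (k (snd R)) \<partial>lborel) * ?R"
    by (rule nn_integral_multc) measurable
  also have "(\<integral>\<^sup>+R. indicator {0..1::real} (fst R) * ennreal (k (snd R)) \<partial>lborel) = 1"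
    by (subst nn_integral_lborel_pair(1)) (auto simp: nn_integral_cmult k1)
  finally show ?thesis by simp
qed

text \<open>
  The Poincare inequality on the ball in its symmetric form, integrated in time. Integrating
  \<open>D\<close> over the whole space on the right makes the bound independent of the size of
  the support of \<open>k\<close>; it is no loss, as \<open>D\<close> will vanish off the
  cylinder.
\<close>

lemma mollified_poincare:
  fixes u :: "nat \<Rightarrow> 'a::euclidean_space \<times> real \<Rightarrow> real" and D :: "nat \<Rightarrow> 'a \<times> real \<Rightarrow> 'a"
    and k :: "'a \<times> real \<Rightarrow> real"
  assumes u: "\<And>i. i < N \<Longrightarrow> integrable lborel (u i)" and D: "\<And>i. i < N \<Longrightarrow> integrable lborel (D i)"
    and k: "\<And>j. Ck j k" "\<And>x. 0 \<le> k x" "\<And>x. k x \<le> C" "\<And>x h. \<bar>frechet_derivative k (at x) h\<bar> \<le> C * norm h"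
      "(\<integral>\<^sup>+x. k x \<partial>lborel) = 1"
    and weak: "\<And>i e x t. i < N \<Longrightarrow> x \<in> ball x0 r \<Longrightarrow> t \<in> I \<Longrightarrow>
      (\<integral>w. u i w * frechet_derivative (\<lambda>w. k ((x, t) - w)) (at w) (e, 0) \<partial>lborel) =
      - (\<integral>w. (D i w \<bullet> e) * k ((x, t) - w) \<partial>lborel)"
    and q: "1 \<le> q" and r: "0 \<le> r"
  defines "v \<equiv> \<lambda>i z. \<integral>w. u i w * k (z - w) \<partial>lborel"
  shows "(\<integral>\<^sup>+(t, x, y). indicator I t * (indicator (ball x0 r) x * indicator (ball x0 r) y *
       ennreal (vnorm N (\<lambda>i. v i (x, t) - v i (y, t)) powr q)) \<partial>lborel)
    \<le> ennreal ((2 * r) powr q * 2 ^ DIM('a)) * emeasure lborel (ball x0 r) *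
       (\<integral>\<^sup>+w. ennreal (vnorm N (\<lambda>i. D i w) powr q) \<partial>lborel)"
proof -
  let ?B = "ball x0 r"
  define g where "g w = ennreal ((2 * r * vnorm N (\<lambda>i. D i w)) powr q)" for w
  have "i < N \<Longrightarrow> D i \<in> borel_measurable borel" for i
    using borel_measurable_integrable[OF D] by simp
  hence [measurable]: "(\<lambda>w. vnorm N (\<lambda>i. D i w)) \<in> borel_measurable borel"
    by (intro vnorm_measurable) auto
  have gm: "g \<in> borel_measurable borel" unfolding g_def[abs_def] by measurable
  have km: "k \<in> borel_measurable borel" using k(1) by (rule Ck_measurable)
  have pt: "indicator I t * (indicator ?B x * indicator ?B y *
       ennreal (vnorm N (\<lambda>i. v i (x, t) - v i (y, t)) powr q)) \<le>
     indicator ?B x * indicator ?B y * (\<integral>\<^sup>+(\<tau>, w).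
       g w * ennreal (indicator {0..1} (\<tau>::real) * k ((y, t) + \<tau> *\<^sub>R (x - y, 0) - w)) \<partial>(lborel \<Otimes>\<^sub>M lborel))"
    for t x y
  proof (cases "t \<in> I \<and> x \<in> ?B \<and> y \<in> ?B")
    case True
    have cv: "y + \<tau> *\<^sub>R (x - y) \<in> ?B" if "0 \<le> \<tau>" "\<tau> \<le> 1" for \<tau>
    proof -
      have "y + \<tau> *\<^sub>R (x - y) = (1 - \<tau>) *\<^sub>R y + \<tau> *\<^sub>R x"
        by (simp add: algebra_simps)
      thus ?thesis
        using True that convexD[OF convex_ball, of y x0 r x "1 - \<tau>" \<tau>] by simp
    qed
    have nr: "norm (x - y) \<le> 2 * r"
      using True norm_triangle_ineq4[of "x - x0" "y - x0"] by (simp add: dist_norm norm_minus_commute)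
    have "ennreal (vnorm N (\<lambda>i. (\<integral>w. u i w * k ((y, t) + (x - y, 0) - w) \<partial>lborel) -
          (\<integral>w. u i w * k ((y, t) - w) \<partial>lborel)) powr q) \<le>
       (\<integral>\<^sup>+(\<tau>, w). ennreal ((2 * r * vnorm N (\<lambda>i. D i w)) powr q *
          (indicator {0..1} (\<tau>::real) * k ((y, t) + \<tau> *\<^sub>R (x - y, 0) - w))) \<partial>(lborel \<Otimes>\<^sub>M lborel))"
    proof (rule mollified_segment_power_bound[where C="max C (C * norm (x - y, 0::real))" and e="x - y",
          OF u D k(1,2) _ _ k(5) _ q nr])
      show "k z \<le> max C (C * norm (x - y, 0::real))" for z
        using k(3)[of z] by simp
      show "\<bar>frechet_derivative k (at z) (x - y, 0)\<bar> \<le> max C (C * norm (x - y, 0::real))" for z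
        using k(4)[of z "(x - y, 0)"] by (rule max.coboundedI2)
      fix i and \<tau> :: real assume "i < N" "0 \<le> \<tau>" "\<tau> \<le> 1"
      thus "(\<integral>w. u i w * frechet_derivative (\<lambda>w. k ((y, t) + \<tau> *\<^sub>R (x - y, 0) - w)) (at w) (x - y, 0) \<partial>lborel) =
        - (\<integral>w. (D i w \<bullet> (x - y)) * k ((y, t) + \<tau> *\<^sub>R (x - y, 0) - w) \<partial>lborel)"
        using weak[of i "y + \<tau> *\<^sub>R (x - y)" t "x - y"] cv[of \<tau>] True by simp
    qed
    thus ?thesis
      using True k(2) by (simp add: v_def g_def ennreal_mult)
  qed auto
  have "(\<integral>\<^sup>+(t, x, y). indicator I t * (indicator ?B x * indicator ?B y *
       ennreal (vnorm N (\<lambda>i. v i (x, t) - v i (y, t)) powr q)) \<partial>lborel) \<le>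
    (\<integral>\<^sup>+(t, x, y). indicator ?B x * indicator ?B y * (\<integral>\<^sup>+(\<tau>, w).
       g w * ennreal (indicator {0..1} (\<tau>::real) * k ((y, t) + \<tau> *\<^sub>R (x - y, 0) - w)) \<partial>(lborel \<Otimes>\<^sub>M lborel)) \<partial>lborel)"
    by (rule nn_integral_mono) (use pt in auto)
  also have "\<dots> \<le> ennreal (2 ^ DIM('a)) * emeasure lborel ?B * (\<integral>\<^sup>+w. g w \<partial>lborel)"
    using k by (intro averaged_segments_nn_integral_le gm km) auto
  also have "(\<integral>\<^sup>+w. g w \<partial>lborel) =
      (\<integral>\<^sup>+w. ennreal ((2 * r) powr q) * ennreal (vnorm N (\<lambda>i. D i w) powr q) \<partial>lborel)"
    using r by (simp add: g_def powr_mult ennreal_mult)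
  also have "\<dots> = ennreal ((2 * r) powr q) * (\<integral>\<^sup>+w. ennreal (vnorm N (\<lambda>i. D i w) powr q) \<partial>lborel)"
    by (rule nn_integral_cmult) simp
  finally show ?thesis by (simp add: ennreal_mult mult_ac)
qed

section \<open>Increments of weighted means in time\<close>

lemma integrable_product_bounded_kernel:
  fixes f :: "'a::euclidean_space \<Rightarrow> real" and g :: "'b::euclidean_space \<Rightarrow> real"
  assumes f: "integrable lborel f" and g: "integrable lborel g"
    and K: "K \<in> borel_measurable (lborel \<Otimes>\<^sub>M lborel)" "\<And>x y. \<bar>K (x, y)\<bar> \<le> C"
  shows "integrable (lborel \<Otimes>\<^sub>M lborel) (\<lambda>(x, y). f x * g y * K (x, y))"
proof (rule Bochner_Integration.integrable_bound)
  show "integrable (lborel \<Otimes>\<^sub>M lborel) (\<lambda>(x, y). (C * f x) * g y)"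
    using f g by (intro integrable_lborel_product) auto
  have [measurable]: "f \<in> borel_measurable borel" "g \<in> borel_measurable borel"
    "K \<in> borel_measurable (lborel \<Otimes>\<^sub>M lborel)"
    using borel_measurable_integrable[OF f] borel_measurable_integrable[OF g] K by simp_all
  show "(\<lambda>(x, y). f x * g y * K (x, y)) \<in> borel_measurable (lborel \<Otimes>\<^sub>M lborel)"
    by measurable
  show "AE p in lborel \<Otimes>\<^sub>M lborel. norm (case p of (x, y) \<Rightarrow> f x * g y * K (x, y)) \<le>
      norm (case p of (x, y) \<Rightarrow> (C * f x) * g y)"
  proof (intro AE_I2, clarify)
    fix x y
    have "\<bar>f x * g y\<bar> * \<bar>K (x, y)\<bar> \<le> \<bar>f x * g y\<bar> * \<bar>C\<bar>"
      using K(2)[of x y] by (intro mult_left_mono) auto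
    thus "norm (f x * g y * K (x, y)) \<le> norm ((C * f x) * g y)"
      by (simp add: abs_mult mult_ac)
  qed
qed

text \<open>
  Here \<open>m i t\<close> is the \<open>\<eta>\<close>-weighted spatial mean of the
  mollification of \<open>u i\<close> with the product kernel \<open>a(x) b(t)\<close>, and
  \<open>Z\<close> stands for a primitive of \<open>r \<mapsto> b(t - r) - b(s - r)\<close> with
  values in \<open>[-1, 1]\<close>. Moving the spatial mollification onto \<open>\<eta>\<close> by
  the substitution \<open>x = y + h\<close> turns \<open>m i t - m i s\<close> into an average
  over \<open>h\<close> of \<open>u\<close> tested with \<open>\<eta>(y + h) Z'(r)\<close>. So the
  equation is only needed for the products \<open>\<eta>(y + h) Z(r)\<close>, and the convolution
  of \<open>\<eta>\<close> with \<open>a\<close> never has to be shown smooth.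
\<close>

lemma mollified_mean_increment:
  fixes u :: "nat \<Rightarrow> 'a::euclidean_space \<times> real \<Rightarrow> real" and G :: "nat \<Rightarrow> 'a \<times> real \<Rightarrow> 'a"
    and a \<eta> :: "'a \<Rightarrow> real" and b Z :: "real \<Rightarrow> real"
  assumes u: "\<And>i. i < N \<Longrightarrow> integrable lborel (u i)" and G: "\<And>i. i < N \<Longrightarrow> integrable lborel (G i)"
    and a: "a \<in> borel_measurable borel" "\<And>x. 0 \<le> a x" "\<And>x. a x \<le> C" "(\<integral>\<^sup>+x. a x \<partial>lborel) = 1"
    and b: "b \<in> borel_measurable borel" "\<And>t. \<bar>b t\<bar> \<le> C"
    and \<eta>: "\<And>j. Ck j \<eta>" "\<And>x. \<bar>\<eta> x\<bar> \<le> C" "integrable lborel \<eta>"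
      "\<And>x h. \<bar>frechet_derivative \<eta> (at x) h\<bar> \<le> C' * norm h"
    and Z: "Z \<in> borel_measurable borel" "\<And>t. \<bar>Z t\<bar> \<le> 1"
    and weak: "\<And>i h. i < N \<Longrightarrow> a h \<noteq> 0 \<Longrightarrow>
      (\<integral>w. u i w * (\<eta> (fst w + h) * (b (t - snd w) - b (s - snd w))) \<partial>lborel) =
      (\<integral>w. frechet_derivative \<eta> (at (fst w + h)) (G i w) * Z (snd w) \<partial>lborel)"
  defines "m \<equiv> \<lambda>i t. \<integral>x. \<eta> x * (\<integral>w. u i w * (a (x - fst w) * b (t - snd w)) \<partial>lborel) \<partial>lborel"
  shows "vnorm N (\<lambda>i. m i t - m i s) \<le> C' * (\<integral>w. vnorm N (\<lambda>i. G i w) \<partial>lborel)"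
proof -
  let ?M = "lborel \<Otimes>\<^sub>M lborel :: ('a \<times> 'a \<times> real) measure"
  have C0: "0 \<le> C" using b(2)[of 0] by linarith
  note [measurable] = a(1) b(1) Z(1)
  have \<eta>m[measurable]: "\<eta> \<in> borel_measurable borel" using \<eta>(1) by (rule Ck_measurable)
  have ia: "integrable lborel a"
    using a by (intro integrableI_nonneg) auto
  have a1: "(\<integral>x. a x \<partial>lborel) = 1"
    using a by (subst integral_eq_nn_integral) auto
  have um: "i < N \<Longrightarrow> u i \<in> borel_measurable borel" for i
    using borel_measurable_integrable[OF u] by simp
  have Gm: "i < N \<Longrightarrow> G i \<in> borel_measurable borel" for i
    using borel_measurable_integrable[OF G] by simp
  define \<beta> where "\<beta> w = b (t - snd w) - b (s - snd w)" for w :: "'a \<times> real"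
  have [measurable]: "\<beta> \<in> borel_measurable borel" unfolding \<beta>_def[abs_def] by measurable
  have \<beta>C: "\<bar>\<beta> w\<bar> \<le> 2 * C" for w
    using b(2)[of "t - snd w"] b(2)[of "s - snd w"] by (simp add: \<beta>_def)
  define d where "d p = frechet_derivative \<eta> (at (fst (snd p) + fst p))" for p :: "'a \<times> 'a \<times> real"
  define J where "J i p = a (fst p) * (d p (G i (snd p)) * Z (snd (snd p)))" for i and p :: "'a \<times> 'a \<times> real"
  have lin: "bounded_linear (d p)" for p
    unfolding d_def by (rule has_derivative_bounded_linear[OF Ck_has_derivative[OF \<eta>(1)]])
  have dle: "\<bar>d p h\<bar> \<le> C' * norm h" for p h
    unfolding d_def by (rule \<eta>(4))
  have dm: "(\<lambda>p. d p (f p)) \<in> borel_measurable ?M" if [measurable]: "f \<in> borel_measurable ?M" for f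
  proof -
    have eq: "d p (f p) = (\<Sum>b\<in>Basis. (f p \<bullet> b) * frechet_derivative \<eta> (at (fst (snd p) + fst p)) b)" for p
    proof -
      interpret bounded_linear "d p" by (rule lin)
      have "d p (f p) = (\<Sum>b\<in>Basis. (f p \<bullet> b) * d p b)"
        by (subst (1) euclidean_representation[of "f p", symmetric]) (simp add: sum scaleR)
      thus ?thesis by (simp add: d_def)
    qed
    have [measurable]: "(\<lambda>x. frechet_derivative \<eta> (at x) b) \<in> borel_measurable borel" for b
      using Ck_derivative_continuous[OF \<eta>(1)] by (rule borel_measurable_continuous_onI)
    show ?thesis unfolding eq by measurable
  qed
  have Jint: "integrable ?M (J i)" if "i < N" for i
  proof (rule Bochner_Integration.integrable_bound)
    show "integrable ?M (\<lambda>(h, w). a h * (C' * norm (G i w)))"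
      using ia G[OF that] by (intro integrable_lborel_product) auto
    have [measurable]: "G i \<in> borel_measurable borel" using Gm that .
    have [measurable]: "(\<lambda>p. d p (G i (snd p))) \<in> borel_measurable ?M" by (rule dm) simp
    show "J i \<in> borel_measurable ?M" unfolding J_def[abs_def] by measurable
    show "AE p in ?M. norm (J i p) \<le> norm (case p of (h, w) \<Rightarrow> a h * (C' * norm (G i w)))"
    proof (intro AE_I2)
      fix p
      have "\<bar>d p (G i (snd p))\<bar> * \<bar>Z (snd (snd p))\<bar> \<le> (C' * norm (G i (snd p))) * 1"
        using dle[of p "G i (snd p)"] Z(2) by (intro mult_mono) auto
      also have "\<dots> \<le> \<bar>C' * norm (G i (snd p))\<bar>" by simp
      finally show "norm (J i p) \<le> norm (case p of (h, w) \<Rightarrow> a h * (C' * norm (G i w)))"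
        using a(2) by (auto simp: J_def abs_mult split_beta' intro: mult_left_mono)
    qed
  qed
  have rep: "m i t - m i s = (\<integral>p. J i p \<partial>?M)" if i: "i < N" for i
  proof -
    have [measurable]: "u i \<in> borel_measurable borel" using um i .
    have inner: "integrable lborel (\<lambda>w. u i w * (a (x - fst w) * b (t' - snd w)))" for x t'
    proof (rule integrable_mult_kernel[OF u[OF i]])
      show "\<bar>a (x - fst w) * b (t' - snd w)\<bar> \<le> C * C" for w
        unfolding abs_mult using a(2,3) b(2) C0 by (intro mult_mono) auto
    qed measurable
    have outer: "integrable lborel (\<lambda>x. \<eta> x * (\<integral>w. u i w * (a (x - fst w) * b (t' - snd w)) \<partial>lborel))" for t'
    proof -
      have "integrable ?M (\<lambda>(x, w). \<eta> x * u i w * (a (fst (x, w) - fst (snd (x, w))) * b (t' - snd (snd (x, w)))))"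
      proof (rule integrable_product_bounded_kernel[OF \<eta>(3) u[OF i]])
        show "\<bar>a (fst (x, w) - fst (snd (x, w))) * b (t' - snd (snd (x, w)))\<bar> \<le> C * C" for x :: 'a and w :: "'a \<times> real"
          unfolding abs_mult using a(2,3) b(2) C0 by (intro mult_mono) auto
      qed measurable
      from lborel_pair.integrable_fst'[OF this] show ?thesis
        by (simp add: mult.assoc)
    qed
    have "m i t - m i s = (\<integral>x. \<eta> x * (\<integral>w. u i w * (a (x - fst w) * b (t - snd w)) \<partial>lborel) -
        \<eta> x * (\<integral>w. u i w * (a (x - fst w) * b (s - snd w)) \<partial>lborel) \<partial>lborel)"
      unfolding m_def using outer by simp
    also have "\<dots> = (\<integral>x. (\<integral>w. \<eta> x * (u i w * (a (x - fst w) * \<beta> w)) \<partial>lborel) \<partial>lborel)"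
    proof (rule Bochner_Integration.integral_cong[OF refl])
      fix x :: 'a
      have "(\<integral>w. u i w * (a (x - fst w) * \<beta> w) \<partial>lborel) =
         (\<integral>w. u i w * (a (x - fst w) * b (t - snd w)) \<partial>lborel) - (\<integral>w. u i w * (a (x - fst w) * b (s - snd w)) \<partial>lborel)"
        using inner by (subst Bochner_Integration.integral_diff[symmetric]) (auto simp: \<beta>_def algebra_simps)
      thus "\<eta> x * (\<integral>w. u i w * (a (x - fst w) * b (t - snd w)) \<partial>lborel) -
        \<eta> x * (\<integral>w. u i w * (a (x - fst w) * b (s - snd w)) \<partial>lborel) =
        (\<integral>w. \<eta> x * (u i w * (a (x - fst w) * \<beta> w)) \<partial>lborel)"
        by (simp add: right_diff_distrib)
    qed
    also have "\<dots> = (\<integral>w. (\<integral>x. \<eta> x * (u i w * (a (x - fst w) * \<beta> w)) \<partial>lborel) \<partial>lborel)"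
    proof (rule lborel_pair.Fubini_integral[symmetric])
      have "integrable ?M (\<lambda>(x, w). \<eta> x * u i w * (a (fst (x, w) - fst (snd (x, w))) * \<beta> (snd (x, w))))"
      proof (rule integrable_product_bounded_kernel[OF \<eta>(3) u[OF i]])
        show "\<bar>a (fst (x, w) - fst (snd (x, w))) * \<beta> (snd (x, w))\<bar> \<le> C * (2 * C)" for x :: 'a and w :: "'a \<times> real"
          unfolding abs_mult using a(2,3) \<beta>C C0 by (intro mult_mono) auto
      qed measurable
      thus "integrable ?M (\<lambda>(x, w). \<eta> x * (u i w * (a (x - fst w) * \<beta> w)))"
        by (simp add: mult.assoc)
    qed
    (* The substitution x = fst w + h moves the spatial mollification onto \<eta>. *)
    also have "\<dots> = (\<integral>w. (\<integral>h. a h * u i w * (\<eta> (fst w + h) * \<beta> w) \<partial>lborel) \<partial>lborel)"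
    proof (rule Bochner_Integration.integral_cong[OF refl])
      fix w
      have "integrable lborel (\<lambda>x. \<eta> x * (u i w * (a (x - fst w) * \<beta> w)))"
      proof (rule integrable_mult_kernel[OF \<eta>(3)])
        show "\<bar>u i w * (a (x - fst w) * \<beta> w)\<bar> \<le> \<bar>u i w\<bar> * (C * (2 * C))" for x
          unfolding abs_mult using a(2,3) \<beta>C C0 by (intro mult_left_mono mult_mono) auto
      qed measurable
      from integral_lborel_affine(2)[OF this, of 1 "fst w"]
      show "(\<integral>x. \<eta> x * (u i w * (a (x - fst w) * \<beta> w)) \<partial>lborel) =
          (\<integral>h. a h * u i w * (\<eta> (fst w + h) * \<beta> w) \<partial>lborel)"
        by (simp add: mult_ac)
    qed
    also have "\<dots> = (\<integral>h. (\<integral>w. a h * u i w * (\<eta> (fst w + h) * \<beta> w) \<partial>lborel) \<partial>lborel)"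
    proof (rule lborel_pair.Fubini_integral)
      have "integrable ?M (\<lambda>(h, w). a h * u i w * (\<eta> (fst (snd (h, w)) + fst (h, w)) * \<beta> (snd (h, w))))"
      proof (rule integrable_product_bounded_kernel[OF ia u[OF i]])
        show "\<bar>\<eta> (fst (snd (h, w)) + fst (h, w)) * \<beta> (snd (h, w))\<bar> \<le> C * (2 * C)" for h :: 'a and w :: "'a \<times> real"
          unfolding abs_mult using \<eta>(2) \<beta>C C0 by (intro mult_mono) auto
      qed measurable
      thus "integrable ?M (\<lambda>(h, w). a h * u i w * (\<eta> (fst w + h) * \<beta> w))"
        by simp
    qed
    also have "\<dots> = (\<integral>h. (\<integral>w. J i (h, w) \<partial>lborel) \<partial>lborel)"
    proof (rule Bochner_Integration.integral_cong[OF refl])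
      fix h :: 'a
      show "(\<integral>w. a h * u i w * (\<eta> (fst w + h) * \<beta> w) \<partial>lborel) = (\<integral>w. J i (h, w) \<partial>lborel)"
      proof (cases "a h = 0")
        case False
        show ?thesis
          using weak[OF i False] by (simp add: J_def d_def \<beta>_def mult.assoc)
      qed (simp add: J_def)
    qed
    also have "\<dots> = (\<integral>p. J i p \<partial>?M)"
      by (rule lborel_pair.integral_fst'[OF Jint[OF i]])
    finally show ?thesis .
  qed
  have "vnorm N (\<lambda>i. m i t - m i s) = vnorm N (\<lambda>i. \<integral>p. J i p \<partial>?M)"
    by (rule vnorm_cong) (rule rep)
  also have "\<dots> \<le> (\<integral>p. vnorm N (\<lambda>i. J i p) \<partial>?M)"
    by (rule vnorm_integral_le) (rule Jint)
  also have "\<dots> \<le> (\<integral>(h, w). a h * (C' * vnorm N (\<lambda>i. G i w)) \<partial>?M)"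
  proof (rule integral_mono)
    show "integrable ?M (\<lambda>p. vnorm N (\<lambda>i. J i p))"
      by (rule integrable_vnorm) (rule Jint)
    show "integrable ?M (\<lambda>(h, w). a h * (C' * vnorm N (\<lambda>i. G i w)))"
      using ia by (intro integrable_lborel_product integrable_mult_right integrable_vnorm G) auto
    fix p :: "'a \<times> 'a \<times> real"
    obtain g where g: "\<And>h. d p h = h \<bullet> g" "norm g \<le> C'"
      by (rule gradient_vector[OF lin[of p] dle[of p]]) blast
    have "vnorm N (\<lambda>i. J i p) = \<bar>a (fst p) * Z (snd (snd p))\<bar> * vnorm N (\<lambda>i. G i (snd p) \<bullet> g)"
      using vnorm_scaleR[of N "a (fst p) * Z (snd (snd p))" "\<lambda>i. G i (snd p) \<bullet> g"]
      by (simp add: J_def g mult_ac)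
    also have "\<dots> \<le> a (fst p) * (vnorm N (\<lambda>i. G i (snd p)) * norm g)"
      using a(2) Z(2) by (intro mult_mono vnorm_inner_le) (auto simp: abs_mult intro: mult_left_le)
    also have "\<dots> \<le> a (fst p) * (vnorm N (\<lambda>i. G i (snd p)) * C')"
      using a(2) g by (intro mult_left_mono) auto
    finally show "vnorm N (\<lambda>i. J i p) \<le> (case p of (h, w) \<Rightarrow> a h * (C' * vnorm N (\<lambda>i. G i w)))"
      by (simp add: split_beta' mult_ac)
  qed
  also have "\<dots> = (\<integral>h. (\<integral>w. a h * (C' * vnorm N (\<lambda>i. G i w)) \<partial>lborel) \<partial>lborel)"
  proof -
    have "integrable ?M (\<lambda>(h, w). a h * (C' * vnorm N (\<lambda>i. G i w)))"
      using ia by (intro integrable_lborel_product integrable_mult_right integrable_vnorm G) auto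
    from lborel_pair.integral_fst'[OF this] show ?thesis by simp
  qed
  also have "\<dots> = C' * (\<integral>w. vnorm N (\<lambda>i. G i w) \<partial>lborel)"
    using a1 by simp
  finally show ?thesis .
qed

section \<open>Test functions built from bumps\<close>

lemma compactly_insideI:
  fixes S :: "'a::euclidean_space set"
  assumes "S \<subseteq> K" "compact K" "K \<subseteq> U"
  shows "compactly_inside S U"
proof -
  have "closure S \<subseteq> K"
    using assms by (intro closure_minimal compact_imp_closed)
  moreover have "compact (closure S)"
    using assms bounded_subset[OF compact_imp_bounded] by (auto simp: compact_closure)
  ultimately show ?thesis using assms by (auto simp: compactly_inside_def)
qed

lemma Ck_compose_fst:
  fixes f :: "'a::euclidean_space \<Rightarrow> real"
  shows "Ck n f \<Longrightarrow> Ck n (\<lambda>z::'a \<times> 'b::euclidean_space. f (fst z + c))"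
  by (rule Ck_affine[OF bounded_linear_fst])

lemma Ck_compose_snd:
  fixes f :: "'b::euclidean_space \<Rightarrow> real"
  shows "Ck n f \<Longrightarrow> Ck n (\<lambda>z::'a::euclidean_space \<times> 'b. f (snd z + c))"
  by (rule Ck_affine[OF bounded_linear_snd])

lemma reflected_kernel_test_function:
  fixes k :: "'a::euclidean_space \<times> real \<Rightarrow> real"
  assumes k: "\<And>j. Ck j k" "\<And>z. \<epsilon> \<le> norm (fst z) \<or> \<epsilon> \<le> \<bar>snd z\<bar> \<Longrightarrow> k z = 0"
    and sub: "cball x \<epsilon> \<times> {t - \<epsilon>..t + \<epsilon>} \<subseteq> U"
  shows "(\<lambda>w. k ((x, t) - w)) \<in> test_functions U"
  unfolding test_functions_def mem_Collect_eq
proof (intro conjI allI)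
  show "Ck j (\<lambda>w. k ((x, t) - w))" for j
    by (rule Ck_reflected_shift[OF k(1)])
  show "compactly_inside {w. k ((x, t) - w) \<noteq> 0} U"
  proof (rule compactly_insideI[OF _ _ sub])
    show "{w. k ((x, t) - w) \<noteq> 0} \<subseteq> cball x \<epsilon> \<times> {t - \<epsilon>..t + \<epsilon>}"
    proof
      fix w assume "w \<in> {w. k ((x, t) - w) \<noteq> 0}"
      hence "norm (x - fst w) < \<epsilon>" "\<bar>t - snd w\<bar> < \<epsilon>"
      proof -
        have "\<not> (\<epsilon> \<le> norm (fst ((x, t) - w)) \<or> \<epsilon> \<le> \<bar>snd ((x, t) - w)\<bar>)"
          using k(2)[of "(x, t) - w"] \<open>w \<in> _\<close> by blast
        thus "norm (x - fst w) < \<epsilon>" "\<bar>t - snd w\<bar> < \<epsilon>" by simp_all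
      qed
      thus "w \<in> cball x \<epsilon> \<times> {t - \<epsilon>..t + \<epsilon>}"
        by (cases w) (auto simp: dist_norm)
    qed
  qed (intro compact_Times compact_cball compact_Icc)
qed

text \<open>
  A smooth step, equal to \<open>0\<close> before and to \<open>1\<close> after the support of
  \<open>b\<close>; a difference of two translates is then a compactly supported primitive of a
  difference of two translates of \<open>b\<close>.
\<close>

lemma bump_antiderivative:
  fixes b :: "real \<Rightarrow> real"
  assumes cont: "continuous_on UNIV b" and b: "\<And>t. 0 \<le> b t" "\<And>t. \<epsilon> \<le> \<bar>t\<bar> \<Longrightarrow> b t = 0"
    "(\<integral>\<^sup>+t. b t \<partial>lborel) = 1" and \<epsilon>: "0 < \<epsilon>"
  shows "\<exists>H. \<forall>r. (H has_real_derivative b r) (at r) \<and> 0 \<le> H r \<and> H r \<le> 1 \<and>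
    (r \<le> -\<epsilon> \<longrightarrow> H r = 0) \<and> (\<epsilon> \<le> r \<longrightarrow> H r = 1)"
proof -
  have [measurable]: "b \<in> borel_measurable borel"
    using cont by (rule borel_measurable_continuous_onI)
  have ib: "integrable lborel b"
    using b by (intro integrableI_nonneg) auto
  have b1: "(\<integral>t. b t \<partial>lborel) = 1"
    using b by (subst integral_eq_nn_integral) auto
  define H where "H r = (\<integral>t. indicator {..r} t * b t \<partial>lborel)" for r :: real
  have iH: "integrable lborel (\<lambda>t. indicator {..r} t * b t)" for r :: real
    using integrable_mult_indicator[OF _ ib, of "{..r}"] by simp
  have "0 \<le> H r" for r
    unfolding H_def using b(1) by (intro Bochner_Integration.integral_nonneg) (auto simp: indicator_def)
  moreover have "H r \<le> 1" for r
    unfolding H_def b1[symmetric]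
    by (rule integral_mono[OF iH ib]) (auto simp: indicator_def b)
  moreover have "H r = 0" if "r \<le> -\<epsilon>" for r
  proof -
    have "(\<lambda>t. indicator {..r} t * b t) = (\<lambda>t. 0)"
      using that b(2) \<epsilon> by (intro ext) (auto simp: indicator_def)
    thus ?thesis by (simp add: H_def)
  qed
  moreover have "H r = 1" if "\<epsilon> \<le> r" for r
  proof -
    have "(\<lambda>t. indicator {..r} t * b t) = b"
      using that b(2) \<epsilon> by (intro ext) (auto simp: indicator_def)
    thus ?thesis by (simp add: H_def b1)
  qed
  moreover have "(H has_real_derivative b r) (at r)" for r
  proof -
    define c where "c = min (-\<epsilon>) r - 1"
    have eq: "H y = integral {c..y} b" for y
    proof -
      have "(\<lambda>t. indicator {..y} t * b t) = (\<lambda>t. indicator {c..y} t *\<^sub>R b t)"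
        using b(2) \<epsilon> by (intro ext) (auto simp: indicator_def c_def)
      hence "H y = (LINT t:{c..y}|lborel. b t)"
        by (simp add: H_def set_lebesgue_integral_def)
      also have "\<dots> = integral {c..y} b"
        unfolding set_integrable_def using integrable_mult_indicator[OF _ ib, of "{c..y}"]
        by (intro set_borel_integral_eq_integral) (simp add: set_integrable_def)
      finally show ?thesis .
    qed
    have "((\<lambda>y. integral {c..y} b) has_real_derivative b r) (at r within {c..r + 1})"
      by (rule integral_has_real_derivative[OF continuous_on_subset[OF cont]]) (auto simp: c_def)
    moreover have "at r within {c..r + 1} = at r"
      by (rule at_within_interior) (auto simp: c_def interior_atLeastAtMost_real)
    ultimately show ?thesis by (simp add: eq[abs_def])
  qed
  ultimately show ?thesis by (intro exI[of _ H]) blast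
qed

lemma Ck_antiderivative:
  fixes H b :: "real \<Rightarrow> real"
  assumes "\<And>j. Ck j b" "\<And>r. (H has_real_derivative b r) (at r)"
  shows "Ck j H"
proof (rule Ck_Suc_imp, rule Ck_SucI)
  show "(H has_derivative (\<lambda>h. b r * h)) (at r)" for r
    using assms(2) by (simp add: has_field_derivative_def)
qed (use assms(1) in auto)

lemma separated_test_function:
  fixes \<eta> :: "'a::euclidean_space \<Rightarrow> real" and Z :: "real \<Rightarrow> real"
  assumes \<eta>: "\<And>j. Ck j \<eta>" and Z: "\<And>j. Ck j Z" "\<And>r. (Z has_real_derivative Z' r) (at r)"
    and K: "compact K" "compact J" "K \<times> J \<subseteq> U"
      "\<And>y. \<eta> (y + h) \<noteq> 0 \<Longrightarrow> y \<in> K" "\<And>r. Z r \<noteq> 0 \<Longrightarrow> r \<in> J"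
  defines "\<phi> \<equiv> \<lambda>w. \<eta> (fst w + h) * Z (snd w)"
  shows "\<phi> \<in> test_functions U"
    and "frechet_derivative \<phi> (at w) (0, 1) = \<eta> (fst w + h) * Z' (snd w)"
    and "frechet_derivative \<phi> (at w) (g, 0) = frechet_derivative \<eta> (at (fst w + h)) g * Z (snd w)"
proof -
  have "Ck j \<phi>" for j
    unfolding \<phi>_def using Ck_compose_fst[OF \<eta>] Ck_compose_snd[OF Z(1), of _ 0]
    by (intro Ck_mult) auto
  moreover have "compactly_inside {w. \<phi> w \<noteq> 0} U"
    by (rule compactly_insideI[OF _ compact_Times[OF K(1,2)] K(3)])
      (use K(4,5) in \<open>auto simp: \<phi>_def\<close>)
  ultimately show "\<phi> \<in> test_functions U"
    by (auto simp: test_functions_def)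
  have "((\<lambda>w::'a \<times> real. fst w + h) has_derivative fst) (at w)"
    by (auto intro!: derivative_eq_intros)
  from has_derivative_compose[OF this Ck_has_derivative[OF \<eta>]]
  have 1: "((\<lambda>w. \<eta> (fst w + h)) has_derivative (\<lambda>e. frechet_derivative \<eta> (at (fst w + h)) (fst e))) (at w)" .
  have "((\<lambda>w::'a \<times> real. snd w) has_derivative snd) (at w)"
    by (auto intro!: derivative_eq_intros)
  from has_derivative_compose[OF this Z(2)[unfolded has_field_derivative_def]]
  have 2: "((\<lambda>w. Z (snd w)) has_derivative (\<lambda>e. Z' (snd w) * snd e)) (at w)" .
  from frechet_derivative_at[OF has_derivative_mult[OF 1 2], symmetric]
  have d: "frechet_derivative \<phi> (at w) = (\<lambda>e. \<eta> (fst w + h) * (Z' (snd w) * snd e) +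
     frechet_derivative \<eta> (at (fst w + h)) (fst e) * Z (snd w))"
    by (simp add: \<phi>_def)
  have "frechet_derivative \<eta> (at (fst w + h)) 0 = 0"
    by (rule linear_0[OF has_derivative_linear[OF Ck_has_derivative[OF \<eta>]]])
  thus "frechet_derivative \<phi> (at w) (0, 1) = \<eta> (fst w + h) * Z' (snd w)"
    "frechet_derivative \<phi> (at w) (g, 0) = frechet_derivative \<eta> (at (fst w + h)) g * Z (snd w)"
    by (simp_all add: d)
qed

lemma powr_add3_le:
  fixes a b c q :: real
  assumes "0 \<le> a" "0 \<le> b" "0 \<le> c" "0 \<le> q"
  shows "(a + b + c) powr q \<le> 3 powr q * (a powr q + b powr q + c powr q)"
proof -
  define m where "m = max a (max b c)"
  have "(a + b + c) powr q \<le> (3 * m) powr q"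
    using assms by (intro powr_mono2) (auto simp: m_def)
  also have "\<dots> = 3 powr q * m powr q"
    using assms by (intro powr_mult)
  also have "m powr q \<le> a powr q + b powr q + c powr q"
    using powr_ge_zero[of a q] powr_ge_zero[of b q] powr_ge_zero[of c q]
    unfolding m_def max_def by (auto simp del: powr_ge_zero)
  finally show ?thesis by simp
qed

section \<open>Oscillation over a cylinder\<close>

text \<open>
  The weak spatial gradient and the equation \<open>u\<^sub>t = div G\<close>, both tested in
  space-time and for scalar \<open>u\<close>. The integrals are over the whole space, because
  \<open>u\<close>, \<open>D\<close> and \<open>G\<close> will be Borel functions vanishing off
  \<open>U\<close>.
\<close>

definition distributional_space_gradient ::
  "('a::euclidean_space \<times> real) set \<Rightarrow> ('a \<times> real \<Rightarrow> real) \<Rightarrow> ('a \<times> real \<Rightarrow> 'a) \<Rightarrow> bool" where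
  "distributional_space_gradient U u D \<longleftrightarrow> (\<forall>\<phi>\<in>test_functions U. \<forall>e.
     (\<integral>w. u w * frechet_derivative \<phi> (at w) (e, 0) \<partial>lborel) = - (\<integral>w. (D w \<bullet> e) * \<phi> w \<partial>lborel))"

definition distributional_time_divergence ::
  "('a::euclidean_space \<times> real) set \<Rightarrow> ('a \<times> real \<Rightarrow> real) \<Rightarrow> ('a \<times> real \<Rightarrow> 'a) \<Rightarrow> bool" where
  "distributional_time_divergence U u G \<longleftrightarrow> (\<forall>\<phi>\<in>test_functions U.
     (\<integral>w. u w * frechet_derivative \<phi> (at w) (0, 1) \<partial>lborel) =
     (\<integral>w. frechet_derivative \<phi> (at w) (G w, 0) \<partial>lborel))"

text \<open>
  On the cylinder shrunk by \<open>2\<epsilon>\<close> the kernels of size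
  \<open>\<epsilon>\<close> are test functions on \<open>U\<close>. For two points
  \<open>z\<close>, \<open>z'\<close> of the small cylinder the difference of the values of the
  mollification is split into the deviations from the weighted means at their two times, bounded
  by \<open>mollified_poincare\<close>, and the difference of these means, bounded by
  \<open>mollified_mean_increment\<close>. The right-hand side does not depend on
  \<open>\<epsilon>\<close>.
\<close>

lemma mollified_oscillation_bound:
  fixes u :: "nat \<Rightarrow> 'a::euclidean_space \<times> real \<Rightarrow> real" and D G :: "nat \<Rightarrow> 'a \<times> real \<Rightarrow> 'a"
    and a \<eta> :: "'a \<Rightarrow> real" and b :: "real \<Rightarrow> real"
  assumes U: "U = ball x0 \<rho> \<times> {t0 - s<..<t0 + s}"
    and u: "\<And>i. i < N \<Longrightarrow> integrable lborel (u i)" and D: "\<And>i. i < N \<Longrightarrow> integrable lborel (D i)"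
    and G: "\<And>i. i < N \<Longrightarrow> integrable lborel (G i)"
    and space_weak: "\<And>i. i < N \<Longrightarrow> distributional_space_gradient U (u i) (D i)"
    and time_weak: "\<And>i. i < N \<Longrightarrow> distributional_time_divergence U (u i) (G i)"
    and q: "1 \<le> q" and \<epsilon>: "0 < \<epsilon>" "8 * \<epsilon> \<le> \<rho>" "2 * \<epsilon> < s"
    and a: "smooth_bump 0 \<epsilon> Ca a" and b: "smooth_bump 0 \<epsilon> Cb b" and \<eta>: "smooth_bump x0 (\<rho> / 2) Ce \<eta>"
    and v: "\<And>i z. v i z = (\<integral>w. u i w * (a (fst z - fst w) * b (snd z - snd w)) \<partial>lborel)"
    and Q': "Q' = ball x0 (\<rho> - 2 * \<epsilon>) \<times> {t0 - (s - 2 * \<epsilon>)<..<t0 + (s - 2 * \<epsilon>)}"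
  shows "(\<integral>\<^sup>+z. (\<integral>\<^sup>+z'. indicator Q' z * indicator Q' z' *
      ennreal (vnorm N (\<lambda>i. v i z - v i z') powr q) \<partial>lborel) \<partial>lborel) \<le>
    ennreal (3 powr q) * emeasure lborel U *
      (ennreal (2 * (Ce / (\<rho> / 2) ^ DIM('a)) * (2 * \<rho>) powr q * 2 ^ DIM('a)) * emeasure lborel (ball x0 \<rho>) *
         (\<integral>\<^sup>+w. ennreal (vnorm N (\<lambda>i. D i w) powr q) \<partial>lborel) +
       emeasure lborel U * ennreal ((Ce / (\<rho> / 2) ^ Suc DIM('a) * (\<integral>w. vnorm N (\<lambda>i. G i w) \<partial>lborel)) powr q))"
proof -
  define H where "H = Ce / (\<rho> / 2) ^ DIM('a)"
  define H' where "H' = Ce / (\<rho> / 2) ^ Suc DIM('a)"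
  define C where "C = max (Ca / \<epsilon> ^ DIM('a)) (Cb / \<epsilon>)"
  note a = smooth_bumpD[OF a, simplified] and b = smooth_bumpD[OF b, simplified]
    and \<eta> = smooth_bumpD[OF \<eta>, folded H_def H'_def]
  have aC: "a x \<le> C" and bC: "b t \<le> C" for x t
    using a(3)[of x] b(3)[of t] by (auto simp: C_def)
  define r where "r = \<rho> - 2 * \<epsilon>"
  define I where "I = {t0 - (s - 2 * \<epsilon>)<..<t0 + (s - 2 * \<epsilon>)}"
  let ?B = "ball x0 r"
  have r0: "0 < r" "r \<le> \<rho>" "\<rho> / 2 \<le> r" using \<epsilon> by (auto simp: r_def)
  have Q'_eq: "Q' = ?B \<times> I" by (simp add: Q' r_def I_def)
  have am[measurable]: "a \<in> borel_measurable borel" and bm[measurable]: "b \<in> borel_measurable borel"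
    and \<eta>m[measurable]: "\<eta> \<in> borel_measurable borel"
    using Ck_measurable a(1) b(1) \<eta>(1) by blast+
  have Im[measurable]: "I \<in> sets borel" by (simp add: I_def)
  have C0: "0 \<le> C" using b(2)[of 0] bC[of 0] by linarith
  have H0: "0 \<le> H" using \<eta>(2,3)[of 0] by linarith
  have um: "i < N \<Longrightarrow> u i \<in> borel_measurable borel" for i
    using borel_measurable_integrable[OF u] by simp
  define k where "k z = a (fst z) * b (snd z)" for z
  have kCk: "Ck j k" for j
    unfolding k_def[abs_def] using Ck_compose_fst[OF a(1), of _ 0] Ck_compose_snd[OF b(1), of _ 0]
    by (intro Ck_mult) auto
  have k0: "0 \<le> k z" for z using a(2) b(2) by (simp add: k_def)
  have kz: "k z = 0" if "\<epsilon> \<le> norm (fst z) \<or> \<epsilon> \<le> \<bar>snd z\<bar>" for z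
    using that a(4) b(4) by (auto simp: k_def)
  have kC: "k z \<le> C * C" for z
    unfolding k_def using a(2) aC b(2) bC C0 by (intro mult_mono) auto
  have "k z = 0" if "2 * \<epsilon> \<le> norm z" for z
  proof (rule kz, rule ccontr)
    assume *: "\<not> (\<epsilon> \<le> norm (fst z) \<or> \<epsilon> \<le> \<bar>snd z\<bar>)"
    have "norm z \<le> norm (fst z) + norm (snd z)"
      using norm_Pair_le[of "fst z" "snd z"] by simp
    with * that show False by (simp add: not_le)
  qed
  then obtain C0 where C0': "\<And>z h. \<bar>frechet_derivative k (at z) h\<bar> \<le> C0 * norm h"
    using Ck_derivative_bounded[OF kCk] by blast
  define C1 where "C1 = max (C * C) C0"
  have C1: "k z \<le> C1" "\<bar>frechet_derivative k (at z) h\<bar> \<le> C1 * norm h" for z h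
  proof -
    show "k z \<le> C1" using kC[of z] by (simp add: C1_def)
    have "C0 * norm h \<le> C1 * norm h" by (intro mult_right_mono) (auto simp: C1_def)
    thus "\<bar>frechet_derivative k (at z) h\<bar> \<le> C1 * norm h" using C0'[of z h] by linarith
  qed
  have km[measurable]: "k \<in> borel_measurable borel" using kCk by (rule Ck_measurable)
  have k1: "(\<integral>\<^sup>+z. k z \<partial>lborel) = 1"
  proof -
    have "(\<integral>\<^sup>+z. k z \<partial>lborel) = (\<integral>\<^sup>+x. (\<integral>\<^sup>+t. k (x, t) \<partial>lborel) \<partial>lborel)"
      by (rule nn_integral_lborel_pair) simp
    also have "\<dots> = (\<integral>\<^sup>+x. a x * (\<integral>\<^sup>+t. b t \<partial>lborel) \<partial>lborel)"
      using a(2) b(2) by (subst nn_integral_cmult[symmetric]) (auto simp: k_def ennreal_mult)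
    finally show ?thesis using a(6) b(6) by simp
  qed
  have vk: "v i z = (\<integral>w. u i w * k (z - w) \<partial>lborel)" for i z
    by (simp add: v k_def)
  have vm: "v i \<in> borel_measurable borel" if "i < N" for i
  proof -
    have [measurable]: "u i \<in> borel_measurable borel" using um that .
    show ?thesis unfolding vk[abs_def] by measurable
  qed
  have vbound: "\<bar>v i z\<bar> \<le> C * C * (\<integral>w. \<bar>u i w\<bar> \<partial>lborel)" if "i < N" for i z
  proof -
    have "\<bar>v i z\<bar> \<le> (\<integral>w. \<bar>u i w * k (z - w)\<bar> \<partial>lborel)"
      unfolding vk by simp
    also have "\<dots> \<le> (\<integral>w. (C * C) * \<bar>u i w\<bar> \<partial>lborel)"
    proof (rule integral_mono)
      show "integrable lborel (\<lambda>w. \<bar>u i w * k (z - w)\<bar>)"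
        using kC k0 by (intro integrable_abs integrable_mult_kernel[OF u[OF that], where C="C * C"]) auto
      show "integrable lborel (\<lambda>w. (C * C) * \<bar>u i w\<bar>)"
        using u[OF that] by auto
      show "\<bar>u i w * k (z - w)\<bar> \<le> (C * C) * \<bar>u i w\<bar>" for w
        using mult_left_mono[OF kC[of "z - w"], of "\<bar>u i w\<bar>"] k0[of "z - w"]
        by (simp add: abs_mult mult.commute)
    qed
    finally show ?thesis by simp
  qed
  have i\<eta>: "integrable lborel \<eta>"
    using \<eta> by (intro integrableI_nonneg) auto
  have \<eta>1: "(\<integral>x. \<eta> x \<partial>lborel) = 1"
    using \<eta> by (subst integral_eq_nn_integral) auto

  (* The kernels centred at points of the shrunk cylinder have their supports in U. *)
  have space: "(\<integral>\<^sup>+(t, x, y). indicator I t * (indicator ?B x * indicator ?B y *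
       ennreal (vnorm N (\<lambda>i. v i (x, t) - v i (y, t)) powr q)) \<partial>lborel)
    \<le> ennreal ((2 * r) powr q * 2 ^ DIM('a)) * emeasure lborel ?B *
       (\<integral>\<^sup>+w. ennreal (vnorm N (\<lambda>i. D i w) powr q) \<partial>lborel)"
    unfolding vk
  proof (rule mollified_poincare[OF u D kCk k0 C1 k1 _ q])
    fix i e x t assume i: "i < N" and x: "x \<in> ?B" and t: "t \<in> I"
    have "(\<lambda>w. k ((x, t) - w)) \<in> test_functions U"
    proof (rule reflected_kernel_test_function[where \<epsilon>=\<epsilon>])
      show "cball x \<epsilon> \<times> {t - \<epsilon>..t + \<epsilon>} \<subseteq> U"
      proof (clarsimp simp: U, safe)
        fix y assume "dist x y \<le> \<epsilon>"
        thus "dist x0 y < \<rho>"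
          using x dist_triangle[of x0 y x] \<epsilon>(1) by (simp add: r_def)
      qed (use t \<epsilon>(1) in \<open>auto simp: I_def\<close>)
    qed (use kCk kz in auto)
    from space_weak[OF i, unfolded distributional_space_gradient_def, rule_format, OF this, of e]
    show "(\<integral>w. u i w * frechet_derivative (\<lambda>w. k ((x, t) - w)) (at w) (e, 0) \<partial>lborel) =
      - (\<integral>w. (D i w \<bullet> e) * k ((x, t) - w) \<partial>lborel)" .
  qed (use r0 in auto)

  define m where "m i t = (\<integral>x. \<eta> x * v i (x, t) \<partial>lborel)" for i t
  define M where "M = H' * (\<integral>w. vnorm N (\<lambda>i. G i w) \<partial>lborel)"
  obtain A where A: "\<And>r. (A has_real_derivative b r) (at r)" "\<And>r. 0 \<le> A r" "\<And>r. A r \<le> 1"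
    "\<And>r. r \<le> - \<epsilon> \<Longrightarrow> A r = 0" "\<And>r. \<epsilon> \<le> r \<Longrightarrow> A r = 1"
  proof -
    have "continuous_on UNIV b" using b(1)[of 0] by simp
    from bump_antiderivative[OF this b(2,4,6) \<epsilon>(1)] that show ?thesis by blast
  qed
  have mean: "vnorm N (\<lambda>i. m i t - m i t') \<le> M" if t: "t \<in> I" "t' \<in> I" for t t'
  proof -
    define Z where "Z r = A (t' - r) + (-1) * A (t - r)" for r
    have ACk: "Ck j A" for j by (rule Ck_antiderivative[OF b(1) A(1)])
    have ZCk: "Ck j Z" for j
      unfolding Z_def[abs_def] by (intro Ck_add Ck_mult Ck_const Ck_reflected_shift ACk)
    have Zd: "(Z has_real_derivative (b (t - r) - b (t' - r))) (at r)" for r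
      unfolding Z_def[abs_def]
      by (auto intro!: derivative_eq_intros DERIV_chain2[OF A(1)])
    have Z1: "\<bar>Z r\<bar> \<le> 1" for r
      using A(2)[of "t' - r"] A(3)[of "t' - r"] A(2)[of "t - r"] A(3)[of "t - r"] by (auto simp: Z_def)
    (* Off J both steps are 0 or both are 1, so the support of Z is compact. *)
    define J where "J = {min t t' - \<epsilon>..max t t' + \<epsilon>}"
    have ZJ: "r \<in> J" if "Z r \<noteq> 0" for r
    proof (rule ccontr)
      assume "r \<notin> J"
      hence "(\<epsilon> \<le> t - r \<and> \<epsilon> \<le> t' - r) \<or> (t - r \<le> - \<epsilon> \<and> t' - r \<le> - \<epsilon>)"
        by (auto simp: J_def)
      hence "Z r = 0" using A(4,5) by (auto simp: Z_def)
      with that show False by simp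
    qed
    have "vnorm N (\<lambda>i. (\<integral>x. \<eta> x * (\<integral>w. u i w * (a (x - fst w) * b (t - snd w)) \<partial>lborel) \<partial>lborel) -
        (\<integral>x. \<eta> x * (\<integral>w. u i w * (a (x - fst w) * b (t' - snd w)) \<partial>lborel) \<partial>lborel)) \<le>
        H' * (\<integral>w. vnorm N (\<lambda>i. G i w) \<partial>lborel)"
    proof (rule mollified_mean_increment[where C="max C H" and Z=Z])
      show "Z \<in> borel_measurable borel" using ZCk by (rule Ck_measurable)
      fix i h assume i: "i < N" and "a h \<noteq> 0"
      hence h: "norm h < \<epsilon>" using a(4) not_le by blast
      let ?\<phi> = "\<lambda>w. \<eta> (fst w + h) * Z (snd w)"
      have K: "cball x0 (\<rho> / 2 + \<epsilon>) \<times> J \<subseteq> U"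
        using t \<epsilon> by (auto simp: U J_def I_def min_def max_def)
      have "y \<in> cball x0 (\<rho> / 2 + \<epsilon>)" if "\<eta> (y + h) \<noteq> 0" for y
      proof -
        have "norm (y + h - x0) < \<rho> / 2" using that \<eta>(4) not_le by blast
        thus ?thesis
          using norm_triangle_ineq4[of "y + h - x0" h] h by (simp add: dist_norm norm_minus_commute)
      qed
      note T = separated_test_function[OF \<eta>(1) ZCk Zd compact_cball _ K this ZJ, folded J_def]
      have cJ: "compact J" by (simp add: J_def)
      have "?\<phi> \<in> test_functions U" by (rule T(1)[OF cJ])
      from time_weak[OF i, unfolded distributional_time_divergence_def, rule_format, OF this]
      show "(\<integral>w. u i w * (\<eta> (fst w + h) * (b (t - snd w) - b (t' - snd w))) \<partial>lborel) =
        (\<integral>w. frechet_derivative \<eta> (at (fst w + h)) (G i w) * Z (snd w) \<partial>lborel)"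
        by (simp add: T(2,3)[OF cJ])
    next
      show "a x \<le> max C H" for x using aC[of x] by simp
      show "\<bar>b x\<bar> \<le> max C H" for x using b(2)[of x] bC[of x] by simp
      show "\<bar>\<eta> x\<bar> \<le> max C H" for x using \<eta>(2,3)[of x] by simp
    qed (use u G a \<eta> i\<eta> Z1 in auto)
    thus ?thesis by (simp add: m_def v M_def)
  qed

  define V where "V z = ennreal (vnorm N (\<lambda>i. v i z - m i (snd z)) powr q)" for z
  have mm: "m i \<in> borel_measurable borel" if "i < N" for i
  proof -
    note [measurable] = vm[OF that]
    show ?thesis unfolding m_def[abs_def] by measurable
  qed
  have "(\<lambda>z. vnorm N (\<lambda>i. v i z - m i (snd z))) \<in> borel_measurable borel"
  proof (rule vnorm_measurable)
    fix i assume i: "i < N"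
    note [measurable] = vm[OF i] mm[OF i]
    show "(\<lambda>z. v i z - m i (snd z)) \<in> borel_measurable borel" by measurable
  qed
  note [measurable] = this
  have Vm[measurable]: "V \<in> borel_measurable borel"
    unfolding V_def[abs_def] by measurable
  have diffm: "(\<lambda>y. vnorm N (\<lambda>i. v i (x, t) - v i (y, t))) \<in> borel_measurable borel" for x t
  proof (rule vnorm_measurable)
    fix i assume "i < N"
    note [measurable] = vm[OF this]
    show "(\<lambda>y. v i (x, t) - v i (y, t)) \<in> borel_measurable borel" by measurable
  qed
  define W where "W t x y = ennreal (vnorm N (\<lambda>i. v i (x, t) - v i (y, t)) powr q)" for t x y
  have Bm[measurable]: "?B \<in> sets borel" by simp
  have Wym: "(\<lambda>y. W t x y) \<in> borel_measurable borel" for x t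
    using measurable_compose[OF diffm[of x t], of "\<lambda>r. ennreal (r powr q)" borel]
    unfolding W_def by simp
  have Vle: "V (x, t) \<le> ennreal H * (\<integral>\<^sup>+y. indicator ?B y *
      ennreal (vnorm N (\<lambda>i. v i (x, t) - v i (y, t)) powr q) \<partial>lborel)" for x t
  proof -
    have iv: "integrable lborel (\<lambda>y. \<eta> y * (v i (x, t) - v i (y, t)))" "integrable lborel (\<lambda>y. \<eta> y * v i (y, t))"
      if i: "i < N" for i
    proof -
      note [measurable] = vm[OF i]
      show "integrable lborel (\<lambda>y. \<eta> y * v i (y, t))"
        by (rule integrable_mult_kernel[OF i\<eta> _ vbound[OF i]]) measurable
      thus "integrable lborel (\<lambda>y. \<eta> y * (v i (x, t) - v i (y, t)))"
        using i\<eta> by (simp add: right_diff_distrib)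
    qed
    let ?d = "vnorm N (\<lambda>i. v i (x, t) - m i t)"
    have "?d = vnorm N (\<lambda>i. \<integral>y. \<eta> y * (v i (x, t) - v i (y, t)) \<partial>lborel)"
      using iv(2) i\<eta> \<eta>1 by (intro vnorm_cong) (simp add: m_def right_diff_distrib)
    also have "\<dots> \<le> (\<integral>y. vnorm N (\<lambda>i. \<eta> y * (v i (x, t) - v i (y, t))) \<partial>lborel)"
      by (rule vnorm_integral_le) (rule iv)
    finally have "ennreal ?d \<le> ennreal (\<integral>y. vnorm N (\<lambda>i. \<eta> y * (v i (x, t) - v i (y, t))) \<partial>lborel)"
      by (rule ennreal_leI)
    also have "\<dots> = (\<integral>\<^sup>+y. vnorm N (\<lambda>i. \<eta> y * (v i (x, t) - v i (y, t))) \<partial>lborel)"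
      by (intro nn_integral_eq_integral[symmetric] integrable_vnorm iv) auto
    also have "\<dots> = (\<integral>\<^sup>+y. vnorm N (\<lambda>i. v i (x, t) - v i (y, t)) * \<eta> y \<partial>lborel)"
    proof (rule nn_integral_cong)
      fix y
      show "ennreal (vnorm N (\<lambda>i. \<eta> y * (v i (x, t) - v i (y, t)))) =
        ennreal (vnorm N (\<lambda>i. v i (x, t) - v i (y, t)) * \<eta> y)"
        using vnorm_scaleR[of N "\<eta> y" "\<lambda>i. v i (x, t) - v i (y, t)"] \<eta>(2)[of y]
        by (simp add: mult.commute)
    qed
    finally have "ennreal (?d powr q) \<le> (\<integral>\<^sup>+y. vnorm N (\<lambda>i. v i (x, t) - v i (y, t)) powr q * \<eta> y \<partial>lborel)"
      using diffm \<eta> q by (intro weighted_powr_mean_le) auto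
    also have "\<dots> \<le> (\<integral>\<^sup>+y. ennreal H * (indicator ?B y *
      ennreal (vnorm N (\<lambda>i. v i (x, t) - v i (y, t)) powr q)) \<partial>lborel)"
    proof (rule nn_integral_mono)
      fix y
      show "ennreal (vnorm N (\<lambda>i. v i (x, t) - v i (y, t)) powr q * \<eta> y) \<le>
        ennreal H * (indicator ?B y * ennreal (vnorm N (\<lambda>i. v i (x, t) - v i (y, t)) powr q))"
      proof (cases "y \<in> ?B")
        case True
        thus ?thesis
          using \<eta>(2,3)[of y] H0
          by (auto simp: ennreal_mult[symmetric] mult.commute intro!: ennreal_leI mult_right_mono)
      next
        case False
        hence "\<eta> y = 0" using r0 by (intro \<eta>(4)) (auto simp: dist_norm norm_minus_commute)
        thus ?thesis by simp
      qed
    qed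
    also have "\<dots> = ennreal H * (\<integral>\<^sup>+y. indicator ?B y *
      ennreal (vnorm N (\<lambda>i. v i (x, t) - v i (y, t)) powr q) \<partial>lborel)"
    proof (rule nn_integral_cmult)
      note [measurable] = Wym[of t x, unfolded W_def]
      show "(\<lambda>y. indicator ?B y * ennreal (vnorm N (\<lambda>i. v i (x, t) - v i (y, t)) powr q)) \<in> borel_measurable lborel"
        by measurable
    qed
    finally show ?thesis by (simp add: V_def)
  qed
  have Wm: "(\<lambda>(t, x, y). W t x y) \<in> borel_measurable borel"
  proof -
    have "(\<lambda>p. vnorm N (\<lambda>i. v i (fst (snd p), fst p) - v i (snd (snd p), fst p))) \<in>
      borel_measurable (borel :: (real \<times> 'a \<times> 'a) measure)"
    proof (rule vnorm_measurable)
      fix i assume "i < N"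
      note [measurable] = vm[OF this]
      show "(\<lambda>p::real \<times> 'a \<times> 'a. v i (fst (snd p), fst p) - v i (snd (snd p), fst p)) \<in> borel_measurable borel"
        by measurable
    qed
    note [measurable] = this
    show ?thesis unfolding W_def split_beta' by measurable
  qed
  have Wm2: "(\<lambda>p. indicator I (fst p) * (indicator ?B (fst (snd p)) * indicator ?B (snd (snd p)) *
      W (fst p) (fst (snd p)) (snd (snd p)))) \<in> borel_measurable borel"
  proof -
    note [measurable] = Wm[unfolded split_beta']
    show ?thesis by measurable
  qed
  define P where "P = ennreal ((2 * \<rho>) powr q * 2 ^ DIM('a)) * emeasure lborel (ball x0 \<rho>) *
       (\<integral>\<^sup>+w. ennreal (vnorm N (\<lambda>i. D i w) powr q) \<partial>lborel)"
  have VP: "(\<integral>\<^sup>+z. indicator Q' z * V z \<partial>lborel) \<le> ennreal H * P"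
  proof -
    have [measurable]: "Q' \<in> sets borel"
      unfolding Q'_eq I_def by (intro borel_open open_Times open_ball open_greaterThanLessThan)
    have "(\<integral>\<^sup>+z. indicator Q' z * V z \<partial>lborel) = (\<integral>\<^sup>+t. (\<integral>\<^sup>+x. indicator Q' (x, t) * V (x, t) \<partial>lborel) \<partial>lborel)"
      by (rule nn_integral_lborel_pair) measurable
    also have "\<dots> \<le> (\<integral>\<^sup>+t. (\<integral>\<^sup>+x. (\<integral>\<^sup>+y. ennreal H * (indicator I t * (indicator ?B x * indicator ?B y * W t x y)) \<partial>lborel) \<partial>lborel) \<partial>lborel)"
    proof (intro nn_integral_mono)
      fix t x
      have m: "(\<lambda>y. indicator ?B y * W t x y) \<in> borel_measurable lborel"
      proof -
        note [measurable] = Wym[of t x]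
        show ?thesis by measurable
      qed
      show "indicator Q' (x, t) * V (x, t) \<le>
        (\<integral>\<^sup>+y. ennreal H * (indicator I t * (indicator ?B x * indicator ?B y * W t x y)) \<partial>lborel)"
      proof (cases "(x, t) \<in> Q'")
        case True
        hence "(\<lambda>y. ennreal H * (indicator I t * (indicator ?B x * indicator ?B y * W t x y))) =
           (\<lambda>y. ennreal H * (indicator ?B y * W t x y))"
          by (simp add: Q'_eq)
        hence "(\<integral>\<^sup>+y. ennreal H * (indicator I t * (indicator ?B x * indicator ?B y * W t x y)) \<partial>lborel) =
          ennreal H * (\<integral>\<^sup>+y. indicator ?B y * W t x y \<partial>lborel)"
          using m by (simp add: nn_integral_cmult)
        thus ?thesis using True Vle[of x t] by (simp add: W_def)
      qed simp
    qed
    also have "\<dots> = (\<integral>\<^sup>+p. ennreal H * (indicator I (fst p) * (indicator ?B (fst (snd p)) * indicator ?B (snd (snd p)) *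
      W (fst p) (fst (snd p)) (snd (snd p)))) \<partial>lborel)"
    proof -
      define F where "F p = indicator I (fst p) * (indicator ?B (fst (snd p)) * indicator ?B (snd (snd p)) *
        W (fst p) (fst (snd p)) (snd (snd p)))" for p
      have [measurable]: "F \<in> borel_measurable borel"
        using Wm2 unfolding F_def[abs_def] .
      have "(\<integral>\<^sup>+p. ennreal H * F p \<partial>lborel) = (\<integral>\<^sup>+t. (\<integral>\<^sup>+p. ennreal H * F (t, p) \<partial>lborel) \<partial>lborel)"
        by (rule nn_integral_lborel_pair) measurable
      also have "\<dots> = (\<integral>\<^sup>+t. (\<integral>\<^sup>+x. (\<integral>\<^sup>+y. ennreal H * F (t, x, y) \<partial>lborel) \<partial>lborel) \<partial>lborel)"
        by (intro nn_integral_cong nn_integral_lborel_pair) measurable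
      finally show ?thesis by (simp add: F_def)
    qed
    also have "\<dots> = ennreal H * (\<integral>\<^sup>+(t, x, y). indicator I t * (indicator ?B x * indicator ?B y * W t x y) \<partial>lborel)"
      using Wm2 by (simp add: nn_integral_cmult split_beta')
    also have "\<dots> \<le> ennreal H * (ennreal ((2 * r) powr q * 2 ^ DIM('a)) * emeasure lborel ?B *
       (\<integral>\<^sup>+w. ennreal (vnorm N (\<lambda>i. D i w) powr q) \<partial>lborel))"
      using space unfolding W_def by (rule mult_left_mono) simp
    also have "\<dots> \<le> ennreal H * P"
    proof -
      have "ennreal ((2 * r) powr q * 2 ^ DIM('a)) \<le> ennreal ((2 * \<rho>) powr q * 2 ^ DIM('a))"
        using r0 q by (intro ennreal_leI mult_right_mono powr_mono2) auto
      moreover have "emeasure lborel ?B \<le> emeasure lborel (ball x0 \<rho>)"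
        using r0 by (intro emeasure_mono subset_ball) auto
      ultimately show ?thesis
        unfolding P_def by (intro mult_left_mono mult_right_mono mult_mono) simp_all
    qed
    finally show ?thesis .
  qed

  have Q'U: "Q' \<subseteq> U" and [measurable]: "Q' \<in> sets borel"
    using \<epsilon> by (auto simp: Q' U intro!: borel_open open_Times)
  have eQ': "emeasure lborel Q' \<le> emeasure lborel U"
    by (rule emeasure_mono[OF Q'U]) (simp add: U borel_open open_Times)
  let ?T = "\<lambda>z z'. ennreal (3 powr q) * (indicator Q' z * V z * indicator Q' z' +
      indicator Q' z * indicator Q' z' * ennreal (M powr q) + indicator Q' z * (indicator Q' z' * V z'))"
  have "t0 \<in> I" using \<epsilon>(3) by (simp add: I_def)
  hence M0: "0 \<le> M" using order_trans[OF vnorm_nonneg mean[of t0 t0]] by simp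
  (* Pass from z to z' through the weighted means at the two times. *)
  have pt: "indicator Q' z * indicator Q' z' * ennreal (vnorm N (\<lambda>i. v i z - v i z') powr q) \<le> ?T z z'" for z z'
  proof (cases "z \<in> Q' \<and> z' \<in> Q'")
    case True
    hence tt: "snd z \<in> I" "snd z' \<in> I" by (auto simp: Q'_eq)
    let ?a = "vnorm N (\<lambda>i. v i z - m i (snd z))" and ?b = "vnorm N (\<lambda>i. v i z' - m i (snd z'))"
    have "vnorm N (\<lambda>i. v i z - v i z') \<le> ?a + vnorm N (\<lambda>i. m i (snd z) - v i z')"
      by (rule vnorm_triangle_diff)
    also have "vnorm N (\<lambda>i. m i (snd z) - v i z') \<le> vnorm N (\<lambda>i. m i (snd z) - m i (snd z')) + vnorm N (\<lambda>i. m i (snd z') - v i z')"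
      by (rule vnorm_triangle_diff)
    also have "vnorm N (\<lambda>i. m i (snd z') - v i z') = ?b" by (rule vnorm_minus_commute)
    also have "vnorm N (\<lambda>i. m i (snd z) - m i (snd z')) \<le> M" by (rule mean[OF tt])
    finally have "vnorm N (\<lambda>i. v i z - v i z') powr q \<le> (?a + M + ?b) powr q"
      using q by (intro powr_mono2) auto
    also have "\<dots> \<le> 3 powr q * (?a powr q + M powr q + ?b powr q)"
      using q M0 by (intro powr_add3_le) auto
    finally have "ennreal (vnorm N (\<lambda>i. v i z - v i z') powr q) \<le> ennreal (3 powr q * (?a powr q + M powr q + ?b powr q))"
      by (rule ennreal_leI)
    also have "\<dots> = ennreal (3 powr q) * (V z + ennreal (M powr q) + V z')"
      by (simp add: V_def ennreal_mult)
    finally show ?thesis using True by simp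
  qed auto
  have "(\<integral>\<^sup>+z. (\<integral>\<^sup>+z'. indicator Q' z * indicator Q' z' * ennreal (vnorm N (\<lambda>i. v i z - v i z') powr q) \<partial>lborel) \<partial>lborel) \<le>
    (\<integral>\<^sup>+z. (\<integral>\<^sup>+z'. ?T z z' \<partial>lborel) \<partial>lborel)"
    by (intro nn_integral_mono pt)
  also have "\<dots> = (\<integral>\<^sup>+z. ennreal (3 powr q) * (indicator Q' z * V z * emeasure lborel Q' +
      indicator Q' z * (emeasure lborel Q' * ennreal (M powr q)) + indicator Q' z * (\<integral>\<^sup>+z'. indicator Q' z' * V z' \<partial>lborel)) \<partial>lborel)"
    by (intro nn_integral_cong) (simp add: nn_integral_cmult nn_integral_add nn_integral_multc mult.assoc)
  also have "\<dots> = ennreal (3 powr q) * ((\<integral>\<^sup>+z. indicator Q' z * V z \<partial>lborel) * emeasure lborel Q' +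
      emeasure lborel Q' * (emeasure lborel Q' * ennreal (M powr q)) +
      emeasure lborel Q' * (\<integral>\<^sup>+z'. indicator Q' z' * V z' \<partial>lborel))"
    by (simp add: nn_integral_cmult nn_integral_add nn_integral_multc)
  also have "\<dots> \<le> ennreal (3 powr q) * ((ennreal H * P) * emeasure lborel U +
      emeasure lborel U * (emeasure lborel U * ennreal (M powr q)) +
      emeasure lborel U * (ennreal H * P))"
    by (intro mult_left_mono add_mono mult_mono VP eQ') auto
  also have "\<dots> = ennreal (3 powr q) * emeasure lborel U * (2 * (ennreal H * P) + emeasure lborel U * ennreal (M powr q))"
    by (simp add: distrib_left mult_2 mult_ac add_ac)
  also have "2 * (ennreal H * P) = ennreal (2 * H * (2 * \<rho>) powr q * 2 ^ DIM('a)) * emeasure lborel (ball x0 \<rho>) *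
         (\<integral>\<^sup>+w. ennreal (vnorm N (\<lambda>i. D i w) powr q) \<partial>lborel)"
    using H0 by (simp add: P_def ennreal_mult mult_ac)
  finally show ?thesis by (simp add: M_def H_def H'_def)
qed

lemma common_translation_radius:
  fixes u :: "nat \<Rightarrow> 'a::euclidean_space \<Rightarrow> real"
  assumes u: "\<And>i. i < N \<Longrightarrow> integrable lborel (u i)" and e: "0 < e"
  shows "\<exists>d>0. \<forall>i<N. \<forall>h. norm h < d \<longrightarrow> (\<integral>\<^sup>+z. ennreal \<bar>u i (z - h) - u i z\<bar> \<partial>lborel) \<le> ennreal e"
  using u
proof (induction N)
  case 0
  show ?case by (intro exI[of _ 1]) auto
next
  case (Suc N)
  then obtain d where d: "d > 0" "\<forall>i<N. \<forall>h. norm h < d \<longrightarrow> (\<integral>\<^sup>+z. ennreal \<bar>u i (z - h) - u i z\<bar> \<partial>lborel) \<le> ennreal e"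
    by (meson less_Suc_eq)
  obtain d' where d': "d' > 0" "\<forall>h. norm h < d' \<longrightarrow> (\<integral>\<^sup>+z. ennreal \<bar>u N (z - h) - u N z\<bar> \<partial>lborel) \<le> ennreal e"
    using L1_translation_continuous[OF Suc.prems[of N]] e by blast
  show ?case
    using d d' by (intro exI[of _ "min d d'"]) (auto simp: less_Suc_eq)
qed

lemma tendsto_vnorm:
  fixes f :: "'c \<Rightarrow> nat \<Rightarrow> real"
  assumes "\<And>i. i < N \<Longrightarrow> ((\<lambda>x. f x i) \<longlongrightarrow> l i) F"
  shows "((\<lambda>x. vnorm N (f x)) \<longlongrightarrow> vnorm N l) F"
  unfolding vnorm_def L2_set_def
  by (intro tendsto_real_sqrt tendsto_sum tendsto_power tendsto_norm assms) auto

text \<open>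
  Choose \<open>\<epsilon>\<close> for each \<open>j\<close> so small that the mollification is
  within \<open>1/(j+1)\<close> of \<open>u\<close> in \<open>L\<^sup>1\<close>, pass to a
  subsequence converging almost everywhere, and apply Fatou's lemma in each of the two variables.
  The indicators of the shrunk cylinders converge to that of \<open>U\<close> because
  \<open>U\<close> is open, so the exhaustion of \<open>U\<close> takes place in the same limit.
\<close>

lemma oscillation_bound:
  fixes u :: "nat \<Rightarrow> 'a::euclidean_space \<times> real \<Rightarrow> real" and D G :: "nat \<Rightarrow> 'a \<times> real \<Rightarrow> 'a"
    and \<eta> :: "'a \<Rightarrow> real"
  assumes U: "U = ball x0 \<rho> \<times> {t0 - s<..<t0 + s}" and pos: "0 < \<rho>" "0 < s"
    and u: "\<And>i. i < N \<Longrightarrow> integrable lborel (u i)" and D: "\<And>i. i < N \<Longrightarrow> integrable lborel (D i)"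
    and G: "\<And>i. i < N \<Longrightarrow> integrable lborel (G i)"
    and space_weak: "\<And>i. i < N \<Longrightarrow> distributional_space_gradient U (u i) (D i)"
    and time_weak: "\<And>i. i < N \<Longrightarrow> distributional_time_divergence U (u i) (G i)"
    and q: "1 \<le> q"
    and \<eta>: "smooth_bump x0 (\<rho> / 2) C \<eta>"
  shows "(\<integral>\<^sup>+z. (\<integral>\<^sup>+z'. indicator U z * indicator U z' *
      ennreal (vnorm N (\<lambda>i. u i z - u i z') powr q) \<partial>lborel) \<partial>lborel) \<le>
    ennreal (3 powr q) * emeasure lborel U *
      (ennreal (2 * (C / (\<rho> / 2) ^ DIM('a)) * (2 * \<rho>) powr q * 2 ^ DIM('a)) * emeasure lborel (ball x0 \<rho>) *
         (\<integral>\<^sup>+w. ennreal (vnorm N (\<lambda>i. D i w) powr q) \<partial>lborel) +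
       emeasure lborel U * ennreal ((C / (\<rho> / 2) ^ Suc DIM('a) * (\<integral>w. vnorm N (\<lambda>i. G i w) \<partial>lborel)) powr q))" (is "_ \<le> ?R")
proof -
  have um: "i < N \<Longrightarrow> u i \<in> borel_measurable borel" for i
    using borel_measurable_integrable[OF u] by simp
  obtain Ca where Ca: "\<And>R. 0 < R \<Longrightarrow> \<exists>a. smooth_bump (0::'a) R Ca a"
    using exists_smooth_bump[where ?'a='a] by blast
  obtain Cb where Cb: "\<And>R. 0 < R \<Longrightarrow> \<exists>b. smooth_bump (0::real) R Cb b"
    using exists_smooth_bump[where ?'a=real] by blast
  have "\<exists>\<epsilon>>0. \<epsilon> \<le> 1 / real (Suc j) \<and> 8 * \<epsilon> \<le> \<rho> \<and> 2 * \<epsilon> < s \<and> (\<forall>i<N. \<forall>h. norm h < 2 * \<epsilon> \<longrightarrow>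
      (\<integral>\<^sup>+z. ennreal \<bar>u i (z - h) - u i z\<bar> \<partial>lborel) \<le> ennreal (1 / real (Suc j)))" for j :: nat
  proof -
    obtain d where d: "d > 0" "\<forall>i<N. \<forall>h. norm h < d \<longrightarrow> (\<integral>\<^sup>+z. ennreal \<bar>u i (z - h) - u i z\<bar> \<partial>lborel) \<le> ennreal (1 / real (Suc j))"
      using common_translation_radius[where u=u and N=N and e="1 / real (Suc j)", OF u] by auto
    (* The product kernel vanishes off the ball of radius 2 \<epsilon>, hence d / 2. *)
    define \<epsilon> where "\<epsilon> = min (min (1 / real (Suc j)) (\<rho> / 8)) (min (s / 3) (d / 2))"
    have "0 < \<epsilon>" "\<epsilon> \<le> 1 / real (Suc j)" "8 * \<epsilon> \<le> \<rho>" "2 * \<epsilon> < s" and "2 * \<epsilon> \<le> d"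
      using pos d(1) by (auto simp: \<epsilon>_def)
    thus ?thesis using d(2) by (meson order_less_le_trans)
  qed
  hence "\<forall>j. \<exists>\<epsilon>. 0 < \<epsilon> \<and> \<epsilon> \<le> 1 / real (Suc j) \<and> 8 * \<epsilon> \<le> \<rho> \<and> 2 * \<epsilon> < s \<and> (\<forall>i<N. \<forall>h. norm h < 2 * \<epsilon> \<longrightarrow>
      (\<integral>\<^sup>+z. ennreal \<bar>u i (z - h) - u i z\<bar> \<partial>lborel) \<le> ennreal (1 / real (Suc j)))"
    by blast
  from choice[OF this] obtain \<epsilon> where
    \<epsilon>: "\<And>j. 0 < \<epsilon> j" "\<And>j. \<epsilon> j \<le> 1 / real (Suc j)" "\<And>j. 8 * \<epsilon> j \<le> \<rho>" "\<And>j. 2 * \<epsilon> j < s"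
    and tr: "\<And>j i h. i < N \<Longrightarrow> norm h < 2 * \<epsilon> j \<Longrightarrow>
      (\<integral>\<^sup>+z. ennreal \<bar>u i (z - h) - u i z\<bar> \<partial>lborel) \<le> ennreal (1 / real (Suc j))"
    by blast
  have "\<forall>j. \<exists>f. smooth_bump (0::'a) (\<epsilon> j) Ca f" using Ca[OF \<epsilon>(1)] by blast
  from choice[OF this] obtain a where abump: "\<And>j. smooth_bump (0::'a) (\<epsilon> j) Ca (a j)" by blast
  have "\<forall>j. \<exists>f. smooth_bump (0::real) (\<epsilon> j) Cb f" using Cb[OF \<epsilon>(1)] by blast
  from choice[OF this] obtain b where bbump: "\<And>j. smooth_bump (0::real) (\<epsilon> j) Cb (b j)" by blast
  note a = smooth_bumpD[OF abump, simplified] and b = smooth_bumpD[OF bbump, simplified]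
  define v where "v j i z = (\<integral>w. u i w * (a j (fst z - fst w) * b j (snd z - snd w)) \<partial>lborel)" for j i z
  define Q where "Q j = ball x0 (\<rho> - 2 * \<epsilon> j) \<times> {t0 - (s - 2 * \<epsilon> j)<..<t0 + (s - 2 * \<epsilon> j)}" for j
  define F where "F j z z' = indicator (Q j) z * indicator (Q j) z' *
      ennreal (vnorm N (\<lambda>i. v j i z - v j i z') powr q)" for j z z'
  have bound: "(\<integral>\<^sup>+z. (\<integral>\<^sup>+z'. F j z z' \<partial>lborel) \<partial>lborel) \<le> ?R" for j
    unfolding F_def
    by (rule mollified_oscillation_bound[OF U u D G space_weak time_weak q \<epsilon>(1)[of j] \<epsilon>(3) \<epsilon>(4)
          abump bbump \<eta> v_def Q_def])
  have abm: "a j \<in> borel_measurable borel" "b j \<in> borel_measurable borel" for j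
    using Ck_measurable[OF a(1)] Ck_measurable[OF b(1)] by blast+
  have vm: "v j i \<in> borel_measurable borel" if "i < N" for i j
  proof -
    note [measurable] = abm um[OF that]
    show ?thesis unfolding v_def[abs_def] by measurable
  qed
  have L1: "(\<integral>\<^sup>+z. ennreal \<bar>v j i z - u i z\<bar> \<partial>lborel) \<le> ennreal (1 / real (Suc j))" if i: "i < N" for i j
  proof -
    note [measurable] = abm
    let ?k = "\<lambda>z. a j (fst z) * b j (snd z)"
    have k: "(\<integral>\<^sup>+z. ?k z \<partial>lborel) = 1"
    proof -
      have "(\<integral>\<^sup>+z. ?k z \<partial>lborel) = (\<integral>\<^sup>+x. (\<integral>\<^sup>+t. ?k (x, t) \<partial>lborel) \<partial>lborel)"
        by (rule nn_integral_lborel_pair) measurable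
      also have "\<dots> = (\<integral>\<^sup>+x. a j x * (\<integral>\<^sup>+t. b j t \<partial>lborel) \<partial>lborel)"
        using a(2) b(2) by (subst nn_integral_cmult[symmetric]) (auto simp: ennreal_mult)
      finally show ?thesis using a(6) b(6) by simp
    qed
    have C0: "0 \<le> Ca / \<epsilon> j ^ DIM('a)" using a(2,3)[of j 0] by (rule order_trans)
    have "(\<integral>\<^sup>+z. ennreal \<bar>(\<integral>w. u i w * ?k (z - w) \<partial>lborel) - u i z\<bar> \<partial>lborel) \<le> ennreal (1 / real (Suc j))"
    proof (rule mollifier_L1_bound[OF u[OF i] _ _ k _ _ tr[OF i, of _ j]])
      show "?k z \<le> (Ca / \<epsilon> j ^ DIM('a)) * (Cb / \<epsilon> j)" for z
        using a(2,3) b(2,3) C0 by (intro mult_mono) auto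
      show "?k z = 0" if "2 * \<epsilon> j \<le> norm z" for z
      proof (rule ccontr)
        assume "?k z \<noteq> 0"
        hence "norm (fst z) < \<epsilon> j" "\<bar>snd z\<bar> < \<epsilon> j"
          using a(4)[of j "fst z"] b(4)[of j "snd z"] by (auto simp: not_le[symmetric])
        with norm_Pair_le[of "fst z" "snd z"] that show False by simp
      qed
    qed (use a(2) b(2) in auto)
    thus ?thesis by (simp add: v_def)
  qed
  define f where "f j z = (\<Sum>i<N. \<bar>v j i z - u i z\<bar>)" for j z
  have fi: "integrable lborel (f j)" "(\<integral>z. \<bar>f j z\<bar> \<partial>lborel) \<le> real N * (1 / real (Suc j))" for j
  proof -
    have i1: "integrable lborel (\<lambda>z. \<bar>v j i z - u i z\<bar>)" if "i < N" for i
      using L1[OF that, of j] vm[OF that, of j] um[OF that]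
      by (intro integrableI_nonneg) (auto intro: le_less_trans)
    have i2: "(\<integral>z. \<bar>v j i z - u i z\<bar> \<partial>lborel) \<le> 1 / real (Suc j)" if "i < N" for i
      using L1[OF that, of j] nn_integral_eq_integral[OF i1[OF that]] by simp
    show "integrable lborel (f j)" unfolding f_def[abs_def] using i1 by (intro Bochner_Integration.integrable_sum) auto
    have "(\<integral>z. \<bar>f j z\<bar> \<partial>lborel) = (\<integral>z. f j z \<partial>lborel)"
      by (simp add: f_def sum_nonneg)
    also have "\<dots> = (\<Sum>i<N. (\<integral>z. \<bar>v j i z - u i z\<bar> \<partial>lborel))"
      unfolding f_def by (rule Bochner_Integration.integral_sum) (use i1 in auto)
    also have "\<dots> \<le> (\<Sum>i<N. 1 / real (Suc j))" using i2 by (intro sum_mono) auto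
    finally show "(\<integral>z. \<bar>f j z\<bar> \<partial>lborel) \<le> real N * (1 / real (Suc j))" by simp
  qed
  have "(\<lambda>j. \<integral>z. norm (f j z) \<partial>lborel) \<longlonglongrightarrow> 0"
  proof (rule tendsto_sandwich[OF _ _ tendsto_const])
    show "eventually (\<lambda>j. (\<integral>z. norm (f j z) \<partial>lborel) \<le> real N * (1 / real (Suc j))) sequentially"
      using fi(2) by simp
    show "(\<lambda>j. real N * (1 / real (Suc j))) \<longlonglongrightarrow> 0"
      using tendsto_mult[OF tendsto_const[of "real N"] LIMSEQ_inverse_real_of_nat] by (simp add: inverse_eq_divide)
  qed auto
  from tendsto_L1_AE_subseq[OF fi(1) this]
  obtain r where r: "strict_mono r" "AE z in lborel. (\<lambda>j. f (r j) z) \<longlonglongrightarrow> 0" by blast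
  have conv: "(\<lambda>j. v (r j) i z) \<longlonglongrightarrow> u i z" if f0: "(\<lambda>j. f (r j) z) \<longlonglongrightarrow> 0" and i: "i < N" for i z
  proof -
    have "(\<lambda>j. v (r j) i z - u i z) \<longlonglongrightarrow> 0"
    proof (rule Lim_null_comparison[OF _ f0], rule always_eventually, rule allI)
      fix j
      show "norm (v (r j) i z - u i z) \<le> f (r j) z"
        unfolding f_def using i member_le_sum[of i "{..<N}" "\<lambda>i. \<bar>v (r j) i z - u i z\<bar>"] by simp
    qed
    thus ?thesis by (simp add: LIM_zero_cancel)
  qed
  have \<epsilon>0: "(\<lambda>j. \<epsilon> (r j)) \<longlonglongrightarrow> 0"
  proof -
    have "\<epsilon> \<longlonglongrightarrow> 0"
    proof (rule tendsto_sandwich[OF _ _ tendsto_const])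
      show "eventually (\<lambda>j. \<epsilon> j \<le> 1 / real (Suc j)) sequentially" using \<epsilon>(2) by simp
      show "(\<lambda>j. 1 / real (Suc j)) \<longlonglongrightarrow> 0" using LIMSEQ_inverse_real_of_nat by (simp add: inverse_eq_divide)
      show "eventually (\<lambda>j. 0 \<le> \<epsilon> j) sequentially" by (intro always_eventually allI less_imp_le \<epsilon>)
    qed
    from LIMSEQ_subseq_LIMSEQ[OF this r(1)] show ?thesis by (simp add: o_def)
  qed
  (* A point of the open set U lies in all sufficiently late shrunk cylinders. *)
  have inQ: "eventually (\<lambda>j. z \<in> Q (r j)) sequentially" if z: "z \<in> U" for z
  proof -
    define g where "g = min (\<rho> - dist x0 (fst z)) (min (snd z - (t0 - s)) (t0 + s - snd z))"
    have "0 < g / 2" using z by (auto simp: g_def U)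
    from order_tendstoD(2)[OF \<epsilon>0 this] show ?thesis
      by (rule eventually_mono) (use z in \<open>auto simp: g_def Q_def U mem_Times_iff\<close>)
  qed
  have pt: "indicator U z * indicator U z' * ennreal (vnorm N (\<lambda>i. u i z - u i z') powr q) \<le>
      liminf (\<lambda>j. F (r j) z z')"
    if z: "(\<lambda>j. f (r j) z) \<longlonglongrightarrow> 0" "(\<lambda>j. f (r j) z') \<longlonglongrightarrow> 0" for z z'
  proof (cases "z \<in> U \<and> z' \<in> U")
    case True
    have "(\<lambda>j. ennreal (vnorm N (\<lambda>i. v (r j) i z - v (r j) i z') powr q)) \<longlonglongrightarrow>
        ennreal (vnorm N (\<lambda>i. u i z - u i z') powr q)"
      by (intro tendsto_ennrealI tendsto_powr' tendsto_vnorm tendsto_diff conv z tendsto_const) (use q in auto)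
    moreover have "eventually (\<lambda>j. ennreal (vnorm N (\<lambda>i. v (r j) i z - v (r j) i z') powr q) = F (r j) z z') sequentially"
      using eventually_conj[OF inQ inQ, of z z'] True by (auto elim!: eventually_mono simp: F_def)
    ultimately have "(\<lambda>j. F (r j) z z') \<longlonglongrightarrow> ennreal (vnorm N (\<lambda>i. u i z - u i z') powr q)"
      by (rule Lim_transform_eventually)
    from lim_imp_Liminf[OF _ this] True show ?thesis by simp
  qed auto
  have Qm: "Q j \<in> sets borel" for j
    unfolding Q_def by (intro borel_open open_Times open_ball open_greaterThanLessThan)
  have Fm: "(\<lambda>p. F j (fst p) (snd p)) \<in> borel_measurable borel" for j
  proof -
    have "(\<lambda>p. vnorm N (\<lambda>i. v j i (fst p) - v j i (snd p))) \<in> borel_measurable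
       (borel :: (('a \<times> real) \<times> ('a \<times> real)) measure)"
    proof (rule vnorm_measurable)
      fix i assume "i < N"
      note [measurable] = vm[OF this]
      show "(\<lambda>p::(('a \<times> real) \<times> ('a \<times> real)). v j i (fst p) - v j i (snd p)) \<in> borel_measurable borel" by measurable
    qed
    note [measurable] = this Qm
    show ?thesis unfolding F_def[abs_def] by measurable
  qed
  have Fm1: "(\<lambda>z'. F j z z') \<in> borel_measurable borel" for j z
  proof -
    note [measurable] = Fm
    have "(\<lambda>z'. F j (fst (z, z')) (snd (z, z'))) \<in> borel_measurable borel"
      by (rule measurable_compose[OF _ Fm, of "\<lambda>z'. (z, z')"]) simp
    thus ?thesis by simp
  qed
  have Fm2: "(\<lambda>z. \<integral>\<^sup>+z'. F j z z' \<partial>lborel) \<in> borel_measurable borel" for j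
  proof -
    have "(\<lambda>p. F j (fst p) (snd p)) \<in> borel_measurable (borel \<Otimes>\<^sub>M lborel)"
      using Fm[of j] by (simp add: borel_prod[symmetric] cong: measurable_cong_sets)
    from lborel.borel_measurable_nn_integral_fst[OF this] show ?thesis by simp
  qed
  have "(\<integral>\<^sup>+z. (\<integral>\<^sup>+z'. indicator U z * indicator U z' *
      ennreal (vnorm N (\<lambda>i. u i z - u i z') powr q) \<partial>lborel) \<partial>lborel) \<le>
    (\<integral>\<^sup>+z. liminf (\<lambda>j. \<integral>\<^sup>+z'. F (r j) z z' \<partial>lborel) \<partial>lborel)"
  proof (rule nn_integral_mono_AE, use r(2) in eventually_elim)
    case (elim z)
    have "(\<integral>\<^sup>+z'. indicator U z * indicator U z' * ennreal (vnorm N (\<lambda>i. u i z - u i z') powr q) \<partial>lborel) \<le>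
      (\<integral>\<^sup>+z'. liminf (\<lambda>j. F (r j) z z') \<partial>lborel)"
      by (rule nn_integral_mono_AE, use r(2) in eventually_elim) (rule pt[OF elim])
    also have "\<dots> \<le> liminf (\<lambda>j. \<integral>\<^sup>+z'. F (r j) z z' \<partial>lborel)"
      by (rule nn_integral_liminf) (simp add: Fm1)
    finally show ?case .
  qed
  also have "\<dots> \<le> liminf (\<lambda>j. \<integral>\<^sup>+z. (\<integral>\<^sup>+z'. F (r j) z z' \<partial>lborel) \<partial>lborel)"
    by (rule nn_integral_liminf) (simp add: Fm2)
  also have "\<dots> \<le> liminf (\<lambda>j::nat. ?R)"
    by (intro Liminf_mono always_eventually allI bound)
  also have "\<dots> = ?R" by (simp add: Liminf_const)
  finally show ?thesis .
qed

text \<open>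
  The difference of \<open>u(z)\<close> and the mean is the average over \<open>z'\<close> of
  \<open>u(z) - u(z')\<close>; apply Jensen's inequality to it.
\<close>

lemma mean_oscillation_le:
  fixes u :: "nat \<Rightarrow> 'a::euclidean_space \<Rightarrow> real"
  assumes u: "\<And>i. i < N \<Longrightarrow> integrable lborel (u i)" and U[measurable]: "U \<in> sets borel"
    and m: "emeasure lborel U = ennreal m" "0 < m" and q: "1 \<le> q"
  shows "(\<integral>\<^sup>+z. indicator U z * ennreal (vnorm N (\<lambda>i. u i z - (\<integral>w. indicator U w * u i w \<partial>lborel) / m) powr q) \<partial>lborel) \<le>
    ennreal (1 / m) * (\<integral>\<^sup>+z. (\<integral>\<^sup>+z'. indicator U z * indicator U z' *
      ennreal (vnorm N (\<lambda>i. u i z - u i z') powr q) \<partial>lborel) \<partial>lborel)"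
proof -
  have um: "i < N \<Longrightarrow> u i \<in> borel_measurable borel" for i
    using borel_measurable_integrable[OF u] by simp
  define K where "K w = indicator U w / m" for w
  have [measurable]: "K \<in> borel_measurable borel" unfolding K_def[abs_def] by measurable
  have K0: "0 \<le> K w" for w using m by (simp add: K_def)
  have K1: "(\<integral>\<^sup>+w. K w \<partial>lborel) = 1"
  proof -
    have "(\<integral>\<^sup>+w. K w \<partial>lborel) = (\<integral>\<^sup>+w. ennreal (1 / m) * indicator U w \<partial>lborel)"
      using m(2) by (intro nn_integral_cong) (auto simp: K_def indicator_def)
    also have "\<dots> = ennreal (1 / m) * ennreal m"
      by (simp add: nn_integral_cmult m)
    also have "\<dots> = 1" using m(2) by (simp flip: ennreal_mult)
    finally show ?thesis .
  qed
  have iK: "integrable lborel K" using K0 K1 by (intro integrableI_nonneg) auto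
  have iK1: "(\<integral>w. K w \<partial>lborel) = 1" using K0 K1 by (subst integral_eq_nn_integral) auto
  have iuK: "integrable lborel (\<lambda>w. u i w * K w)" if "i < N" for i
    by (rule integrable_mult_kernel[OF u[OF that], where C="1 / m"])
      (use m(2) in \<open>auto simp: K_def indicator_def\<close>)
  have dm: "(\<lambda>w. vnorm N (\<lambda>i. u i z - u i w)) \<in> borel_measurable borel" for z
    by (rule vnorm_measurable) (use um in auto)
  have pt: "indicator U z * ennreal (vnorm N (\<lambda>i. u i z - (\<integral>w. indicator U w * u i w \<partial>lborel) / m) powr q) \<le>
    ennreal (1 / m) * (\<integral>\<^sup>+z'. indicator U z * indicator U z' * ennreal (vnorm N (\<lambda>i. u i z - u i z') powr q) \<partial>lborel)" for z
  proof (cases "z \<in> U")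
    case True
    let ?d = "vnorm N (\<lambda>i. u i z - (\<integral>w. indicator U w * u i w \<partial>lborel) / m)"
    have int: "integrable lborel (\<lambda>w. (u i z - u i w) * K w)" if "i < N" for i
      using iuK[OF that] iK by (simp add: left_diff_distrib)
    have "?d = vnorm N (\<lambda>i. \<integral>w. (u i z - u i w) * K w \<partial>lborel)"
    proof (rule vnorm_cong)
      fix i assume i: "i < N"
      have "(\<integral>w. (u i z - u i w) * K w \<partial>lborel) = u i z - (\<integral>w. u i w * K w \<partial>lborel)"
        using iuK[OF i] iK iK1 by (simp add: left_diff_distrib)
      also have "(\<integral>w. u i w * K w \<partial>lborel) = (\<integral>w. indicator U w * u i w / m \<partial>lborel)"
        by (simp add: K_def mult.commute)
      finally show "u i z - (\<integral>w. indicator U w * u i w \<partial>lborel) / m = (\<integral>w. (u i z - u i w) * K w \<partial>lborel)"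
        by simp
    qed
    also have "\<dots> \<le> (\<integral>w. vnorm N (\<lambda>i. (u i z - u i w) * K w) \<partial>lborel)"
      by (rule vnorm_integral_le) (rule int)
    finally have "ennreal ?d \<le> ennreal (\<integral>w. vnorm N (\<lambda>i. (u i z - u i w) * K w) \<partial>lborel)"
      by (rule ennreal_leI)
    also have "\<dots> = (\<integral>\<^sup>+w. vnorm N (\<lambda>i. (u i z - u i w) * K w) \<partial>lborel)"
      by (intro nn_integral_eq_integral[symmetric] integrable_vnorm int) auto
    also have "\<dots> = (\<integral>\<^sup>+w. vnorm N (\<lambda>i. u i z - u i w) * K w \<partial>lborel)"
    proof (rule nn_integral_cong)
      fix w
      show "ennreal (vnorm N (\<lambda>i. (u i z - u i w) * K w)) = ennreal (vnorm N (\<lambda>i. u i z - u i w) * K w)"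
        using vnorm_scaleR[of N "K w" "\<lambda>i. u i z - u i w"] K0[of w] by (simp add: mult.commute)
    qed
    finally have "ennreal (?d powr q) \<le> (\<integral>\<^sup>+w. vnorm N (\<lambda>i. u i z - u i w) powr q * K w \<partial>lborel)"
      using dm K0 K1 q by (intro weighted_powr_mean_le) auto
    also have "\<dots> = (\<integral>\<^sup>+w. ennreal (1 / m) * (indicator U z * indicator U w * ennreal (vnorm N (\<lambda>i. u i z - u i w) powr q)) \<partial>lborel)"
      using True m(2) by (intro nn_integral_cong)
        (auto simp: K_def indicator_def ennreal_mult[symmetric])
    also have "\<dots> = ennreal (1 / m) * (\<integral>\<^sup>+w. indicator U z * indicator U w * ennreal (vnorm N (\<lambda>i. u i z - u i w) powr q) \<partial>lborel)"
    proof (rule nn_integral_cmult)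
      have [measurable]: "(\<lambda>w. ennreal (vnorm N (\<lambda>i. u i z - u i w) powr q)) \<in> borel_measurable borel"
        using measurable_compose[OF dm[of z], of "\<lambda>r. ennreal (r powr q)" borel] by simp
      show "(\<lambda>w. indicator U z * indicator U w * ennreal (vnorm N (\<lambda>i. u i z - u i w) powr q)) \<in> borel_measurable lborel"
        by measurable
    qed
    finally show ?thesis using True by simp
  qed simp
  have Fm: "(\<lambda>p. indicator U (fst p) * indicator U (snd p) * ennreal (vnorm N (\<lambda>i. u i (fst p) - u i (snd p)) powr q))
     \<in> borel_measurable (lborel \<Otimes>\<^sub>M lborel)"
  proof -
    have "(\<lambda>p. vnorm N (\<lambda>i. u i (fst p) - u i (snd p))) \<in> borel_measurable (lborel \<Otimes>\<^sub>M lborel)"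
    proof (rule vnorm_measurable)
      fix i assume "i < N"
      note [measurable] = um[OF this]
      show "(\<lambda>p. u i (fst p) - u i (snd p)) \<in> borel_measurable (lborel \<Otimes>\<^sub>M lborel)" by measurable
    qed
    note [measurable] = this
    show ?thesis by measurable
  qed
  have "(\<lambda>z. \<integral>\<^sup>+z'. indicator U z * indicator U z' * ennreal (vnorm N (\<lambda>i. u i z - u i z') powr q) \<partial>lborel) \<in> borel_measurable lborel"
    using lborel.borel_measurable_nn_integral_fst[OF Fm] by simp
  from nn_integral_cmult[OF this, of "ennreal (1 / m)", symmetric] show ?thesis
    by (simp only:) (intro nn_integral_mono pt)
qed

section \<open>Caratheodory compositions and Borel representatives\<close>

lemma tendsto_function_coordinatewise:
  fixes f :: "'c \<Rightarrow> nat \<Rightarrow> 'b::topological_space"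
  assumes "\<And>i. ((\<lambda>x. f x i) \<longlongrightarrow> l i) F"
  shows "(f \<longlongrightarrow> l) F"
proof -
  have "limitin (product_topology (\<lambda>i. euclidean) UNIV) f l F"
    unfolding limitin_componentwise using assms by simp
  thus ?thesis by (simp add: euclidean_product_topology)
qed

text \<open>
  Approximate \<open>D\<close> pointwise by functions with finitely many values in
  \<^term>\<open>vecs N\<close>. For these the composition is a finite sum of measurable
  functions, and it converges almost everywhere by continuity of \<open>A z\<close>; completeness
  of Lebesgue measure takes care of the exceptional set.
\<close>

lemma caratheodory_composition_measurable:
  fixes A :: "'a::euclidean_space \<Rightarrow> (nat \<Rightarrow> 'b::euclidean_space) \<Rightarrow> nat \<Rightarrow> 'b"
  assumes S: "S \<in> sets lebesgue" and A: "caratheodory S N A"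
    and D: "D \<in> S \<rightarrow> vecs N" "vmeasurable S N D" and i: "i < N"
  shows "(\<lambda>z. A z (D z) i) \<in> borel_measurable (lebesgue_on S)"
proof -
  let ?M = "lebesgue_on S"
  have sp: "space ?M = S" by simp
  have "\<exists>F. (\<forall>k. simple_function ?M (F k)) \<and> (\<forall>z\<in>S. (\<lambda>k. F k z) \<longlonglongrightarrow> D z j)" if "j < N" for j
  proof -
    have "(\<lambda>z. D z j) \<in> borel_measurable ?M"
      using D(2) that by (simp add: vmeasurable_def)
    from borel_measurable_implies_sequence_metric[OF this, of 0] show ?thesis
      unfolding sp by blast
  qed
  hence "\<forall>j. \<exists>F. j < N \<longrightarrow> (\<forall>k. simple_function ?M (F k)) \<and> (\<forall>z\<in>S. (\<lambda>k. F k z) \<longlonglongrightarrow> D z j)"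
    by blast
  from choice[OF this] obtain F where F0: "\<forall>j. j < N \<longrightarrow> (\<forall>k. simple_function ?M (F j k)) \<and> (\<forall>z\<in>S. (\<lambda>k. F j k z) \<longlonglongrightarrow> D z j)"
    by blast
  have F: "\<And>j k. j < N \<Longrightarrow> simple_function ?M (F j k)"
    "\<And>j z. j < N \<Longrightarrow> z \<in> S \<Longrightarrow> (\<lambda>k. F j k z) \<longlonglongrightarrow> D z j"
    using F0 by blast+
  define s where "s k z = (\<lambda>j. if j < N then F j k z else 0)" for k z
  have s_vecs: "s k z \<in> vecs N" for k z by (simp add: s_def vecs_def)
  have fin: "finite (s k ` S)" for k
  proof (rule finite_subset)
    show "finite {g. \<forall>j. (j \<in> {..<N} \<longrightarrow> g j \<in> (\<Union>j<N. F j k ` S)) \<and> (j \<notin> {..<N} \<longrightarrow> g j = 0)}"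
      using F(1) sp by (intro finite_set_of_finite_funs finite_UN_I) (auto simp: simple_function_def)
    have "F j k z \<in> (\<Union>j<N. F j k ` S)" if "j < N" "z \<in> S" for j z
      using that by blast
    thus "s k ` S \<subseteq> {g. \<forall>j. (j \<in> {..<N} \<longrightarrow> g j \<in> (\<Union>j<N. F j k ` S)) \<and> (j \<notin> {..<N} \<longrightarrow> g j = 0)}"
      unfolding s_def by auto
  qed
  have pre: "{z \<in> S. s k z = g} \<in> sets ?M" if "g \<in> vecs N" for k g
  proof -
    have "{z \<in> S. s k z = g} = {z \<in> space ?M. \<forall>j\<in>{..<N}. F j k z = g j}"
      using that by (auto simp: s_def vecs_def fun_eq_iff not_less)
    also have "\<dots> \<in> sets ?M"
    proof (rule sets.sets_Collect_finite_All')
      fix j assume "j \<in> {..<N}"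
      hence "F j k -` {g j} \<inter> space ?M \<in> sets ?M"
        using F(1) by (intro simple_functionD) auto
      thus "{z \<in> space ?M. F j k z = g j} \<in> sets ?M"
        by (simp add: vimage_def Int_def conj_commute)
    qed (use i in auto)
    finally show ?thesis .
  qed
  have meas: "(\<lambda>z. A z (s k z) i) \<in> borel_measurable ?M" for k
  proof -
    have "(\<lambda>z. \<Sum>g\<in>s k ` S. indicator {z \<in> S. s k z = g} z *\<^sub>R A z g i) \<in> borel_measurable ?M"
    proof (intro borel_measurable_sum borel_measurable_scaleR borel_measurable_indicator)
      fix g assume "g \<in> s k ` S"
      hence g: "g \<in> vecs N" using s_vecs by auto
      show "{z \<in> S. s k z = g} \<in> sets ?M" by (rule pre[OF g])
      show "(\<lambda>z. A z g i) \<in> borel_measurable ?M"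
        using A g i by (auto simp: caratheodory_def vmeasurable_def)
    qed
    moreover have "(\<Sum>g\<in>s k ` S. indicator {z \<in> S. s k z = g} z *\<^sub>R A z g i) = A z (s k z) i" if "z \<in> S" for z
    proof -
      have "(\<Sum>g\<in>s k ` S. indicator {z \<in> S. s k z = g} z *\<^sub>R A z g i) =
          (\<Sum>g\<in>s k ` S. if g = s k z then A z g i else 0)"
        using that by (intro sum.cong) (auto simp: indicator_def)
      also have "\<dots> = A z (s k z) i" using fin that by (subst sum.delta) auto
      finally show ?thesis .
    qed
    ultimately show ?thesis by (subst (asm) measurable_cong) auto
  qed
  have "AE z in ?M. (\<lambda>k. A z (s k z) i) \<longlonglongrightarrow> A z (D z) i"
  proof -
    have "AE z in ?M. continuous_on (vecs N) (A z)" using A by (simp add: caratheodory_def)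
    moreover have "AE z in ?M. z \<in> S" by (rule AE_I2) simp
    ultimately show ?thesis
    proof eventually_elim
      case (elim z)
      have Dv: "D z \<in> vecs N" using D(1) elim(2) by auto
      have "(\<lambda>k. s k z) \<longlonglongrightarrow> D z"
      proof (rule tendsto_function_coordinatewise)
        fix j
        show "(\<lambda>k. s k z j) \<longlonglongrightarrow> D z j"
          using F(2)[OF _ elim(2)] Dv by (cases "j < N") (auto simp: s_def vecs_def)
      qed
      from continuous_on_tendsto_compose[OF elim(1) this Dv] s_vecs
      have conv: "(\<lambda>k. A z (s k z)) \<longlonglongrightarrow> A z (D z)" by simp
      have "continuous_on UNIV (\<lambda>x::nat \<Rightarrow> 'b. x i)"
        by (rule continuous_on_product_then_coordinatewise[OF continuous_on_id])
      from continuous_on_tendsto_compose[OF this conv UNIV_I] show ?case by simp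
    qed
  qed
  hence ae: "AE z in lebesgue. z \<in> S \<longrightarrow> (\<lambda>k. A z (s k z) i) \<longlonglongrightarrow> A z (D z) i"
    using S by (subst (asm) AE_restrict_space_iff) auto
  define f where "f k z = indicator S z *\<^sub>R A z (s k z) i" for k z
  define f0 where "f0 z = indicator S z *\<^sub>R A z (D z) i" for z
  have fm: "f k \<in> borel_measurable lebesgue" for k
    using meas[of k] borel_measurable_restrict_space_iff[of S lebesgue "\<lambda>z. A z (s k z) i"] S
    unfolding f_def[abs_def] by simp
  have "AE z in lebesgue. (\<lambda>k. f k z) \<longlonglongrightarrow> f0 z"
    using ae by eventually_elim (auto simp: f_def f0_def indicator_def)
  then obtain Z where Z0: "{z \<in> space lebesgue. \<not> (\<lambda>k. f k z) \<longlonglongrightarrow> f0 z} \<subseteq> Z" "Z \<in> null_sets lebesgue"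
    unfolding eventually_ae_filter by blast
  hence Z: "\<forall>z\<in>- Z. (\<lambda>k. f k z) \<longlonglongrightarrow> f0 z" "Z \<in> null_sets lebesgue"
    by auto
  have [measurable]: "Z \<in> sets lebesgue" using Z by auto
  have "(\<lambda>z. indicator (- Z) z *\<^sub>R f0 z) \<in> borel_measurable lebesgue"
  proof (rule borel_measurable_LIMSEQ_metric)
    show "(\<lambda>z. indicator (- Z) z *\<^sub>R f k z) \<in> borel_measurable lebesgue" for k
      using fm[of k] by (intro borel_measurable_scaleR borel_measurable_indicator) (auto simp: Compl_in_sets_lebesgue)
    show "(\<lambda>k. indicator (- Z) z *\<^sub>R f k z) \<longlonglongrightarrow> indicator (- Z) z *\<^sub>R f0 z" for z
      using Z(1) by (cases "z \<in> Z") auto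
  qed
  moreover have "AE z in lebesgue. indicator (- Z) z *\<^sub>R f0 z = f0 z"
    using AE_not_in[OF Z(2)] by eventually_elim auto
  ultimately have "f0 \<in> borel_measurable lebesgue" by (rule borel_measurable_AE)
  thus ?thesis
    using borel_measurable_restrict_space_iff[of S lebesgue "\<lambda>z. A z (D z) i"] S
    unfolding f0_def[abs_def] by simp
qed

text \<open>
  Fubini's theorem concerns product measures, and Lebesgue measure on a product is only the
  completion of one. Slicing therefore needs Borel functions in place of the given Lebesgue
  measurable ones.
\<close>

lemma borel_representative:
  fixes f :: "'a::euclidean_space \<Rightarrow> 'b::euclidean_space"
  assumes "f \<in> borel_measurable lebesgue"
  obtains g where "g \<in> borel_measurable borel" "AE z in lborel. g z = f z"
proof -
  have "\<exists>g\<in>borel_measurable lborel. AE z in lborel. f z \<bullet> b = g z" for b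
  proof -
    have "(\<lambda>z. f z \<bullet> b) \<in> borel_measurable lebesgue" using assms by simp
    from completion_ex_borel_measurable_real[OF this] show ?thesis by blast
  qed
  hence "\<forall>b. \<exists>g. g \<in> borel_measurable lborel \<and> (AE z in lborel. f z \<bullet> b = g z)"
    by blast
  from choice[OF this] obtain g where g: "\<And>b. g b \<in> borel_measurable lborel" "\<And>b. AE z in lborel. f z \<bullet> b = g b z"
    by blast
  show ?thesis
  proof
    show "(\<lambda>z. \<Sum>b\<in>Basis. g b z *\<^sub>R b) \<in> borel_measurable borel"
      by (intro borel_measurable_sum borel_measurable_scaleR borel_measurable_const)
        (use g(1) in simp)
    have "AE z in lborel. \<forall>b\<in>Basis. f z \<bullet> b = g b z"
      by (rule AE_finite_allI) (simp_all add: g(2))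
    thus "AE z in lborel. (\<Sum>b\<in>Basis. g b z *\<^sub>R b) = f z"
    proof eventually_elim
      case (elim z)
      have "(\<Sum>b\<in>Basis. g b z *\<^sub>R b) = (\<Sum>b\<in>Basis. (f z \<bullet> b) *\<^sub>R b)"
        using elim by (intro sum.cong) auto
      thus ?case by (simp add: euclidean_representation)
    qed
  qed
qed

lemma integral_lebesgue_on_borel_representative:
  fixes f g :: "'a::euclidean_space \<Rightarrow> 'b::euclidean_space"
  assumes S: "S \<in> sets lebesgue" and f: "f \<in> borel_measurable (lebesgue_on S)"
    and g: "g \<in> borel_measurable borel" and ae: "AE z in lborel. g z = indicator S z *\<^sub>R f z"
  shows "integral\<^sup>L (lebesgue_on S) f = integral\<^sup>L lborel g"
    and "integrable (lebesgue_on S) f \<longleftrightarrow> integrable lborel g"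
proof -
  have gm: "g \<in> borel_measurable lebesgue" "g \<in> borel_measurable lborel"
  proof -
    show "g \<in> borel_measurable lborel" using g by simp
    thus "g \<in> borel_measurable lebesgue" by (rule measurable_completion)
  qed
  have fm: "(\<lambda>z. indicator S z *\<^sub>R f z) \<in> borel_measurable lebesgue"
    using f borel_measurable_restrict_space_iff[of S lebesgue f] S by simp
  have ae': "AE z in lebesgue. indicator S z *\<^sub>R f z = g z"
    using ae unfolding AE_completion_iff by eventually_elim simp
  have "integral\<^sup>L (lebesgue_on S) f = (\<integral>z. indicator S z *\<^sub>R f z \<partial>lebesgue)"
    by (rule integral_restrict_space) (use S in simp)
  also have "\<dots> = integral\<^sup>L lebesgue g"
    by (rule integral_cong_AE[OF fm gm(1) ae'])
  also have "\<dots> = integral\<^sup>L lborel g"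
    by (rule integral_completion[OF gm(2)])
  finally show "integral\<^sup>L (lebesgue_on S) f = integral\<^sup>L lborel g" .
  have "integrable (lebesgue_on S) f \<longleftrightarrow> integrable lebesgue (\<lambda>z. indicator S z *\<^sub>R f z)"
    by (rule integrable_restrict_space) (use S in simp)
  also have "\<dots> \<longleftrightarrow> integrable lebesgue g"
    by (rule integrable_cong_AE[OF fm gm(1) ae'])
  also have "\<dots> \<longleftrightarrow> integrable lborel g"
    by (rule integrable_completion[OF gm(2)])
  finally show "integrable (lebesgue_on S) f \<longleftrightarrow> integrable lborel g" .
qed

section \<open>The weak formulations tested in space-time\<close>

lemma test_function_derivative_zero_off_support:
  fixes \<phi> :: "'a::euclidean_space \<Rightarrow> real"
  assumes \<phi>: "\<phi> \<in> test_functions S" and z: "z \<notin> S"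
  shows "frechet_derivative \<phi> (at z) h = 0" "\<phi> z = 0"
proof -
  have c: "closure {x. \<phi> x \<noteq> 0} \<subseteq> S"
    using \<phi> by (simp add: test_functions_def compactly_inside_def)
  show "\<phi> z = 0"
    using c z closure_subset[of "{x. \<phi> x \<noteq> 0}"] by auto
  have "(\<phi> has_derivative (\<lambda>h. 0)) (at z)"
  proof (rule has_derivative_transform_within_open[OF has_derivative_const[of 0]])
    show "open (- closure {x. \<phi> x \<noteq> 0})" by (intro open_Compl closed_closure)
    show "z \<in> - closure {x. \<phi> x \<noteq> 0}" using c z by auto
    show "0 = \<phi> x" if "x \<in> - closure {x. \<phi> x \<noteq> 0}" for x
      using that closure_subset[of "{x. \<phi> x \<noteq> 0}"] by auto
  qed
  from frechet_derivative_at[OF this, symmetric] show "frechet_derivative \<phi> (at z) h = 0" by simp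
qed

lemma test_function_bounds:
  fixes \<phi> :: "'a::euclidean_space \<Rightarrow> real"
  assumes \<phi>: "\<phi> \<in> test_functions S"
  obtains C where "\<And>z. \<bar>\<phi> z\<bar> \<le> C" "\<And>z h. \<bar>frechet_derivative \<phi> (at z) h\<bar> \<le> C * norm h"
proof -
  have "bounded (closure {x. \<phi> x \<noteq> 0})"
    using \<phi> unfolding test_functions_def compactly_inside_def by (intro compact_imp_bounded) blast
  then obtain B where B: "\<And>x. \<phi> x \<noteq> 0 \<Longrightarrow> norm x \<le> B"
    using closure_subset[of "{x. \<phi> x \<noteq> 0}"] unfolding bounded_iff by blast
  have ck: "Ck k \<phi>" for k using \<phi> by (simp add: test_functions_def)
  have z: "\<phi> x = 0" if "B + 1 \<le> norm x" for x
    using B[of x] that by linarith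
  obtain C0 where C0: "\<And>x. \<bar>\<phi> x\<bar> \<le> C0"
    using Ck_zero_outside_ball_bounded[OF ck[of 0], of "B + 1"] z by (metis less_imp_le)
  obtain C1 where C1: "\<And>x h. \<bar>frechet_derivative \<phi> (at x) h\<bar> \<le> C1 * norm h"
    using Ck_derivative_bounded[of \<phi> "B + 1"] ck z by blast
  show ?thesis
  proof (rule that[of "max C0 C1"])
    show "\<bar>\<phi> z\<bar> \<le> max C0 C1" for z using C0[of z] by simp
    fix z h :: 'a
    have "C1 * norm h \<le> max C0 C1 * norm h" by (intro mult_right_mono) auto
    with C1[of z h] show "\<bar>frechet_derivative \<phi> (at z) h\<bar> \<le> max C0 C1 * norm h" by linarith
  qed
qed

lemma test_function_slice:
  fixes \<phi> :: "'a::euclidean_space \<times> real \<Rightarrow> real"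
  assumes \<phi>: "\<phi> \<in> test_functions (B \<times> I)"
  shows "(\<lambda>x. \<phi> (x, t)) \<in> test_functions B"
    and "frechet_derivative (\<lambda>x. \<phi> (x, t)) (at x) e = frechet_derivative \<phi> (at (x, t)) (e, 0)"
    and "((\<lambda>s. \<phi> (x, s)) has_real_derivative frechet_derivative \<phi> (at (x, t)) (0, 1)) (at t)"
proof -
  have ck: "Ck k \<phi>" for k using \<phi> by (simp add: test_functions_def)
  have "bounded_linear (\<lambda>x::'a. (x, 0::real))"
    by (intro bounded_linear_Pair bounded_linear_ident bounded_linear_zero)
  from Ck_affine[OF this ck, of _ "(0, t)"]
  have "Ck k (\<lambda>x. \<phi> (x, t))" for k by simp
  moreover have "compactly_inside {x. \<phi> (x, t) \<noteq> 0} B"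
  proof (rule compactly_insideI)
    have c: "compact (closure {z. \<phi> z \<noteq> 0})" "closure {z. \<phi> z \<noteq> 0} \<subseteq> B \<times> I"
      using \<phi> by (auto simp: test_functions_def compactly_inside_def)
    show "compact (fst ` closure {z. \<phi> z \<noteq> 0})"
      by (rule compact_continuous_image[OF continuous_on_fst[OF continuous_on_id] c(1)])
    show "fst ` closure {z. \<phi> z \<noteq> 0} \<subseteq> B" using c(2) by auto
    show "{x. \<phi> (x, t) \<noteq> 0} \<subseteq> fst ` closure {z. \<phi> z \<noteq> 0}"
    proof
      fix x assume "x \<in> {x. \<phi> (x, t) \<noteq> 0}"
      hence "(x, t) \<in> closure {z. \<phi> z \<noteq> 0}" using closure_subset[of "{z. \<phi> z \<noteq> 0}"] by blast
      thus "x \<in> fst ` closure {z. \<phi> z \<noteq> 0}" by (rule image_eqI[rotated]) simp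
    qed
  qed
  ultimately show "(\<lambda>x. \<phi> (x, t)) \<in> test_functions B" by (simp add: test_functions_def)
  note d = Ck_has_derivative[OF ck]
  have "((\<lambda>x. (x, t)) has_derivative (\<lambda>e. (e, 0))) (at x)"
    by (intro has_derivative_Pair has_derivative_ident has_derivative_const)
  from frechet_derivative_at[OF has_derivative_compose[OF this d], symmetric]
  show "frechet_derivative (\<lambda>x. \<phi> (x, t)) (at x) e = frechet_derivative \<phi> (at (x, t)) (e, 0)" by simp
  have "((\<lambda>s. (x, s)) has_derivative (\<lambda>s. (0, s))) (at t)"
    by (intro has_derivative_Pair has_derivative_ident has_derivative_const)
  from has_derivative_compose[OF this d]
  have "((\<lambda>s. \<phi> (x, s)) has_derivative (\<lambda>s. frechet_derivative \<phi> (at (x, t)) (0, s))) (at t)" .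
  moreover have "(\<lambda>s. frechet_derivative \<phi> (at (x, t)) (0, s)) = (*) (frechet_derivative \<phi> (at (x, t)) (0, 1))"
  proof
    fix s :: real
    have "frechet_derivative \<phi> (at (x, t)) (s *\<^sub>R (0, 1)) = s *\<^sub>R frechet_derivative \<phi> (at (x, t)) (0, 1)"
      by (rule linear_scale[OF has_derivative_linear[OF d]])
    thus "frechet_derivative \<phi> (at (x, t)) (0, s) = frechet_derivative \<phi> (at (x, t)) (0, 1) * s"
      by (simp add: mult.commute)
  qed
  ultimately show "((\<lambda>s. \<phi> (x, s)) has_real_derivative frechet_derivative \<phi> (at (x, t)) (0, 1)) (at t)"
    by (simp only: has_field_derivative_def)
qed

lemma gradient_inner:
  fixes \<psi> :: "real^'n \<Rightarrow> real"
  assumes "Ck (Suc 0) \<psi>"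
  shows "g \<bullet> gradient \<psi> x = frechet_derivative \<psi> (at x) g"
proof -
  interpret bounded_linear "frechet_derivative \<psi> (at x)"
    by (rule has_derivative_bounded_linear[OF Ck_has_derivative[OF assms]])
  have "g = (\<Sum>j\<in>UNIV. (g $ j) *\<^sub>R axis j 1)"
    using basis_expansion[of g] by (simp add: scalar_mult_eq_scaleR)
  hence "frechet_derivative \<psi> (at x) g = (\<Sum>j\<in>UNIV. g $ j * frechet_derivative \<psi> (at x) (axis j 1))"
    using sum[of "\<lambda>j. (g $ j) *\<^sub>R axis j 1" UNIV] by (simp add: scaleR)
  thus ?thesis by (simp add: inner_vec_def gradient_def)
qed

lemma AE_lborel_slices:
  assumes "AE z in (lborel :: ('a::euclidean_space \<times> 'b::euclidean_space) measure). P z"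
  shows "AE t in lborel. AE x in lborel. P (x, t)"
proof -
  obtain Z where Z: "{z \<in> space lborel. \<not> P z} \<subseteq> Z" "Z \<in> null_sets lborel"
    using assms unfolding eventually_ae_filter by blast
  have Zm[measurable]: "Z \<in> sets (lborel \<Otimes>\<^sub>M lborel)"
    using null_setsD2[OF Z(2)] unfolding lborel_prod .
  have "AE z in lborel \<Otimes>\<^sub>M lborel. z \<notin> Z"
    using AE_not_in[OF Z(2)] unfolding lborel_prod .
  hence "AE x in lborel. AE t in lborel. (x, t) \<notin> Z"
    by (rule lborel_pair.AE_pair)
  hence "AE t in lborel. AE x in lborel. (x, t) \<notin> Z"
  proof (subst lborel_pair.AE_commute[symmetric])
    show "{p \<in> space (lborel \<Otimes>\<^sub>M lborel). (fst p, snd p) \<notin> Z} \<in> sets (lborel \<Otimes>\<^sub>M lborel)"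
      by (simp only: prod.collapse) measurable
  qed
  thus ?thesis
  proof eventually_elim
    case (elim t)
    thus ?case by eventually_elim (use Z(1) in auto)
  qed
qed

lemma test_function_spatial_gradient:
  fixes \<phi> :: "(real^'n) \<times> real \<Rightarrow> real"
  assumes \<phi>: "\<phi> \<in> test_functions (B \<times> I)"
  defines "g \<equiv> \<lambda>z. gradient (\<lambda>x. \<phi> (x, snd z)) (fst z)"
  shows "v \<bullet> g z = frechet_derivative \<phi> (at z) (v, 0)"
    and "g \<in> borel_measurable borel"
proof -
  have eq: "v \<bullet> g z = frechet_derivative \<phi> (at z) (v, 0)" for v z
  proof -
    have "Ck (Suc 0) (\<lambda>x. \<phi> (x, snd z))"
      using test_function_slice(1)[OF \<phi>, of "snd z"] unfolding test_functions_def by blast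
    hence "v \<bullet> g z = frechet_derivative (\<lambda>x. \<phi> (x, snd z)) (at (fst z)) v"
      unfolding g_def by (rule gradient_inner)
    also have "\<dots> = frechet_derivative \<phi> (at (fst z, snd z)) (v, 0)"
      by (rule test_function_slice(2)[OF \<phi>])
    finally show ?thesis by simp
  qed
  thus "v \<bullet> g z = frechet_derivative \<phi> (at z) (v, 0)" .
  have ck: "Ck k \<phi>" for k using \<phi> by (simp add: test_functions_def)
  show "g \<in> borel_measurable borel"
  proof (subst borel_measurable_euclidean_space, intro ballI)
    fix b :: "real^'n"
    have "(\<lambda>z. g z \<bullet> b) = (\<lambda>z. frechet_derivative \<phi> (at z) (b, 0))"
      by (intro ext, subst inner_commute) (rule eq)
    moreover have "(\<lambda>z. frechet_derivative \<phi> (at z) (b, 0)) \<in> borel_measurable borel"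
      using Ck_derivative_continuous[OF ck] by (rule borel_measurable_continuous_onI)
    ultimately show "(\<lambda>z. g z \<bullet> b) \<in> borel_measurable borel" by simp
  qed
qed

lemma integrable_inner_bounded:
  fixes f g :: "'a::euclidean_space \<Rightarrow> 'b::euclidean_space"
  assumes f: "integrable lborel f" and g: "g \<in> borel_measurable borel" and b: "\<And>z v. \<bar>v \<bullet> g z\<bar> \<le> C * norm v"
  shows "integrable lborel (\<lambda>z. f z \<bullet> g z)"
proof (rule Bochner_Integration.integrable_bound)
  show "integrable lborel (\<lambda>z. C * norm (f z))" using f by simp
  have [measurable]: "f \<in> borel_measurable borel" "g \<in> borel_measurable borel"
    using borel_measurable_integrable[OF f] g by simp_all
  show "(\<lambda>z. f z \<bullet> g z) \<in> borel_measurable lborel" by measurable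
  show "AE z in lborel. norm (f z \<bullet> g z) \<le> norm (C * norm (f z))"
    by (intro AE_I2) (simp add: order_trans[OF b abs_ge_self])
qed

text \<open>
  Almost every slice of a space-time test function is tested against the weak gradient of the
  slice \<open>u(\<cdot>, t)\<close>, and Fubini's theorem integrates the result in time. The
  Borel representatives agree with \<open>u\<close> and \<open>D\<close> almost everywhere on
  almost every slice.
\<close>

lemma space_weak_form:
  fixes u :: "(real^'n) \<times> real \<Rightarrow> real" and D :: "(real^'n) \<times> real \<Rightarrow> real^'n"
  assumes B: "open B" and I: "open I"
    and wk: "AE t in lebesgue_on I. weak_gradient B (\<lambda>x. u (x, t)) (\<lambda>x. D (x, t)) \<and>
      (\<lambda>x. u (x, t)) \<in> borel_measurable (lebesgue_on B) \<and> (\<lambda>x. D (x, t)) \<in> borel_measurable (lebesgue_on B)"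
    and u': "integrable lborel u'" "AE z in lborel. u' z = indicator (B \<times> I) z *\<^sub>R u z"
    and D': "integrable lborel D'" "AE z in lborel. D' z = indicator (B \<times> I) z *\<^sub>R D z"
  shows "distributional_space_gradient (B \<times> I) u' D'"
  unfolding distributional_space_gradient_def
proof (intro ballI allI)
  fix \<phi> :: "(real^'n) \<times> real \<Rightarrow> real" and e :: "real^'n"
  assume \<phi>: "\<phi> \<in> test_functions (B \<times> I)"
  have ck: "Ck k \<phi>" for k using \<phi> by (simp add: test_functions_def)
  obtain C where C: "\<And>z. \<bar>\<phi> z\<bar> \<le> C" "\<And>z h. \<bar>frechet_derivative \<phi> (at z) h\<bar> \<le> C * norm h"
    using test_function_bounds[OF \<phi>] by blast
  have \<phi>m: "\<phi> \<in> borel_measurable borel" using ck by (rule Ck_measurable)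
  have dm: "(\<lambda>z. frechet_derivative \<phi> (at z) h) \<in> borel_measurable borel" for h
    using Ck_derivative_continuous[OF ck, of h] by (rule borel_measurable_continuous_onI)
  have u'm: "u' \<in> borel_measurable borel" using borel_measurable_integrable[OF u'(1)] by simp
  have D'm: "D' \<in> borel_measurable borel" using borel_measurable_integrable[OF D'(1)] by simp
  have iu: "integrable lborel (\<lambda>z. u' z * frechet_derivative \<phi> (at z) h)" for h
    by (rule integrable_mult_kernel[OF u'(1) dm C(2)])
  have iD: "integrable lborel (\<lambda>z. (D' z \<bullet> h) * \<phi> z)" for h
    using D'(1) by (intro integrable_mult_kernel[OF _ \<phi>m C(1)]) simp
  have axis: "(\<integral>z. u' z * frechet_derivative \<phi> (at z) (axis j 1, 0) \<partial>lborel) = - (\<integral>z. (D' z $ j) * \<phi> z \<partial>lborel)" for j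
  proof -
    let ?d = "\<lambda>z. frechet_derivative \<phi> (at z) (axis j 1, 0)"
    have iDj: "integrable lborel (\<lambda>z. (D' z $ j) * \<phi> z)"
      using iD[of "axis j 1"] by (simp add: inner_axis)
    note iuj = iu[of "(axis j 1, 0)"]
    have iP: "integrable (lborel \<Otimes>\<^sub>M lborel) (\<lambda>(x, t). u' (x, t) * ?d (x, t) + (D' (x, t) $ j) * \<phi> (x, t))"
      using Bochner_Integration.integrable_add[OF iuj iDj] by (simp add: lborel_prod split_beta')
    have ae_t: "AE t in lborel. t \<in> I \<longrightarrow> weak_gradient B (\<lambda>x. u (x, t)) (\<lambda>x. D (x, t)) \<and>
      (\<lambda>x. u (x, t)) \<in> borel_measurable (lebesgue_on B) \<and> (\<lambda>x. D (x, t)) \<in> borel_measurable (lebesgue_on B)"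
      using wk I by (subst (asm) AE_restrict_space_iff) (auto simp: AE_completion_iff)
    have zero: "AE t in lborel. (\<integral>x. u' (x, t) * ?d (x, t) + (D' (x, t) $ j) * \<phi> (x, t) \<partial>lborel) = 0"
    proof -
      have iu2: "AE t in lborel. integrable lborel (\<lambda>x. u' (x, t) * ?d (x, t))"
        using lborel_pair.AE_integrable_snd[of "\<lambda>x t. u' (x, t) * ?d (x, t)"] iuj
        by (simp add: lborel_prod split_beta')
      have iD2: "AE t in lborel. integrable lborel (\<lambda>x. (D' (x, t) $ j) * \<phi> (x, t))"
        using lborel_pair.AE_integrable_snd[of "\<lambda>x t. (D' (x, t) $ j) * \<phi> (x, t)"] iDj
        by (simp add: lborel_prod split_beta')
      show ?thesis
        using ae_t iu2 iD2 AE_lborel_slices[OF u'(2)] AE_lborel_slices[OF D'(2)]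
      proof eventually_elim
        case (elim t)
        show ?case
        proof (cases "t \<in> I")
          case False
          hence "(x, t) \<notin> B \<times> I" for x by simp
          note z = test_function_derivative_zero_off_support[OF \<phi> this]
          show ?thesis by (simp add: z)
        next
          case True
          define \<psi> where "\<psi> x = \<phi> (x, t)" for x
          have \<psi>: "\<psi> \<in> test_functions B" unfolding \<psi>_def[abs_def] by (rule test_function_slice(1)[OF \<phi>])
          have gr: "gradient \<psi> x $ j = ?d (x, t)" for x
          proof -
            have "gradient \<psi> x $ j = frechet_derivative \<psi> (at x) (axis j 1)"
              by (simp add: gradient_def)
            also have "\<dots> = ?d (x, t)"
              unfolding \<psi>_def[abs_def] by (rule test_function_slice(2)[OF \<phi>])
            finally show ?thesis .
          qed
          have wg: "weak_gradient B (\<lambda>x. u (x, t)) (\<lambda>x. D (x, t))"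
            and um: "(\<lambda>x. u (x, t)) \<in> borel_measurable (lebesgue_on B)"
            and Dm: "(\<lambda>x. D (x, t)) \<in> borel_measurable (lebesgue_on B)"
            using mp[OF elim(1) True] by blast+
          have Bs: "B \<in> sets lebesgue" using B by simp
          have lm: "f \<in> borel_measurable (lebesgue_on B)" if "f \<in> borel_measurable borel" for f :: "real^'n \<Rightarrow> real"
          proof (intro measurable_restrict_space1 measurable_completion)
            show "f \<in> borel_measurable lborel" using that by simp
          qed
          have dt: "(\<lambda>x. ?d (x, t)) \<in> borel_measurable borel"
            by (rule measurable_compose[OF _ dm]) simp
          have \<phi>t: "(\<lambda>x. \<phi> (x, t)) \<in> borel_measurable borel"
            by (rule measurable_compose[OF _ \<phi>m]) simp
          have u't: "(\<lambda>x. u' (x, t)) \<in> borel_measurable borel"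
            by (rule measurable_compose[OF _ u'm]) simp
          have D't: "(\<lambda>x. D' (x, t)) \<in> borel_measurable borel"
            by (rule measurable_compose[OF _ D'm]) simp
          have e1: "(\<integral>x. u' (x, t) * ?d (x, t) \<partial>lborel) = integral\<^sup>L (lebesgue_on B) (\<lambda>x. u (x, t) * ?d (x, t))"
          proof (rule integral_lebesgue_on_borel_representative(1)[OF Bs, symmetric])
            show "(\<lambda>x. u (x, t) * ?d (x, t)) \<in> borel_measurable (lebesgue_on B)"
              using um lm[OF dt] by (rule borel_measurable_times)
            show "(\<lambda>x. u' (x, t) * ?d (x, t)) \<in> borel_measurable borel"
              using u't dt by (rule borel_measurable_times)
            show "AE x in lborel. u' (x, t) * ?d (x, t) = indicator B x *\<^sub>R (u (x, t) * ?d (x, t))"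
              using elim(4) by eventually_elim (use True in \<open>auto simp: indicator_def\<close>)
          qed
          have e2: "integral\<^sup>L (lebesgue_on B) (\<lambda>x. u (x, t) * ?d (x, t)) = - integral\<^sup>L (lebesgue_on B) (\<lambda>x. D (x, t) $ j * \<psi> x)"
          proof -
            have "\<forall>\<psi>\<in>test_functions B. \<forall>j. integral\<^sup>L (lebesgue_on B) (\<lambda>x. u (x, t) * gradient \<psi> x $ j) =
                - integral\<^sup>L (lebesgue_on B) (\<lambda>x. D (x, t) $ j * \<psi> x)"
              using wg unfolding weak_gradient_def by (rule conjunct2)
            from spec[OF bspec[OF this \<psi>], of j] show ?thesis unfolding gr .
          qed
          have e3: "integral\<^sup>L (lebesgue_on B) (\<lambda>x. D (x, t) $ j * \<psi> x) = (\<integral>x. (D' (x, t) $ j) * \<phi> (x, t) \<partial>lborel)"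
          proof (rule integral_lebesgue_on_borel_representative(1)[OF Bs])
            have "(\<lambda>x. D (x, t) \<bullet> axis j 1) \<in> borel_measurable (lebesgue_on B)"
              using Dm by simp
            hence "(\<lambda>x. D (x, t) $ j) \<in> borel_measurable (lebesgue_on B)" by (simp add: inner_axis)
            thus "(\<lambda>x. D (x, t) $ j * \<psi> x) \<in> borel_measurable (lebesgue_on B)"
              using lm[OF \<phi>t] unfolding \<psi>_def by (rule borel_measurable_times)
            have "(\<lambda>x. D' (x, t) \<bullet> axis j 1) \<in> borel_measurable borel"
              using D't by simp
            hence "(\<lambda>x. D' (x, t) $ j) \<in> borel_measurable borel" by (simp add: inner_axis)
            thus "(\<lambda>x. (D' (x, t) $ j) * \<phi> (x, t)) \<in> borel_measurable borel"
              using \<phi>t by (rule borel_measurable_times)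
            show "AE x in lborel. (D' (x, t) $ j) * \<phi> (x, t) = indicator B x *\<^sub>R (D (x, t) $ j * \<psi> x)"
              using elim(5) by eventually_elim (use True in \<open>auto simp: indicator_def \<psi>_def\<close>)
          qed
          have "(\<integral>x. u' (x, t) * ?d (x, t) \<partial>lborel) = - (\<integral>x. (D' (x, t) $ j) * \<phi> (x, t) \<partial>lborel)"
            unfolding e1 e2 e3 ..
          thus ?thesis
            by (subst Bochner_Integration.integral_add[OF elim(2,3)]) linarith
        qed
      qed
    qed
    have "(\<integral>z. u' z * ?d z + (D' z $ j) * \<phi> z \<partial>lborel) =
       (\<integral>t. (\<integral>x. u' (x, t) * ?d (x, t) + (D' (x, t) $ j) * \<phi> (x, t) \<partial>lborel) \<partial>lborel)"
      using lborel_pair.integral_snd[OF iP] by (simp add: lborel_prod split_beta')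
    also have "\<dots> = 0" by (rule integral_eq_zero_AE[OF zero])
    finally show ?thesis
      using iuj iDj by simp
  qed
  have de: "frechet_derivative \<phi> (at z) (e, 0) = (\<Sum>j\<in>UNIV. e $ j * frechet_derivative \<phi> (at z) (axis j 1, 0))" for z
  proof -
    have "frechet_derivative \<phi> (at z) (e, 0) = e \<bullet> gradient (\<lambda>x. \<phi> (x, snd z)) (fst z)"
      by (rule test_function_spatial_gradient(1)[OF \<phi>, symmetric])
    also have "\<dots> = (\<Sum>j\<in>UNIV. e $ j * (axis j 1 \<bullet> gradient (\<lambda>x. \<phi> (x, snd z)) (fst z)))"
      by (simp add: inner_vec_def[of e] inner_axis')
    finally show ?thesis by (simp add: test_function_spatial_gradient(1)[OF \<phi>])
  qed
  have "(\<integral>z. u' z * frechet_derivative \<phi> (at z) (e, 0) \<partial>lborel) =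
      (\<integral>z. (\<Sum>j\<in>UNIV. e $ j * (u' z * frechet_derivative \<phi> (at z) (axis j 1, 0))) \<partial>lborel)"
    unfolding de sum_distrib_left by (simp add: mult_ac)
  also have "\<dots> = (\<Sum>j\<in>UNIV. e $ j * (\<integral>z. u' z * frechet_derivative \<phi> (at z) (axis j 1, 0) \<partial>lborel))"
    by (subst Bochner_Integration.integral_sum) (simp_all add: iu)
  also have "\<dots> = - (\<Sum>j\<in>UNIV. e $ j * (\<integral>z. (D' z $ j) * \<phi> z \<partial>lborel))"
    by (simp add: axis sum_negf)
  also have "(\<Sum>j\<in>UNIV. e $ j * (\<integral>z. (D' z $ j) * \<phi> z \<partial>lborel)) =
      (\<integral>z. (\<Sum>j\<in>UNIV. e $ j * ((D' z $ j) * \<phi> z)) \<partial>lborel)"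
  proof (subst Bochner_Integration.integral_sum)
    fix j
    show "integrable lborel (\<lambda>z. e $ j * ((D' z $ j) * \<phi> z))"
      using iD[of "axis j 1"] by (simp add: inner_axis)
  qed simp
  also have "\<dots> = (\<integral>z. (D' z \<bullet> e) * \<phi> z \<partial>lborel)"
    unfolding inner_vec_def[of _ e] sum_distrib_right by (simp add: mult_ac)
  finally show "(\<integral>z. u' z * frechet_derivative \<phi> (at z) (e, 0) \<partial>lborel) = - (\<integral>z. (D' z \<bullet> e) * \<phi> z \<partial>lborel)" .
qed

lemma test_functions_mono: "S \<subseteq> T \<Longrightarrow> test_functions S \<subseteq> test_functions T"
  by (auto simp: test_functions_def compactly_inside_def)

lemma vinner_single: "i < N \<Longrightarrow> vinner N v (\<lambda>j. if j = i then x else 0) = v i \<bullet> x"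
proof -
  assume i: "i < N"
  have "vinner N v (\<lambda>j. if j = i then x else 0) = (\<Sum>j<N. if j = i then v i \<bullet> x else 0)"
    unfolding vinner_def by (rule sum.cong) auto
  thus ?thesis using i by simp
qed

text \<open>
  Test the system with a field that has a single nonzero component. Its support lies in \<open>B
  \<times> I\<close>, so the integrals over \<open>S\<close> see only the part of
  \<open>u\<close>, \<open>A\<close> and \<open>F\<close> in \<open>B \<times> I\<close>.
\<close>

lemma time_weak_form:
  fixes u :: "(real^'n) \<times> real \<Rightarrow> nat \<Rightarrow> real"
  assumes S: "S \<in> sets lebesgue" "B \<times> I \<subseteq> S"
    and sol: "weak_solution S p N A F u Du" and i: "i < N"
    and um: "(\<lambda>z. u z i) \<in> borel_measurable (lebesgue_on S)"
    and Am: "(\<lambda>z. A z (Du z) i) \<in> borel_measurable (lebesgue_on S)"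
    and Rm: "(\<lambda>z. vnorm N (F z) powr (p - 2) *\<^sub>R F z i) \<in> borel_measurable (lebesgue_on S)"
    and u': "integrable lborel u'" "AE z in lborel. u' z = indicator (B \<times> I) z *\<^sub>R u z i"
    and A': "integrable lborel A'" "AE z in lborel. A' z = indicator (B \<times> I) z *\<^sub>R A z (Du z) i"
    and R': "integrable lborel R'" "AE z in lborel. R' z = indicator (B \<times> I) z *\<^sub>R (vnorm N (F z) powr (p - 2) *\<^sub>R F z i)"
  shows "distributional_time_divergence (B \<times> I) u' (\<lambda>z. A' z - R' z)"
  unfolding distributional_time_divergence_def
proof
  fix \<phi> :: "(real^'n) \<times> real \<Rightarrow> real"
  assume \<phi>: "\<phi> \<in> test_functions (B \<times> I)"
  define g where "g z = gradient (\<lambda>x. \<phi> (x, snd z)) (fst z)" for z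
  define d where "d z = frechet_derivative \<phi> (at z) (0, 1)" for z
  have g: "v \<bullet> g z = frechet_derivative \<phi> (at z) (v, 0)" for v z
    unfolding g_def by (rule test_function_spatial_gradient(1)[OF \<phi>])
  have gm: "g \<in> borel_measurable borel"
    unfolding g_def[abs_def] by (rule test_function_spatial_gradient(2)[OF \<phi>])
  have ck: "Ck k \<phi>" for k using \<phi> by (simp add: test_functions_def)
  have dm: "d \<in> borel_measurable borel"
    unfolding d_def[abs_def] using Ck_derivative_continuous[OF ck] by (rule borel_measurable_continuous_onI)
  have off: "v \<bullet> g z = 0" "d z = 0" if "z \<notin> B \<times> I" for v z
    unfolding g d_def by (rule test_function_derivative_zero_off_support[OF \<phi> that])+
  obtain C where C: "\<And>z h. \<bar>frechet_derivative \<phi> (at z) h\<bar> \<le> C * norm h"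
    using test_function_bounds[OF \<phi>] by metis
  have gC: "\<bar>v \<bullet> g z\<bar> \<le> C * norm v" for v z
    using C[of z "(v, 0)"] by (simp add: g)
  have dC: "\<bar>d z\<bar> \<le> C" for z
    using C[of z "(0, 1)"] by (simp add: d_def)
  define \<Phi> where "\<Phi> z = (\<lambda>j. if j = i then \<phi> z else 0)" for z
  have "\<Phi> \<in> test_fields S N"
    unfolding test_fields_def mem_Collect_eq
  proof (intro conjI allI impI)
    show "\<Phi> z \<in> vecs N" for z using i by (auto simp: \<Phi>_def vecs_def)
    fix j
    have "(\<lambda>z. 0) \<in> test_functions S"
      by (simp add: test_functions_def Ck_const compactly_inside_def)
    moreover have "\<phi> \<in> test_functions S"
      using \<phi> test_functions_mono[OF S(2)] by blast
    ultimately show "(\<lambda>z. \<Phi> z j) \<in> test_functions S"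
      by (cases "j = i") (simp_all add: \<Phi>_def)
  qed
  hence eq: "integral\<^sup>L (lebesgue_on S) (\<lambda>z. - vinner N (u z) (time_derivative \<Phi> z)
                + vinner N (A z (Du z)) (spatial_gradient \<Phi> z)) =
        integral\<^sup>L (lebesgue_on S)
          (\<lambda>z. vinner N (\<lambda>i. vnorm N (F z) powr (p - 2) *\<^sub>R F z i) (spatial_gradient \<Phi> z))"
    using sol unfolding weak_solution_def by blast
  have td: "time_derivative \<Phi> z = (\<lambda>j. if j = i then d z else 0)" for z
  proof
    fix j
    have "((\<lambda>t. \<phi> (fst z, t)) has_real_derivative d z) (at (snd z))"
      using test_function_slice(3)[OF \<phi>, of "fst z" "snd z"] by (simp add: d_def)
    from DERIV_imp_deriv[OF this]
    show "time_derivative \<Phi> z j = (if j = i then d z else 0)"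
      by (simp add: time_derivative_def \<Phi>_def)
  qed
  have sg: "spatial_gradient \<Phi> z = (\<lambda>j. if j = i then g z else 0)" for z
  proof
    fix j
    have "gradient (\<lambda>x. 0) y = (0::real^'n)" for y
      by (simp add: gradient_def vec_eq_iff)
    thus "spatial_gradient \<Phi> z j = (if j = i then g z else 0)"
      by (simp add: spatial_gradient_def \<Phi>_def g_def)
  qed
  let ?R = "\<lambda>z. vnorm N (F z) powr (p - 2) *\<^sub>R F z i"
  have eq2: "integral\<^sup>L (lebesgue_on S) (\<lambda>z. - (u z i * d z) + A z (Du z) i \<bullet> g z) =
      integral\<^sup>L (lebesgue_on S) (\<lambda>z. ?R z \<bullet> g z)"
    using eq unfolding td sg vinner_single[OF i] by simp
  have lm: "f \<in> borel_measurable (lebesgue_on S)" if "f \<in> borel_measurable borel"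
    for f :: "(real^'n) \<times> real \<Rightarrow> 'c::euclidean_space"
  proof (intro measurable_restrict_space1 measurable_completion)
    show "f \<in> borel_measurable lborel" using that by simp
  qed
  have meas: "u' \<in> borel_measurable borel" "A' \<in> borel_measurable borel" "R' \<in> borel_measurable borel"
    using borel_measurable_integrable[OF u'(1)] borel_measurable_integrable[OF A'(1)]
      borel_measurable_integrable[OF R'(1)] by simp_all
  have left: "integral\<^sup>L (lebesgue_on S) (\<lambda>z. - (u z i * d z) + A z (Du z) i \<bullet> g z) =
      (\<integral>z. - (u' z * d z) + A' z \<bullet> g z \<partial>lborel)"
  proof (rule integral_lebesgue_on_borel_representative(1)[OF S(1)])
    show "(\<lambda>z. - (u z i * d z) + A z (Du z) i \<bullet> g z) \<in> borel_measurable (lebesgue_on S)"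
      using um Am lm[OF dm] lm[OF gm]
      by (intro borel_measurable_add borel_measurable_uminus borel_measurable_times borel_measurable_inner)
    show "(\<lambda>z. - (u' z * d z) + A' z \<bullet> g z) \<in> borel_measurable borel"
      using meas dm gm
      by (intro borel_measurable_add borel_measurable_uminus borel_measurable_times borel_measurable_inner)
    show "AE z in lborel. - (u' z * d z) + A' z \<bullet> g z = indicator S z *\<^sub>R (- (u z i * d z) + A z (Du z) i \<bullet> g z)"
      using u'(2) A'(2)
    proof eventually_elim
      case (elim z)
      show ?case
      proof (cases "z \<in> B \<times> I")
        case True
        hence "indicator (B \<times> I) z = (1::real)" "indicator S z = (1::real)" using S(2) by auto
        thus ?thesis unfolding elim by simp
      next
        case False
        show ?thesis by (simp add: off[OF False])
      qed
    qed
  qed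
  have right: "integral\<^sup>L (lebesgue_on S) (\<lambda>z. ?R z \<bullet> g z) = (\<integral>z. R' z \<bullet> g z \<partial>lborel)"
  proof (rule integral_lebesgue_on_borel_representative(1)[OF S(1)])
    show "(\<lambda>z. ?R z \<bullet> g z) \<in> borel_measurable (lebesgue_on S)"
      using Rm lm[OF gm] by (rule borel_measurable_inner)
    show "(\<lambda>z. R' z \<bullet> g z) \<in> borel_measurable borel"
      using meas(3) gm by (rule borel_measurable_inner)
    show "AE z in lborel. R' z \<bullet> g z = indicator S z *\<^sub>R (?R z \<bullet> g z)"
      using R'(2)
    proof eventually_elim
      case (elim z)
      show ?case
      proof (cases "z \<in> B \<times> I")
        case True
        hence "indicator (B \<times> I) z = (1::real)" "indicator S z = (1::real)" using S(2) by auto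
        thus ?thesis unfolding elim by simp
      next
        case False
        show ?thesis by (simp only: off[OF False]) simp
      qed
    qed
  qed
  have iu: "integrable lborel (\<lambda>z. u' z * d z)"
    by (rule integrable_mult_kernel[OF u'(1) dm dC])
  have iA: "integrable lborel (\<lambda>z. A' z \<bullet> g z)"
    by (rule integrable_inner_bounded[OF A'(1) gm gC])
  have iR: "integrable lborel (\<lambda>z. R' z \<bullet> g z)"
    by (rule integrable_inner_bounded[OF R'(1) gm gC])
  have "- (\<integral>z. u' z * d z \<partial>lborel) + (\<integral>z. A' z \<bullet> g z \<partial>lborel) = (\<integral>z. R' z \<bullet> g z \<partial>lborel)"
    using eq2 iu iA unfolding left right by simp
  hence "(\<integral>z. u' z * d z \<partial>lborel) = (\<integral>z. A' z \<bullet> g z \<partial>lborel) - (\<integral>z. R' z \<bullet> g z \<partial>lborel)"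
    by linarith
  also have "\<dots> = (\<integral>z. (A' z - R' z) \<bullet> g z \<partial>lborel)"
    using iA iR by (simp add: inner_diff_left)
  finally show "(\<integral>z. u' z * frechet_derivative \<phi> (at z) (0, 1) \<partial>lborel) =
    (\<integral>z. frechet_derivative \<phi> (at z) (A' z - R' z, 0) \<partial>lborel)"
    by (simp add: d_def g)
qed

section \<open>Parabolic cylinders\<close>

text \<open>
  This covers a non-integrable \<open>h\<close>, whose integral is \<open>0\<close> by convention.
\<close>

lemma integral_le_of_nn_integral_le:
  fixes h :: "'a \<Rightarrow> real"
  assumes "\<And>z. 0 \<le> h z" "(\<integral>\<^sup>+z. ennreal (h z) \<partial>M) \<le> ennreal b" "0 \<le> b"
  shows "(\<integral>z. h z \<partial>M) \<le> b"
proof (cases "integrable M h")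
  case True
  hence "ennreal (\<integral>z. h z \<partial>M) \<le> ennreal b"
    using assms(1,2) nn_integral_eq_integral[OF True] by simp
  thus ?thesis using assms(3) by simp
qed (simp add: not_integrable_integral_eq assms)

lemma powr_le_one_plus_powr:
  fixes x :: real
  assumes "0 \<le> x" "0 \<le> r" "r \<le> q"
  shows "x powr r \<le> 1 + x powr q"
proof (cases "x \<le> 1")
  case True
  hence "x powr r \<le> 1 powr r" using assms by (intro powr_mono2) auto
  hence "x powr r \<le> 1" by simp
  thus ?thesis using powr_ge_zero[of x q] by linarith
next
  case False
  hence "x powr r \<le> x powr q" using assms by (intro powr_mono) auto
  thus ?thesis by simp
qed

lemma lebesgue_on_subset_integrable:
  fixes f :: "'a::euclidean_space \<Rightarrow> 'b::euclidean_space"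
  assumes "integrable (lebesgue_on S) f" "Q \<subseteq> S" "Q \<in> sets lebesgue" "S \<in> sets lebesgue"
  shows "integrable (lebesgue_on Q) f"
proof -
  have 1: "integrable lebesgue (\<lambda>z. indicator S z *\<^sub>R f z)"
    using assms(1,4) integrable_restrict_space[of S lebesgue f] by simp
  have "integrable lebesgue (\<lambda>z. indicator Q z *\<^sub>R (indicator S z *\<^sub>R f z))"
    by (rule integrable_mult_indicator[OF assms(3) 1])
  also have "(\<lambda>z. indicator Q z *\<^sub>R (indicator S z *\<^sub>R f z)) = (\<lambda>z. indicator Q z *\<^sub>R f z)"
  proof
    fix z
    show "indicator Q z *\<^sub>R (indicator S z *\<^sub>R f z) = indicator Q z *\<^sub>R f z"
      using assms(2) by (cases "z \<in> Q") auto
  qed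
  finally show ?thesis
    using assms(3) integrable_restrict_space[of Q lebesgue f] by simp
qed

lemma nn_integral_lebesgue_on_borel_representative:
  fixes h :: "'a::euclidean_space \<Rightarrow> ennreal"
  assumes "Q \<in> sets lebesgue" "AE z in lborel. h' z = indicator Q z * h z"
  shows "(\<integral>\<^sup>+z. h z \<partial>(lebesgue_on Q)) = (\<integral>\<^sup>+z. h' z \<partial>lborel)"
proof -
  have "(\<integral>\<^sup>+z. h z \<partial>(lebesgue_on Q)) = (\<integral>\<^sup>+z. h z * indicator Q z \<partial>lebesgue)"
    using assms(1) by (subst nn_integral_restrict_space) auto
  also have "\<dots> = (\<integral>\<^sup>+z. h z * indicator Q z \<partial>lborel)"
    by (rule nn_integral_completion)
  also have "\<dots> = (\<integral>\<^sup>+z. h' z \<partial>lborel)"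
  proof (rule nn_integral_cong_AE)
    show "AE z in lborel. h z * indicator Q z = h' z"
      using assms(2) by eventually_elim (simp add: mult.commute)
  qed
  finally show ?thesis .
qed

text \<open>
  The arithmetic of the scaling: with \<open>m = |Q|\<close> and \<open>\<Lambda> =
  \<lambda>\<^sup>2\<^sup>-\<^sup>p\<close> all powers of \<open>\<rho>\<close> cancel, the bump
  of radius \<open>\<rho>/2\<close> having height of order \<open>\<rho>\<^sup>-\<^sup>n\<close>
  and slope of order \<open>\<rho>\<^sup>-\<^sup>n\<^sup>-\<^sup>1\<close>.
\<close>

lemma cylinder_constant:
  fixes q L C \<omega> \<rho> \<Lambda> X Y g :: real and n :: nat
  assumes pos: "1 \<le> q" "0 < L" "0 < C" "0 < \<omega>" "0 < \<rho>" "0 < \<Lambda>" "0 \<le> X" "0 \<le> Y"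
    and g: "0 \<le> g" "g \<le> (L + 1) * Y" and m: "m = \<omega> * \<rho> ^ n * (2 * (\<Lambda> * \<rho>\<^sup>2))"
  defines "c \<equiv> 3 powr q * (2 * C * 2 ^ n * 2 powr q * 2 ^ n * \<omega> + ((L + 1) * C * 2 ^ (n + 2) * \<omega>) powr q)"
  shows "3 powr q * ((2 * (C / (\<rho> / 2) ^ n) * (2 * \<rho>) powr q * 2 ^ n) * (\<omega> * \<rho> ^ n) * X +
       m * (C / (\<rho> / 2) ^ Suc n * g) powr q) / \<rho> powr q / m \<le>
     c * (X / m) + c * (\<Lambda> * (Y / m)) powr q"
proof -
  define c1 where "c1 = 2 * C * 2 ^ n * 2 powr q * 2 ^ n * \<omega>"
  define c2 where "c2 = ((L + 1) * C * 2 ^ (n + 2) * \<omega>) powr q"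
  have m0: "0 < m" using pos by (simp add: m)
  have \<rho>q: "0 < \<rho> powr q" using pos by simp
  have c12: "0 \<le> c1" "0 \<le> c2" using pos by (auto simp: c1_def c2_def)
  have k1: "(2 * (C / (\<rho> / 2) ^ n) * (2 * \<rho>) powr q * 2 ^ n) * (\<omega> * \<rho> ^ n) * X = \<rho> powr q * (c1 * X)"
    using pos by (simp add: c1_def powr_mult power_divide field_simps)
  have "C / (\<rho> / 2) ^ Suc n * g \<le> C / (\<rho> / 2) ^ Suc n * ((L + 1) * Y)"
    using pos g by (intro mult_left_mono) auto
  also have "\<dots> = \<rho> * (((L + 1) * C * 2 ^ (n + 2) * \<omega>) * (\<Lambda> * (Y / m)))"
  proof -
    have "\<rho> ^ Suc n \<noteq> 0" "m \<noteq> 0" using pos m0 by auto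
    thus ?thesis
      using pos by (simp add: m power_divide field_simps power2_eq_square)
  qed
  finally have "(C / (\<rho> / 2) ^ Suc n * g) powr q \<le>
      (\<rho> * (((L + 1) * C * 2 ^ (n + 2) * \<omega>) * (\<Lambda> * (Y / m)))) powr q"
    using pos g by (intro powr_mono2) auto
  also have "\<dots> = \<rho> powr q * (c2 * (\<Lambda> * (Y / m)) powr q)"
  proof -
    define K where "K = (L + 1) * C * 2 ^ (n + 2) * \<omega>"
    define W where "W = \<Lambda> * (Y / m)"
    have "0 \<le> K" "0 \<le> W" using pos m0 by (auto simp: K_def W_def)
    hence "(\<rho> * (K * W)) powr q = \<rho> powr q * (K powr q * W powr q)"
      using pos(5) by (simp add: powr_mult)
    thus ?thesis unfolding c2_def K_def W_def .
  qed
  finally have k2: "(C / (\<rho> / 2) ^ Suc n * g) powr q \<le> \<rho> powr q * (c2 * (\<Lambda> * (Y / m)) powr q)" .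
  let ?Z = "(\<Lambda> * (Y / m)) powr q"
  have "3 powr q * ((2 * (C / (\<rho> / 2) ^ n) * (2 * \<rho>) powr q * 2 ^ n) * (\<omega> * \<rho> ^ n) * X +
       m * (C / (\<rho> / 2) ^ Suc n * g) powr q) / \<rho> powr q / m \<le>
     3 powr q * (\<rho> powr q * (c1 * X) + m * (\<rho> powr q * (c2 * ?Z))) / \<rho> powr q / m"
    unfolding k1 using k2 m0 \<rho>q
    by (intro divide_right_mono mult_left_mono add_left_mono) auto
  also have "\<dots> = 3 powr q * c1 * (X / m) + 3 powr q * c2 * ?Z"
    using m0 \<rho>q by (simp add: field_simps)
  also have "\<dots> \<le> c * (X / m) + c * ?Z"
    unfolding c_def c1_def[symmetric] c2_def[symmetric]
    using c12 m0 pos by (intro add_mono mult_right_mono) auto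
  finally show ?thesis .
qed

lemma exists_borel_representatives:
  fixes f :: "nat \<Rightarrow> 'a::euclidean_space \<Rightarrow> 'b::euclidean_space"
  assumes Q: "Q \<in> sets lebesgue" and f: "\<And>i. i < N \<Longrightarrow> integrable (lebesgue_on Q) (f i)"
  shows "\<exists>g. \<forall>i<N. integrable lborel (g i) \<and> (AE z in lborel. g i z = indicator Q z *\<^sub>R f i z)"
proof -
  have "\<exists>g. i < N \<longrightarrow> integrable lborel g \<and> (AE z in lborel. g z = indicator Q z *\<^sub>R f i z)" for i
  proof (cases "i < N")
    case True
    have fm: "f i \<in> borel_measurable (lebesgue_on Q)"
      using f[OF True] by (rule borel_measurable_integrable)
    hence "(\<lambda>z. indicator Q z *\<^sub>R f i z) \<in> borel_measurable lebesgue"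
      using Q borel_measurable_restrict_space_iff[of Q lebesgue "f i"] by simp
    then obtain g where g: "g \<in> borel_measurable borel" "AE z in lborel. g z = indicator Q z *\<^sub>R f i z"
      by (rule borel_representative)
    have "integrable lborel g"
      using integral_lebesgue_on_borel_representative(2)[OF Q fm g] f[OF True] by simp
    with g(2) show ?thesis by blast
  qed simp
  hence "\<forall>i. \<exists>g. i < N \<longrightarrow> integrable lborel g \<and> (AE z in lborel. g z = indicator Q z *\<^sub>R f i z)"
    by blast
  from choice[OF this] show ?thesis by blast
qed

lemma vnorm_zero [simp]: "vnorm N (\<lambda>i. 0) = 0"
  by (simp add: vnorm_def L2_set_def)

lemma AE_less_all:
  fixes N :: nat
  assumes "\<And>i. i < N \<Longrightarrow> AE z in M. P i z"
  shows "AE z in M. \<forall>i<N. P i z"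
proof -
  have "AE z in M. \<forall>i\<in>{..<N}. P i z"
    by (rule AE_finite_allI) (simp_all add: assms)
  thus ?thesis by (rule eventually_mono) auto
qed

text \<open>
  The estimate on one cylinder with an explicit constant. The functions \<open>u\<close>,
  \<open>\<nabla>u\<close>, \<open>A(z, \<nabla>u)\<close> and \<open>|F|\<^sup>p\<^sup>-\<^sup>2
  F\<close> are integrable on \<open>Q\<close> because \<open>p - 1 \<le> q\<close> and
  \<open>|F|\<^sup>p\<^sup>-\<^sup>1\<close> is integrable on the compact closure of
  \<open>Q\<close>. Their Borel representatives satisfy the hypotheses of
  \<open>oscillation_bound\<close>, and the rest is the passage from the double integral to
  \<open>u\<^sub>Q\<close> and the computation of the constant.
\<close>

lemma weak_solution_cylinder_poincare:
  fixes p q L lam T \<rho> t0 C :: real and N :: nat and \<Omega> :: "(real^'n) set" and x0 :: "real^'n"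
    and A :: "(real^'n) \<times> real \<Rightarrow> (nat \<Rightarrow> real^'n) \<Rightarrow> nat \<Rightarrow> real^'n"
    and F :: "(real^'n) \<times> real \<Rightarrow> nat \<Rightarrow> real^'n"
    and u :: "(real^'n) \<times> real \<Rightarrow> nat \<Rightarrow> real"
    and Du :: "(real^'n) \<times> real \<Rightarrow> nat \<Rightarrow> real^'n"
  assumes p: "1 < p" "p - 1 \<le> q" and q: "1 \<le> q" and L: "0 < L" and lam: "0 < lam"
    and \<Omega>: "open \<Omega>" and A: "caratheodory (\<Omega> \<times> {0<..<T}) N A"
    and growth: "AE z in lebesgue_on (\<Omega> \<times> {0<..<T}). \<forall>\<xi>\<in>vecs N.
       vnorm N (A z \<xi>) \<le> L * vnorm N \<xi> powr (p - 1)"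
    and F: "vmeasurable (\<Omega> \<times> {0<..<T}) N F" "Lspace_loc (\<Omega> \<times> {0<..<T}) (p - 1) N F"
    and ps: "parabolic_sobolev \<Omega> T q N u Du"
    and sol: "weak_solution (\<Omega> \<times> {0<..<T}) p N A F u Du"
    and \<rho>: "0 < \<rho>" and inside: "compactly_inside (cylinder p lam x0 t0 \<rho>) (\<Omega> \<times> {0<..<T})"
    and C: "0 < C" and \<eta>: "smooth_bump x0 (\<rho> / 2) C \<eta>"
  defines "Q \<equiv> cylinder p lam x0 t0 \<rho>" and "n \<equiv> DIM(real^'n)" and "\<omega> \<equiv> unit_ball_vol DIM(real^'n)"
  defines "c \<equiv> 3 powr q * (2 * C * 2 ^ n * 2 powr q * 2 ^ n * \<omega> + ((L + 1) * C * 2 ^ (n + 2) * \<omega>) powr q)"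
  shows "avg Q (\<lambda>z. vnorm N (\<lambda>i. u z i - vavg Q u i) powr q / \<rho> powr q)
    \<le> c * avg Q (\<lambda>z. vnorm N (Du z) powr q)
      + c * (lam powr (2 - p) * avg Q (\<lambda>z. (vnorm N (Du z) + vnorm N (F z)) powr (p - 1))) powr q"
proof -
  have \<omega>0: "0 < \<omega>" by (simp add: \<omega>_def)
  let ?S = "\<Omega> \<times> {0<..<T}"
  define s where "s = lam powr (2 - p) * \<rho>\<^sup>2"
  let ?B = "ball x0 \<rho>" and ?I = "{t0 - s<..<t0 + s}"
  have s0: "0 < s" using lam \<rho> by (simp add: s_def)
  have Q: "Q = ?B \<times> ?I" by (simp add: Q_def cylinder_def s_def)
  have Qo: "open Q" unfolding Q by (intro open_Times open_ball open_greaterThanLessThan)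
  have Qb: "Q \<in> sets borel" using Qo by simp
  have QL: "Q \<in> sets lebesgue" using Qb by simp
  have SL: "?S \<in> sets lebesgue" using \<Omega> by (simp add: open_Times)
  have clQ: "closure Q = cball x0 \<rho> \<times> {t0 - s..t0 + s}"
    unfolding Q closure_Times using \<rho> s0 by simp
  have clS: "closure Q \<subseteq> ?S" "compact (closure Q)"
    using inside unfolding Q_def compactly_inside_def by auto
  have QS: "Q \<subseteq> ?S" using clS(1) closure_subset[of Q] by (rule order_trans[rotated])
  have ball_in: "compactly_inside ?B \<Omega>" and times: "0 < t0 - s" "t0 + s < T"
  proof -
    have "x0 \<in> cball x0 \<rho>" using \<rho> by simp
    moreover have "cball x0 \<rho> \<subseteq> \<Omega>"
    proof
      fix x assume "x \<in> cball x0 \<rho>"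
      hence "(x, t0) \<in> closure Q" using s0 by (simp add: clQ)
      thus "x \<in> \<Omega>" using clS(1) by blast
    qed
    ultimately show "compactly_inside ?B \<Omega>"
      using \<rho> by (simp add: compactly_inside_def)
    have "(x0, t0 - s) \<in> closure Q" "(x0, t0 + s) \<in> closure Q"
      using s0 \<rho> by (auto simp: clQ)
    hence "(x0, t0 - s) \<in> ?S" "(x0, t0 + s) \<in> ?S" using clS(1) by blast+
    thus "0 < t0 - s" "t0 + s < T" by simp_all
  qed
  define m where "m = \<omega> * \<rho> ^ n * (2 * (lam powr (2 - p) * \<rho>\<^sup>2))"
  have m0: "0 < m" using \<omega>0 \<rho> lam by (simp add: m_def)
  have eB: "emeasure lborel ?B = ennreal (\<omega> * \<rho> ^ n)"
    using emeasure_ball[of \<rho> x0] \<rho> by (simp add: \<omega>_def n_def)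
  have eQ: "emeasure lborel Q = ennreal m"
  proof -
    have "emeasure lborel Q = emeasure (lborel \<Otimes>\<^sub>M lborel) (?B \<times> ?I)"
      by (simp add: Q lborel_prod)
    also have "\<dots> = emeasure lborel ?B * emeasure lborel ?I"
      by (rule lborel.emeasure_pair_measure_Times) auto
    also have "emeasure lborel ?I = ennreal (2 * (lam powr (2 - p) * \<rho>\<^sup>2))"
      using s0 by (simp add: s_def)
    finally show ?thesis
      using \<omega>0 \<rho> lam unfolding eB m_def by (simp add: ennreal_mult[symmetric])
  qed
  have mQ: "measure lebesgue Q = m"
    using eQ m0 Qb by (simp add: measure_def)
  have avg: "avg Q h = integral\<^sup>L (lebesgue_on Q) h / m" for h
    by (simp add: avg_def mQ)
  have intc: "integrable (lebesgue_on Q) (\<lambda>z. c)" for c :: real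
  proof -
    have "Q \<in> lmeasurable" using eQ QL Qb by (simp add: fmeasurable_def)
    thus ?thesis by (intro finite_measure.integrable_const finite_measure_lebesgue_on)
  qed

  have um: "vmeasurable ?S N u" "vmeasurable ?S N Du" and Duv: "Du \<in> ?S \<rightarrow> vecs N"
    using ps unfolding parabolic_sobolev_def by blast+
  have ps': "AE t in lebesgue_on ?I. sobolev ?B q N (\<lambda>x. u (x, t)) (\<lambda>x. Du (x, t))"
      "integrable (lebesgue_on Q) (\<lambda>z. vnorm N (u z) powr q + vnorm N (Du z) powr q)"
  proof -
    have "open ?B \<and> compactly_inside ?B \<Omega> \<and> 0 < t0 - s \<and> t0 - s < t0 + s \<and> t0 + s < T"
      using ball_in times s0 by simp
    hence "(AE t in lebesgue_on ?I. sobolev ?B q N (\<lambda>x. u (x, t)) (\<lambda>x. Du (x, t))) \<and>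
      integrable (lebesgue_on (?B \<times> ?I)) (\<lambda>z. vnorm N (u z) powr q + vnorm N (Du z) powr q)"
      using ps unfolding parabolic_sobolev_def by blast
    thus "AE t in lebesgue_on ?I. sobolev ?B q N (\<lambda>x. u (x, t)) (\<lambda>x. Du (x, t))"
      "integrable (lebesgue_on Q) (\<lambda>z. vnorm N (u z) powr q + vnorm N (Du z) powr q)"
      unfolding Q by blast+
  qed
  have uS: "(\<lambda>z. u z i) \<in> borel_measurable (lebesgue_on ?S)" if "i < N" for i
    using um(1) that unfolding vmeasurable_def by blast
  have DS: "(\<lambda>z. Du z i) \<in> borel_measurable (lebesgue_on ?S)" if "i < N" for i
    using um(2) that unfolding vmeasurable_def by blast
  have FS: "(\<lambda>z. F z i) \<in> borel_measurable (lebesgue_on ?S)" if "i < N" for i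
    using F(1) that unfolding vmeasurable_def by blast
  have AS: "(\<lambda>z. A z (Du z) i) \<in> borel_measurable (lebesgue_on ?S)" if "i < N" for i
    by (rule caratheodory_composition_measurable[OF SL A Duv um(2) that])
  have nF: "(\<lambda>z. vnorm N (F z)) \<in> borel_measurable (lebesgue_on ?S)"
    by (rule vnorm_measurable) (rule FS)
  have nD: "(\<lambda>z. vnorm N (Du z)) \<in> borel_measurable (lebesgue_on ?S)"
    by (rule vnorm_measurable) (rule DS)
  have nu: "(\<lambda>z. vnorm N (u z)) \<in> borel_measurable (lebesgue_on ?S)"
    by (rule vnorm_measurable) (rule uS)
  define R where "R z i = vnorm N (F z) powr (p - 2) *\<^sub>R F z i" for z i
  have RS: "(\<lambda>z. R z i) \<in> borel_measurable (lebesgue_on ?S)" if "i < N" for i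
  proof -
    note [measurable] = nF FS[OF that]
    show ?thesis unfolding R_def by measurable
  qed
  have R_norm: "vnorm N (R z) = vnorm N (F z) powr (p - 1)" for z
  proof (cases "vnorm N (F z) = 0")
    case False
    hence "0 < vnorm N (F z)" using vnorm_nonneg[of N "F z"] by linarith
    hence "vnorm N (F z) powr (p - 2) * vnorm N (F z) = vnorm N (F z) powr (p - 2) * vnorm N (F z) powr 1"
      by simp
    also have "\<dots> = vnorm N (F z) powr (p - 1)" by (subst powr_add[symmetric]) simp
    finally show ?thesis unfolding R_def vnorm_scaleR by simp
  next
    case True
    thus ?thesis unfolding R_def vnorm_scaleR by simp
  qed
  have onQ: "f \<in> borel_measurable (lebesgue_on Q)" if "f \<in> borel_measurable (lebesgue_on ?S)"
    for f :: "(real^'n) \<times> real \<Rightarrow> 'x::euclidean_space"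
    by (rule measurable_restrict_mono[OF that QS])

  let ?w = "\<lambda>z. vnorm N (u z) powr q + vnorm N (Du z) powr q"
  have iX: "integrable (lebesgue_on Q) (\<lambda>z. vnorm N (Du z) powr q)"
  proof (rule Bochner_Integration.integrable_bound[OF ps'(2)])
    note [measurable] = onQ[OF nD]
    show "(\<lambda>z. vnorm N (Du z) powr q) \<in> borel_measurable (lebesgue_on Q)" by measurable
  qed simp
  have iDp: "integrable (lebesgue_on Q) (\<lambda>z. vnorm N (Du z) powr (p - 1))"
  proof (rule Bochner_Integration.integrable_bound[OF Bochner_Integration.integrable_add[OF intc[of 1] iX]])
    note [measurable] = onQ[OF nD]
    show "(\<lambda>z. vnorm N (Du z) powr (p - 1)) \<in> borel_measurable (lebesgue_on Q)" by measurable
    show "AE z in lebesgue_on Q. norm (vnorm N (Du z) powr (p - 1)) \<le> norm (1 + vnorm N (Du z) powr q)"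
    proof (rule AE_I2)
      fix z
      have "vnorm N (Du z) powr (p - 1) \<le> 1 + vnorm N (Du z) powr q"
        using p by (intro powr_le_one_plus_powr) auto
      thus "norm (vnorm N (Du z) powr (p - 1)) \<le> norm (1 + vnorm N (Du z) powr q)" by simp
    qed
  qed
  have iFp: "integrable (lebesgue_on Q) (\<lambda>z. vnorm N (F z) powr (p - 1))"
  proof -
    have "Lspace (closure Q) (p - 1) N F"
      using F(2) clS unfolding Lspace_loc_def by blast
    hence "integrable (lebesgue_on (closure Q)) (\<lambda>z. vnorm N (F z) powr (p - 1))"
      unfolding Lspace_def by blast
    thus ?thesis
      by (rule lebesgue_on_subset_integrable) (use closure_subset QL in auto)
  qed
  have iY: "integrable (lebesgue_on Q) (\<lambda>z. (vnorm N (Du z) + vnorm N (F z)) powr (p - 1))"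
  proof (rule Bochner_Integration.integrable_bound)
    show "integrable (lebesgue_on Q) (\<lambda>z. 3 powr (p - 1) * (vnorm N (Du z) powr (p - 1) + vnorm N (F z) powr (p - 1)))"
      using iDp iFp by simp
    note [measurable] = onQ[OF nD] onQ[OF nF]
    show "(\<lambda>z. (vnorm N (Du z) + vnorm N (F z)) powr (p - 1)) \<in> borel_measurable (lebesgue_on Q)" by measurable
    show "AE z in lebesgue_on Q. norm ((vnorm N (Du z) + vnorm N (F z)) powr (p - 1)) \<le>
       norm (3 powr (p - 1) * (vnorm N (Du z) powr (p - 1) + vnorm N (F z) powr (p - 1)))"
    proof (rule AE_I2)
      fix z
      have "(vnorm N (Du z) + vnorm N (F z) + 0) powr (p - 1) \<le>
         3 powr (p - 1) * (vnorm N (Du z) powr (p - 1) + vnorm N (F z) powr (p - 1) + 0 powr (p - 1))"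
        using p by (intro powr_add3_le) auto
      thus "norm ((vnorm N (Du z) + vnorm N (F z)) powr (p - 1)) \<le>
       norm (3 powr (p - 1) * (vnorm N (Du z) powr (p - 1) + vnorm N (F z) powr (p - 1)))" by simp
    qed
  qed
  have Agr: "AE z in lebesgue_on Q. vnorm N (A z (Du z)) \<le> L * vnorm N (Du z) powr (p - 1)"
  proof -
    have "AE z in lebesgue. z \<in> ?S \<longrightarrow> (\<forall>\<xi>\<in>vecs N. vnorm N (A z \<xi>) \<le> L * vnorm N \<xi> powr (p - 1))"
      using growth AE_restrict_space_iff[of ?S lebesgue] SL by simp
    hence "AE z in lebesgue. z \<in> Q \<longrightarrow> vnorm N (A z (Du z)) \<le> L * vnorm N (Du z) powr (p - 1)"
    proof eventually_elim
      case (elim z)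
      show ?case
      proof
        assume "z \<in> Q"
        hence "z \<in> ?S" using QS by blast
        moreover from this have "Du z \<in> vecs N" using Duv by blast
        ultimately show "vnorm N (A z (Du z)) \<le> L * vnorm N (Du z) powr (p - 1)" using elim by blast
      qed
    qed
    thus ?thesis using AE_restrict_space_iff[of Q lebesgue] QL by simp
  qed

  have dominated: "integrable (lebesgue_on Q) f"
    if f: "f \<in> borel_measurable (lebesgue_on ?S)"
      and le: "\<And>z. norm (f z) \<le> vnorm N (u z) \<or> norm (f z) \<le> vnorm N (Du z)"
    for f :: "(real^'n) \<times> real \<Rightarrow> 'x::euclidean_space"
  proof (rule Bochner_Integration.integrable_bound[OF Bochner_Integration.integrable_add[OF intc[of 1] ps'(2)] onQ[OF f]])
    show "AE z in lebesgue_on Q. norm (f z) \<le> norm (1 + ?w z)"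
    proof (rule AE_I2)
      fix z
      have pw: "vnorm N v \<le> 1 + vnorm N v powr q" for v :: "nat \<Rightarrow> 'y::euclidean_space"
        using powr_le_one_plus_powr[of "vnorm N v" 1 q] q by simp
      have "norm (f z) \<le> 1 + ?w z"
        using le[of z] pw[of "u z"] pw[of "Du z"] powr_ge_zero[of "vnorm N (u z)" q] powr_ge_zero[of "vnorm N (Du z)" q]
        by linarith
      also have "\<dots> \<le> norm (1 + ?w z)" by simp
      finally show "norm (f z) \<le> norm (1 + ?w z)" .
    qed
  qed
  have iu: "integrable (lebesgue_on Q) (\<lambda>z. u z i)" if i: "i < N" for i
    by (rule dominated[OF uS[OF i]]) (rule disjI1, rule norm_le_vnorm[OF i])
  have iD: "integrable (lebesgue_on Q) (\<lambda>z. Du z i)" if i: "i < N" for i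
    by (rule dominated[OF DS[OF i]]) (rule disjI2, rule norm_le_vnorm[OF i])
  have iA: "integrable (lebesgue_on Q) (\<lambda>z. A z (Du z) i)" if i: "i < N" for i
  proof (rule Bochner_Integration.integrable_bound[OF integrable_mult_right[OF iDp, of L] onQ[OF AS[OF i]]])
    show "AE z in lebesgue_on Q. norm (A z (Du z) i) \<le> norm (L * vnorm N (Du z) powr (p - 1))"
      using Agr
    proof eventually_elim
      case (elim z)
      thus ?case using norm_le_vnorm[OF i, of "A z (Du z)"] by simp
    qed
  qed
  have iR: "integrable (lebesgue_on Q) (\<lambda>z. R z i)" if i: "i < N" for i
  proof (rule Bochner_Integration.integrable_bound[OF iFp onQ[OF RS[OF i]]])
    show "AE z in lebesgue_on Q. norm (R z i) \<le> norm (vnorm N (F z) powr (p - 1))"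
      using norm_le_vnorm[OF i, of "R _"] by (intro AE_I2) (simp add: R_norm)
  qed

  obtain u' where u': "\<forall>i<N. integrable lborel (u' i) \<and> (AE z in lborel. u' i z = indicator Q z *\<^sub>R u z i)"
    using exists_borel_representatives[OF QL, of N "\<lambda>i z. u z i"] iu by blast
  obtain D' where D': "\<forall>i<N. integrable lborel (D' i) \<and> (AE z in lborel. D' i z = indicator Q z *\<^sub>R Du z i)"
    using exists_borel_representatives[OF QL, of N "\<lambda>i z. Du z i"] iD by blast
  obtain A' where A': "\<forall>i<N. integrable lborel (A' i) \<and> (AE z in lborel. A' i z = indicator Q z *\<^sub>R A z (Du z) i)"
    using exists_borel_representatives[OF QL, of N "\<lambda>i z. A z (Du z) i"] iA by blast
  obtain R' where R': "\<forall>i<N. integrable lborel (R' i) \<and> (AE z in lborel. R' i z = indicator Q z *\<^sub>R R z i)"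
    using exists_borel_representatives[OF QL, of N "\<lambda>i z. R z i"] iR by blast
  (* The flux G of the equation u_t = div G. *)
  define G' where "G' i z = A' i z - R' i z" for i z

  have sw: "distributional_space_gradient Q (u' i) (D' i)" if i: "i < N" for i
    unfolding Q
  proof (rule space_weak_form)
    show "AE t in lebesgue_on ?I. weak_gradient ?B (\<lambda>x. u (x, t) i) (\<lambda>x. Du (x, t) i) \<and>
      (\<lambda>x. u (x, t) i) \<in> borel_measurable (lebesgue_on ?B) \<and> (\<lambda>x. Du (x, t) i) \<in> borel_measurable (lebesgue_on ?B)"
      using ps'(1)
    proof eventually_elim
      case (elim t)
      thus ?case using i unfolding sobolev_def Lspace_def vmeasurable_def by blast
    qed
  qed (use u' D' i in \<open>simp_all add: Q\<close>)
  have tw: "distributional_time_divergence Q (u' i) (G' i)" if i: "i < N" for i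
    unfolding G'_def[abs_def] Q
    by (rule time_weak_form[OF SL _ sol i uS[OF i] AS[OF i] RS[OF i, unfolded R_def]])
      (use u' A' R' i QS in \<open>simp_all add: Q R_def\<close>)

  define X where "X = (\<integral>z. vnorm N (Du z) powr q \<partial>(lebesgue_on Q))"
  define Y where "Y = (\<integral>z. (vnorm N (Du z) + vnorm N (F z)) powr (p - 1) \<partial>(lebesgue_on Q))"
  define g where "g = (\<integral>w. vnorm N (\<lambda>i. G' i w) \<partial>lborel)"
  have X0: "0 \<le> X" "0 \<le> Y" "0 \<le> g" by (simp_all add: X_def Y_def g_def)
  have iG': "integrable lborel (G' i)" if "i < N" for i
    unfolding G'_def[abs_def] using A' R' that by simp

  have DX: "(\<integral>\<^sup>+w. ennreal (vnorm N (\<lambda>i. D' i w) powr q) \<partial>lborel) = ennreal X"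
  proof -
    have "AE z in lborel. \<forall>i<N. D' i z = indicator Q z *\<^sub>R Du z i"
      using D' by (intro AE_less_all) blast
    hence "AE z in lborel. ennreal (vnorm N (\<lambda>i. D' i z) powr q) = indicator Q z * ennreal (vnorm N (Du z) powr q)"
    proof eventually_elim
      case (elim z)
      have "vnorm N (\<lambda>i. D' i z) = vnorm N (\<lambda>i. indicator Q z *\<^sub>R Du z i)"
        using elim by (intro vnorm_cong) blast
      thus ?case by (cases "z \<in> Q") simp_all
    qed
    from nn_integral_lebesgue_on_borel_representative[OF QL this, symmetric]
    have "(\<integral>\<^sup>+w. ennreal (vnorm N (\<lambda>i. D' i w) powr q) \<partial>lborel) = (\<integral>\<^sup>+z. ennreal (vnorm N (Du z) powr q) \<partial>(lebesgue_on Q))" .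
    also have "\<dots> = ennreal X"
      unfolding X_def using iX by (rule nn_integral_eq_integral) simp
    finally show ?thesis .
  qed
  have gY: "g \<le> (L + 1) * Y"
  proof -
    have "AE z in lborel. \<forall>i<N. A' i z = indicator Q z *\<^sub>R A z (Du z) i"
      using A' by (intro AE_less_all) blast
    moreover have "AE z in lborel. \<forall>i<N. R' i z = indicator Q z *\<^sub>R R z i"
      using R' by (intro AE_less_all) blast
    ultimately have ae: "AE z in lborel. vnorm N (\<lambda>i. G' i z) = indicator Q z *\<^sub>R vnorm N (\<lambda>i. A z (Du z) i - R z i)"
    proof eventually_elim
      case (elim z)
      have "vnorm N (\<lambda>i. G' i z) = vnorm N (\<lambda>i. indicator Q z *\<^sub>R (A z (Du z) i - R z i))"
        using elim by (intro vnorm_cong) (simp add: G'_def scaleR_diff_right)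
      thus ?case by (simp add: vnorm_scaleR)
    qed
    have iAR: "integrable (lebesgue_on Q) (\<lambda>z. vnorm N (\<lambda>i. A z (Du z) i - R z i))"
      by (intro integrable_vnorm Bochner_Integration.integrable_diff iA iR)
    have "integrable lborel (\<lambda>z. vnorm N (\<lambda>i. G' i z))"
      by (rule integrable_vnorm) (rule iG')
    hence "(\<lambda>z. vnorm N (\<lambda>i. G' i z)) \<in> borel_measurable borel"
      using borel_measurable_integrable by fastforce
    from integral_lebesgue_on_borel_representative(1)[OF QL borel_measurable_integrable[OF iAR] this ae]
    have "g = (\<integral>z. vnorm N (\<lambda>i. A z (Du z) i - R z i) \<partial>(lebesgue_on Q))"
      unfolding g_def by (rule sym)
    also have "\<dots> \<le> (\<integral>z. (L + 1) * (vnorm N (Du z) + vnorm N (F z)) powr (p - 1) \<partial>(lebesgue_on Q))"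
    proof (rule integral_mono_AE[OF iAR integrable_mult_right[OF iY]])
      show "AE z in lebesgue_on Q. vnorm N (\<lambda>i. A z (Du z) i - R z i) \<le>
          (L + 1) * (vnorm N (Du z) + vnorm N (F z)) powr (p - 1)"
        using Agr
      proof eventually_elim
        case (elim z)
        let ?a = "vnorm N (Du z)" and ?b = "vnorm N (F z)"
        have "vnorm N (\<lambda>i. A z (Du z) i - R z i) \<le> vnorm N (A z (Du z)) + vnorm N (\<lambda>i. - R z i)"
          using vnorm_triangle[of N "A z (Du z)" "\<lambda>i. - R z i"] by simp
        also have "vnorm N (\<lambda>i. - R z i) = ?b powr (p - 1)"
          using R_norm[of z] by (simp add: vnorm_def)
        also have "vnorm N (A z (Du z)) \<le> L * ?a powr (p - 1)" by (rule elim)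
        also have "L * ?a powr (p - 1) \<le> L * (?a + ?b) powr (p - 1)"
          using L p by (intro mult_left_mono powr_mono2) auto
        also have "?b powr (p - 1) \<le> (?a + ?b) powr (p - 1)"
          using p by (intro powr_mono2) auto
        finally show ?case by (simp add: distrib_right)
      qed
    qed
    also have "\<dots> = (L + 1) * Y" unfolding Y_def by (rule integral_mult_right_zero)
    finally show ?thesis .
  qed

  define K where "K = (2 * (C / (\<rho> / 2) ^ n) * (2 * \<rho>) powr q * 2 ^ n) * (\<omega> * \<rho> ^ n) * X +
     m * (C / (\<rho> / 2) ^ Suc n * g) powr q"
  have K0: "0 \<le> K" using C \<rho> \<omega>0 X0 m0 by (simp add: K_def)
  have osc: "(\<integral>\<^sup>+z. (\<integral>\<^sup>+z'. indicator Q z * indicator Q z' *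
    ennreal (vnorm N (\<lambda>i. u' i z - u' i z') powr q) \<partial>lborel) \<partial>lborel) \<le> ennreal (3 powr q * m * K)"
  proof -
    have "(\<integral>\<^sup>+z. (\<integral>\<^sup>+z'. indicator Q z * indicator Q z' *
      ennreal (vnorm N (\<lambda>i. u' i z - u' i z') powr q) \<partial>lborel) \<partial>lborel) \<le>
      ennreal (3 powr q) * emeasure lborel Q *
      (ennreal (2 * (C / (\<rho> / 2) ^ DIM(real^'n)) * (2 * \<rho>) powr q * 2 ^ DIM(real^'n)) * emeasure lborel ?B *
         (\<integral>\<^sup>+w. ennreal (vnorm N (\<lambda>i. D' i w) powr q) \<partial>lborel) +
       emeasure lborel Q * ennreal ((C / (\<rho> / 2) ^ Suc DIM(real^'n) * (\<integral>w. vnorm N (\<lambda>i. G' i w) \<partial>lborel)) powr q))"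
      by (rule oscillation_bound[OF Q \<rho> s0 _ _ iG' sw tw q \<eta>]) (use u' D' in blast)+
    also have "\<dots> = ennreal (3 powr q * m * K)"
    proof -
      have ring: "ennreal t * ennreal m * (ennreal a * ennreal b * ennreal X + ennreal m * ennreal d) =
          ennreal (t * m * (a * b * X + m * d))" if "0 \<le> t" "0 \<le> a" "0 \<le> b" "0 \<le> d" for t a b d
        using that X0 m0 by (simp add: ennreal_mult)
      show ?thesis
        unfolding eQ eB DX g_def[symmetric] n_def[symmetric] K_def
        by (rule ring) (use C \<rho> \<omega>0 in auto)
    qed
    finally show ?thesis .
  qed
  have um': "u' i \<in> borel_measurable borel" if "i < N" for i
    using u' that borel_measurable_integrable[of lborel "u' i"] by simp
  (* The mean of the representative is the mean of u, as a null set does not matter. *)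
  have mean: "(\<integral>w. indicator Q w * u' i w \<partial>lborel) / m = vavg Q u i" if i: "i < N" for i
  proof -
    have ae: "AE z in lborel. u' i z = indicator Q z *\<^sub>R u z i" using u' i by blast
    have "AE w in lborel. indicator Q w * u' i w = u' i w"
      using ae by eventually_elim (simp add: indicator_def)
    hence "(\<integral>w. indicator Q w * u' i w \<partial>lborel) = (\<integral>w. u' i w \<partial>lborel)"
      using um'[OF i] Qb by (intro integral_cong_AE) auto
    also have "\<dots> = integral\<^sup>L (lebesgue_on Q) (\<lambda>z. u z i)"
      by (rule integral_lebesgue_on_borel_representative(1)[OF QL onQ[OF uS[OF i]] um'[OF i] ae, symmetric])
    finally show ?thesis by (simp add: vavg_def avg)
  qed
  let ?h = "\<lambda>z. vnorm N (\<lambda>i. u z i - vavg Q u i) powr q"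
  have "(\<integral>\<^sup>+z. ennreal (?h z) \<partial>(lebesgue_on Q)) =
    (\<integral>\<^sup>+z. indicator Q z * ennreal (vnorm N (\<lambda>i. u' i z - (\<integral>w. indicator Q w * u' i w \<partial>lborel) / m) powr q) \<partial>lborel)"
  proof (rule nn_integral_lebesgue_on_borel_representative[OF QL])
    have "AE z in lborel. \<forall>i<N. u' i z = indicator Q z *\<^sub>R u z i"
      using u' by (intro AE_less_all) blast
    thus "AE z in lborel. indicator Q z * ennreal (vnorm N (\<lambda>i. u' i z - (\<integral>w. indicator Q w * u' i w \<partial>lborel) / m) powr q) =
      indicator Q z * ennreal (?h z)"
    proof eventually_elim
      case (elim z)
      show ?case
      proof (cases "z \<in> Q")
        case True
        have "vnorm N (\<lambda>i. u' i z - (\<integral>w. indicator Q w * u' i w \<partial>lborel) / m) = vnorm N (\<lambda>i. u z i - vavg Q u i)"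
          using elim True by (intro vnorm_cong) (simp add: mean)
        thus ?thesis by simp
      qed simp
    qed
  qed
  also have "\<dots> \<le> ennreal (1 / m) * (\<integral>\<^sup>+z. (\<integral>\<^sup>+z'. indicator Q z * indicator Q z' *
    ennreal (vnorm N (\<lambda>i. u' i z - u' i z') powr q) \<partial>lborel) \<partial>lborel)"
    by (rule mean_oscillation_le[OF _ Qb eQ m0 q]) (use u' in blast)
  also have "\<dots> \<le> ennreal (1 / m) * ennreal (3 powr q * m * K)"
    by (intro mult_left_mono osc) simp
  also have "\<dots> = ennreal (3 powr q * K)"
    using m0 K0 by (simp flip: ennreal_mult)
  finally have nn: "(\<integral>\<^sup>+z. ennreal (?h z) \<partial>(lebesgue_on Q)) \<le> ennreal (3 powr q * K)" .
  have h: "(\<integral>z. ?h z \<partial>(lebesgue_on Q)) \<le> 3 powr q * K"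
    by (rule integral_le_of_nn_integral_le[OF _ nn]) (use K0 in auto)
  have "avg Q (\<lambda>z. ?h z / \<rho> powr q) = (\<integral>z. ?h z \<partial>(lebesgue_on Q)) / \<rho> powr q / m"
    by (simp add: avg)
  also have "\<dots> \<le> 3 powr q * K / \<rho> powr q / m"
    using h m0 by (intro divide_right_mono) auto
  also have "\<dots> \<le> c * (X / m) + c * (lam powr (2 - p) * (Y / m)) powr q"
    unfolding K_def c_def
    by (rule cylinder_constant) (use q L C \<omega>0 \<rho> lam X0 gY m_def in auto)
  finally show ?thesis by (simp add: avg X_def Y_def)
qed

theorem lemma6p1:
  fixes q L :: real
  assumes "1 \<le> q" and "0 < L"
  shows "\<exists>c::real.
    \<forall>(p::real) (lam::real) (\<nu>::real) (T::real) (N::nat) (\<Omega> :: (real^'n) set)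
      (A :: (real^'n) \<times> real \<Rightarrow> (nat \<Rightarrow> real^'n) \<Rightarrow> nat \<Rightarrow> real^'n)
      (F :: (real^'n) \<times> real \<Rightarrow> nat \<Rightarrow> real^'n)
      (u :: (real^'n) \<times> real \<Rightarrow> nat \<Rightarrow> real)
      (Du :: (real^'n) \<times> real \<Rightarrow> nat \<Rightarrow> real^'n).
      1 < p \<and> max 1 (p - 1) \<le> q \<and> 0 < lam \<and> 0 < \<nu> \<and> \<nu> < L \<and> 0 < T \<and> 1 \<le> N \<and>
      open \<Omega> \<and> connected \<Omega> \<and> \<Omega> \<noteq> {} \<and> bounded \<Omega> \<and>
      caratheodory (\<Omega> \<times> {0<..<T}) N A \<and>
      (AE z in lebesgue_on (\<Omega> \<times> {0<..<T}). \<forall>\<xi>\<in>vecs N.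
         \<nu> * vnorm N \<xi> powr p \<le> vinner N (A z \<xi>) \<xi> \<and>
         vnorm N (A z \<xi>) \<le> L * vnorm N \<xi> powr (p - 1)) \<and>
      F \<in> (\<Omega> \<times> {0<..<T}) \<rightarrow> vecs N \<and> vmeasurable (\<Omega> \<times> {0<..<T}) N F \<and>
      Lspace_loc (\<Omega> \<times> {0<..<T}) (p - 1) N F \<and>
      parabolic_sobolev \<Omega> T q N u Du \<and>
      weak_solution (\<Omega> \<times> {0<..<T}) p N A F u Du
      \<longrightarrow>
      (\<forall>x0 t0 \<rho>. 0 < \<rho> \<and> compactly_inside (cylinder p lam x0 t0 \<rho>) (\<Omega> \<times> {0<..<T}) \<longrightarrow>
        (let Q = cylinder p lam x0 t0 \<rho> in
          avg Q (\<lambda>z. vnorm N (\<lambda>i. u z i - vavg Q u i) powr q / \<rho> powr q)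
          \<le> c * avg Q (\<lambda>z. vnorm N (Du z) powr q)
            + c * (lam powr (2 - p) *
                   avg Q (\<lambda>z. (vnorm N (Du z) + vnorm N (F z)) powr (p - 1))) powr q))"
proof -
  obtain C where C: "0 < C" "\<And>(x0::real^'n) R. 0 < R \<Longrightarrow> \<exists>\<eta>. smooth_bump x0 R C \<eta>"
    using exists_smooth_bump[where ?'a="real^'n"] by blast
  let ?n = "DIM(real^'n)" and ?\<omega> = "unit_ball_vol DIM(real^'n)"
  let ?c = "3 powr q * (2 * C * 2 ^ ?n * 2 powr q * 2 ^ ?n * ?\<omega> + ((L + 1) * C * 2 ^ (?n + 2) * ?\<omega>) powr q)"
  show ?thesis
    unfolding Let_def
  proof (intro exI[of _ ?c] allI impI)
    fix p lam \<nu> T :: real and N :: nat and \<Omega> :: "(real^'n) set" and A F u Du x0 t0 \<rho>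
    assume H: "1 < p \<and> max 1 (p - 1) \<le> q \<and> 0 < lam \<and> 0 < \<nu> \<and> \<nu> < L \<and> 0 < T \<and> 1 \<le> N \<and>
      open \<Omega> \<and> connected \<Omega> \<and> \<Omega> \<noteq> {} \<and> bounded \<Omega> \<and>
      caratheodory (\<Omega> \<times> {0<..<T}) N A \<and>
      (AE z in lebesgue_on (\<Omega> \<times> {0<..<T}). \<forall>\<xi>\<in>vecs N.
         \<nu> * vnorm N \<xi> powr p \<le> vinner N (A z \<xi>) \<xi> \<and>
         vnorm N (A z \<xi>) \<le> L * vnorm N \<xi> powr (p - 1)) \<and>
      F \<in> (\<Omega> \<times> {0<..<T}) \<rightarrow> vecs N \<and> vmeasurable (\<Omega> \<times> {0<..<T}) N F \<and>
      Lspace_loc (\<Omega> \<times> {0<..<T}) (p - 1) N F \<and>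
      parabolic_sobolev \<Omega> T q N u Du \<and>
      weak_solution (\<Omega> \<times> {0<..<T}) p N A F u Du"
      and cyl: "0 < \<rho> \<and> compactly_inside (cylinder p lam x0 t0 \<rho>) (\<Omega> \<times> {0<..<T})"
    have "AE z in lebesgue_on (\<Omega> \<times> {0<..<T}). \<forall>\<xi>\<in>vecs N.
         \<nu> * vnorm N \<xi> powr p \<le> vinner N (A z \<xi>) \<xi> \<and> vnorm N (A z \<xi>) \<le> L * vnorm N \<xi> powr (p - 1)"
      using H by blast
    hence "AE z in lebesgue_on (\<Omega> \<times> {0<..<T}). \<forall>\<xi>\<in>vecs N. vnorm N (A z \<xi>) \<le> L * vnorm N \<xi> powr (p - 1)"
      by eventually_elim blast
    moreover have "p - 1 \<le> q"
    proof -
      have "max 1 (p - 1) \<le> q" using H by blast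
      thus ?thesis by simp
    qed
    moreover obtain \<eta> where "smooth_bump x0 (\<rho> / 2) C \<eta>"
      using C(2)[of "\<rho> / 2" x0] cyl by auto
    ultimately show "avg (cylinder p lam x0 t0 \<rho>) (\<lambda>z. vnorm N (\<lambda>i. u z i - vavg (cylinder p lam x0 t0 \<rho>) u i) powr q / \<rho> powr q)
          \<le> ?c * avg (cylinder p lam x0 t0 \<rho>) (\<lambda>z. vnorm N (Du z) powr q)
            + ?c * (lam powr (2 - p) *
                   avg (cylinder p lam x0 t0 \<rho>) (\<lambda>z. (vnorm N (Du z) + vnorm N (F z)) powr (p - 1))) powr q"
      using H cyl assms C(1) by (intro weak_solution_cylinder_poincare) ((elim conjE)?, assumption)+
  qed
qed

end
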